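(* Let $G$ be a finite simple connected graph which is complete intersection. Then every minimal generator of $I_G$ is a circuit, i.e. (up to sign) of the form $B_w$ where $w$ is either an even cycle, or two odd cycles intersecting in exactly one vertex, or two vertex-disjoint odd cycles joined by a path.
   Context: For a finite simple graph $G$ with edges $e_1,\dots,e_m$ and a field $K$, the toric ideal $I_G\subseteq K[e_1,\dots,e_m]$ is the kernel of the $K$-algebra map $e_i=\{v_j,v_k\}\mapsto v_jv_k$; $G$ is complete intersection if $I_G$ is generated by $\operatorname{ht}(I_G)$ elements. A minimal generator of $I_G$ is a binomial belonging to at least one minimal system of binomial generators of $I_G$. For an even closed walk $w=(e_{i_1},\dots,e_{i_{2q}})$, $B_w=\prod_{k=1}^q e_{i_{2k-1}}-\prod_{k=1}^q e_{i_{2k}}$. A circuit of $I_G$ is an irreducible binomial of $I_G$ with minimal support; these are exactly the binomials $B_w$ for $w$ an even cycle, two odd cycles intersecting in exactly one vertex (traversed as a closed walk), or two vertex-disjoint odd cycles joined by a path (traversed as closed walk going through the path twice). *)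

theory Defs
  imports Main "HOL-Library.Poly_Mapping" "HOL-Library.Extended_Nat"
begin

definition is_ideal :: "'a::comm_ring_1 set \<Rightarrow> bool" where
  "is_ideal I \<longleftrightarrow> 0 \<in> I \<and> (\<forall>x\<in>I. \<forall>y\<in>I. x + y \<in> I) \<and> (\<forall>r. \<forall>x\<in>I. r * x \<in> I)"

definition gen_ideal :: "'a::comm_ring_1 set \<Rightarrow> 'a set" where
  "gen_ideal S = {x. \<exists>F c. finite F \<and> F \<subseteq> S \<and> x = (\<Sum>s\<in>F. c s * s)}"

definition is_prime_ideal :: "'a::comm_ring_1 set \<Rightarrow> bool" where
  "is_prime_ideal P \<longleftrightarrow> is_ideal P \<and> P \<noteq> UNIV \<and> (\<forall>a b. a * b \<in> P \<longrightarrow> a \<in> P \<or> b \<in> P)"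

definition prime_height :: "'a::comm_ring_1 set \<Rightarrow> enat" where
  "prime_height P = Sup {enat n | n. \<exists>ch :: nat \<Rightarrow> 'a set.
      (\<forall>i\<le>n. is_prime_ideal (ch i)) \<and> (\<forall>i<n. ch i \<subset> ch (Suc i)) \<and> ch n = P}"

definition ideal_height :: "'a::comm_ring_1 set \<Rightarrow> enat" where
  "ideal_height I = Inf {prime_height P | P. is_prime_ideal P \<and> I \<subseteq> P}"

type_synonym ('x, 'k) mpoly = "('x \<Rightarrow>\<^sub>0 nat) \<Rightarrow>\<^sub>0 'k"

definition monom :: "('x \<Rightarrow>\<^sub>0 nat) \<Rightarrow> ('x, 'k::field) mpoly" where
  "monom a = Poly_Mapping.single a 1"

definition is_binomial :: "('x, 'k::field) mpoly \<Rightarrow> bool" where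
  "is_binomial p \<longleftrightarrow> (\<exists>u v. p = monom u - monom v)"

text \<open>A finite simple graph: vertex set = UNIV of a finite type 'v, edge set = UNIV of a
  finite type 'e, with an injective endpoint map assigning to each edge a 2-element set.\<close>
definition simple_graph :: "('e::finite \<Rightarrow> 'v::finite set) \<Rightarrow> bool" where
  "simple_graph ends \<longleftrightarrow> inj ends \<and> (\<forall>e. card (ends e) = 2)"

definition is_walk :: "('e \<Rightarrow> 'v set) \<Rightarrow> 'v list \<Rightarrow> 'e list \<Rightarrow> bool" where
  "is_walk ends vs es \<longleftrightarrow> length vs = Suc (length es) \<and>
     (\<forall>i<length es. ends (es ! i) = {vs ! i, vs ! Suc i})"

definition connected_graph :: "('e \<Rightarrow> 'v set) \<Rightarrow> bool" where
  "connected_graph ends \<longleftrightarrow>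
     (\<forall>u v. \<exists>vs es. is_walk ends vs es \<and> hd vs = u \<and> last vs = v)"

text \<open>Toric map: e \<mapsto> product of the endpoints of e, extended K-linearly.\<close>
definition mono_image :: "('e \<Rightarrow> 'v set) \<Rightarrow> ('e \<Rightarrow>\<^sub>0 nat) \<Rightarrow> ('v \<Rightarrow>\<^sub>0 nat)" where
  "mono_image ends a = (\<Sum>e\<in>Poly_Mapping.keys a. (\<Sum>v\<in>ends e. Poly_Mapping.single v (Poly_Mapping.lookup a e)))"

definition toric_map :: "('e \<Rightarrow> 'v set) \<Rightarrow> ('e, 'k::field) mpoly \<Rightarrow> ('v, 'k) mpoly" where
  "toric_map ends p = (\<Sum>a\<in>Poly_Mapping.keys p. Poly_Mapping.single (mono_image ends a) (Poly_Mapping.lookup p a))"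

definition toric_ideal :: "('e \<Rightarrow> 'v set) \<Rightarrow> ('e, 'k::field) mpoly set" where
  "toric_ideal ends = {p. toric_map ends p = 0}"

definition complete_intersection :: "('e \<Rightarrow> 'v set) \<Rightarrow> 'k::field itself \<Rightarrow> bool" where
  "complete_intersection ends TYPE('k) \<longleftrightarrow>
     (\<exists>gs :: ('e, 'k) mpoly list. gen_ideal (set gs) = toric_ideal ends
        \<and> enat (length gs) = ideal_height (toric_ideal ends :: ('e, 'k) mpoly set))"

definition minimal_binomial_system :: "('x, 'k::field) mpoly set \<Rightarrow> ('x, 'k) mpoly set \<Rightarrow> bool" where
  "minimal_binomial_system I B \<longleftrightarrow> (\<forall>b\<in>B. is_binomial b) \<and> gen_ideal B = I \<and>
     (\<forall>B'. B' \<subset> B \<longrightarrow> gen_ideal B' \<noteq> I)"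

definition minimal_generator :: "('x, 'k::field) mpoly set \<Rightarrow> ('x, 'k) mpoly \<Rightarrow> bool" where
  "minimal_generator I p \<longleftrightarrow> (\<exists>B. minimal_binomial_system I B \<and> p \<in> B)"

text \<open>Monomial of a list of edges, and B_w for an even closed walk (e_1,...,e_2q):
  product of odd-position edges minus product of even-position edges (1-indexed).\<close>
definition list_mono :: "'e list \<Rightarrow> ('e \<Rightarrow>\<^sub>0 nat)" where
  "list_mono es = (\<Sum>i<length es. Poly_Mapping.single (es ! i) 1)"

definition walk_binomial :: "'e list \<Rightarrow> ('e, 'k::field) mpoly" where
  "walk_binomial es =
     monom (list_mono (map (\<lambda>i. es ! i) (filter even [0..<length es])))
   - monom (list_mono (map (\<lambda>i. es ! i) (filter odd [0..<length es])))"

definition cycle_vs :: "'v list \<Rightarrow> bool" where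
  "cycle_vs c \<longleftrightarrow> length c \<ge> 4 \<and> hd c = last c \<and> distinct (tl c)"

definition cycle_len :: "'v list \<Rightarrow> nat" where
  "cycle_len c = length c - 1"

definition even_cycle_walk :: "'v list \<Rightarrow> bool" where
  "even_cycle_walk vs \<longleftrightarrow> cycle_vs vs \<and> even (cycle_len vs)"

definition two_odd_cycles_vertex :: "'v list \<Rightarrow> bool" where
  "two_odd_cycles_vertex vs \<longleftrightarrow> (\<exists>c1 c2.
     cycle_vs c1 \<and> cycle_vs c2 \<and> odd (cycle_len c1) \<and> odd (cycle_len c2) \<and>
     hd c2 = hd c1 \<and> set c1 \<inter> set c2 = {hd c1} \<and> vs = c1 @ tl c2)"

definition two_odd_cycles_path :: "'v list \<Rightarrow> bool" where
  "two_odd_cycles_path vs \<longleftrightarrow> (\<exists>c1 p c2.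
     cycle_vs c1 \<and> cycle_vs c2 \<and> odd (cycle_len c1) \<and> odd (cycle_len c2) \<and>
     set c1 \<inter> set c2 = {} \<and>
     length p \<ge> 2 \<and> distinct p \<and> hd p = hd c1 \<and> last p = hd c2 \<and>
     set p \<inter> set c1 = {hd p} \<and> set p \<inter> set c2 = {last p} \<and>
     vs = c1 @ tl p @ tl c2 @ tl (rev p))"

end

theory Submission
  imports Defs "HOL-Library.FuncSet" "HOL-Library.Cardinality"
begin

text \<open>The height bound has to hold for an arbitrary chain of primes ending at I_G. An element
  taken from each strict inclusion behaves like a new variable; together with the variables at a set
  Y of edges whose columns in the incidence matrix are independent, a chain of length n gives n +
  |Y| independent directions. Counting how many products of these fit into a box of exponents shows
  that there are at most |E| directions, so n is at most |E| - |Y|. The obstacle afterwards is that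
  independence of the rows says little about a single binomial. It becomes usable because two
  monomials of one fibre are joined by moves: an invariant kept by the moves restricts which rows
  can occur in their difference, and independence makes this expression unique. The forbidden
  submatrices are then used as the absence of directed cycles of rows: one edge per arc of a cycle
  gives as many columns as rows. Proportionality enters the graph theory through one consequence: a
  kernel vector given by non-negative weights along w, positive on the first step, has a non-zero
  factor, so the steps of non-zero weight touch every vertex of w. Thus P and P' have the same inner
  vertices, and the order is settled by the visits not crossing.\<close>

text \<open>
  A chain of primes below \<open>I\<^sub>G\<close> raises the transcendence degree at each step, so the height of
  \<open>I\<^sub>G\<close> is at most the rank of the lattice \<open>L\<close> of integer kernel vectors of the incidence matrix.
  By graded Nakayama, in the complete intersection case the exponent vectors (rows) of a minimal
  system of binomials are therefore linearly independent. Since the fibres are connected by these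
  binomials, independence forbids square submatrices of the rows whose rows all have both signs; it
  follows that a vector of \<open>L\<close> supported on the support of a minimal generator \<open>x\<^sup>a - x\<^sup>b\<close>, once
  restricted to the support of \<open>a\<close>, has degree proportional to that of \<open>a\<close>.

  Independence also makes \<open>x\<^sup>a - x\<^sup>b\<close> primitive, so it is \<open>B\<^sub>w\<close> for an alternating closed walk \<open>w\<close>
  which visits a vertex at most twice, with opposite parities, and whose pairs of visits do not
  cross. If \<open>w\<close> is not an even cycle, it splits as \<open>O\<^sub>1 P O\<^sub>2 P'\<close> with odd cycles \<open>O\<^sub>1\<close>, \<open>O\<^sub>2\<close>, and the
  proportionality applied to the kernel vectors \<open>O\<^sub>1 + 2 P + O\<^sub>2\<close> and \<open>O\<^sub>1 + 2 P' + O\<^sub>2\<close> forces \<open>P'\<close>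
  to be the reverse of \<open>P\<close>.
\<close>

subsection \<open>Linear systems and finitely supported functions\<close>

text \<open>Elimination, one equation at a time. It is the dimension count behind the height bound,
  graded Nakayama, the independence of the rows and \<open>few_mixed_rows\<close>.\<close>

lemma underdetermined_system:
  fixes M :: "'t \<Rightarrow> 'j \<Rightarrow> 'k::field"
  assumes "finite J" "finite T" "card J < card T"
  shows "\<exists>c. (\<exists>t\<in>T. c t \<noteq> 0) \<and> (\<forall>j\<in>J. (\<Sum>t\<in>T. c t * M t j) = 0)"
  using assms
proof (induction J arbitrary: T M rule: finite_induct)
  case empty
  then obtain t where "t \<in> T"
    by fastforce
  then show ?case
    by (intro exI[of _ "\<lambda>_. 1"]) auto
next
  case (insert j J)
  show ?case
  proof (cases "\<forall>t\<in>T. M t j = 0")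
    case True
    have "card J < card T"
      using insert by simp
    from insert.IH[OF insert.prems(1) this, of M] True show ?thesis
      by auto
  next
    case False
    then obtain s where s: "s \<in> T" "M s j \<noteq> 0"
      by blast
    define T' where "T' = T - {s}"
    have T: "T = insert s T'" "s \<notin> T'" "finite T'"
      using s insert.prems by (auto simp: T'_def)
    have "card J < card T'"
      using insert T by simp
    from insert.IH[OF T(3) this, of "\<lambda>t i. M t i - M t j / M s j * M s i"]
    obtain c where c: "\<exists>t\<in>T'. c t \<noteq> 0"
      "\<And>i. i \<in> J \<Longrightarrow> (\<Sum>t\<in>T'. c t * (M t i - M t j / M s j * M s i)) = 0"
      by blast
    \<comment> \<open>The value at the pivot \<open>s\<close> is forced by equation
      \<open>j\<close>; the other equations then become those already solved by
      \<open>c\<close>.\<close>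
    define d where "d = c(s := - (\<Sum>t\<in>T'. c t * M t j) / M s j)"
    have dT': "(\<Sum>t\<in>T'. d t * M t i) = (\<Sum>t\<in>T'. c t * M t i)" for i
      using T(2) by (intro sum.cong) (auto simp: d_def)
    have "(\<Sum>t\<in>T. d t * M t i) = (\<Sum>t\<in>T'. c t * (M t i - M t j / M s j * M s i))" for i
    proof -
      have "(\<Sum>t\<in>T. d t * M t i) = d s * M s i + (\<Sum>t\<in>T'. c t * M t i)"
        using T dT' by simp
      moreover have "d s * M s i = - (\<Sum>t\<in>T'. c t * (M t j / M s j * M s i))"
        by (simp add: d_def sum_distrib_right sum_divide_distrib mult.assoc)
      ultimately show ?thesis
        by (simp add: right_diff_distrib sum_subtractf)
    qed
    then have "(\<Sum>t\<in>T. d t * M t i) = 0" if "i \<in> insert j J" for i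
      using that c s by auto
    moreover have "\<exists>t\<in>T. d t \<noteq> 0"
      using c(1) T by (auto simp: d_def)
    ultimately show ?thesis
      by blast
  qed
qed

abbreviation lookup :: "('x \<Rightarrow>\<^sub>0 'c::zero) \<Rightarrow> 'x \<Rightarrow> 'c" where
  "lookup \<equiv> Poly_Mapping.lookup"

lemma poly_mapping_sum_singles:
  "p = (\<Sum>a\<in>Poly_Mapping.keys p. Poly_Mapping.single a (lookup p a))"
proof (rule poly_mapping_eqI)
  fix k
  show "lookup p k = lookup (\<Sum>a\<in>Poly_Mapping.keys p. Poly_Mapping.single a (lookup p a)) k"
    by (auto simp: lookup_sum lookup_single when_def in_keys_iff)
qed

lemma poly_mapping_additive_induct [case_names zero single add]:
  fixes p :: "'a \<Rightarrow>\<^sub>0 'b::comm_monoid_add"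
  assumes "P 0" "\<And>a c. P (Poly_Mapping.single a c)" "\<And>p q. P p \<Longrightarrow> P q \<Longrightarrow> P (p + q)"
  shows "P p"
proof -
  have "P (\<Sum>a\<in>F. Poly_Mapping.single a (lookup p a))" if "finite F" for F
    using that by induction (auto intro: assms)
  then show ?thesis
    by (subst poly_mapping_sum_singles) auto
qed

text \<open>For additive \<open>h\<close> this is the induced homomorphism of monoid algebras, such
  as the toric map. Stated for any \<open>h\<close>, it also covers predicates, where it adds up the
  coefficients over a set of monomials.\<close>

definition pushforward :: "('a \<Rightarrow> 'b) \<Rightarrow> ('a \<Rightarrow>\<^sub>0 'k) \<Rightarrow> ('b \<Rightarrow>\<^sub>0 'k::comm_monoid_add)" where
  "pushforward h p = (\<Sum>a\<in>Poly_Mapping.keys p. Poly_Mapping.single (h a) (lookup p a))"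

lemma pushforward_superset:
  assumes "finite A" "Poly_Mapping.keys p \<subseteq> A"
  shows "pushforward h p = (\<Sum>a\<in>A. Poly_Mapping.single (h a) (lookup p a))"
  unfolding pushforward_def using assms
  by (intro sum.mono_neutral_left) (auto simp: in_keys_iff)

lemma pushforward_add: "pushforward h (p + q) = pushforward h p + pushforward h q"
proof -
  let ?A = "Poly_Mapping.keys p \<union> Poly_Mapping.keys q"
  have "Poly_Mapping.keys (p + q) \<subseteq> ?A"
    by (rule keys_add)
  then show ?thesis
    by (simp add: pushforward_superset[of ?A] lookup_add single_add sum.distrib)
qed

lemma pushforward_0 [simp]: "pushforward h 0 = 0"
  by (simp add: pushforward_def)

lemma pushforward_single [simp]:
  "pushforward h (Poly_Mapping.single a c) = Poly_Mapping.single (h a) c"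
  by (subst pushforward_superset[of "{a}"]) auto

lemma pushforward_mult:
  fixes p :: "('a::comm_monoid_add) \<Rightarrow>\<^sub>0 'k::comm_semiring_0"
    and h :: "'a \<Rightarrow> 'b::comm_monoid_add"
  assumes "\<And>a b. h (a + b) = h a + h b"
  shows "pushforward h (p * q) = pushforward h p * pushforward h q"
proof (induction p rule: poly_mapping_additive_induct)
  case (single a c)
  show ?case
    by (induction q rule: poly_mapping_additive_induct)
      (auto simp: mult_single assms pushforward_add distrib_left)
qed (auto simp: pushforward_add distrib_right)

lemma lookup_pushforward:
  "lookup (pushforward h p) b = (\<Sum>a | a \<in> Poly_Mapping.keys p \<and> h a = b. lookup p a)"
  by (simp add: pushforward_def lookup_sum lookup_single when_def sum.inter_filter)

text \<open>The kernel depends only on the partition of the exponents into fibres of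
  \<open>h\<close>, so the target of the toric map may be changed.\<close>

lemma pushforward_eq_0_cong:
  assumes "\<And>a b. h a = h b \<longleftrightarrow> h' a = h' b"
  shows "pushforward h p = 0 \<longleftrightarrow> pushforward h' p = 0"
proof -
  have aux: "pushforward h p = 0 \<longleftrightarrow>
      (\<forall>b. (\<Sum>a | a \<in> Poly_Mapping.keys p \<and> h a = h b. lookup p a) = 0)" for h :: "'a \<Rightarrow> 'x"
  proof
    assume *: "\<forall>b. (\<Sum>a | a \<in> Poly_Mapping.keys p \<and> h a = h b. lookup p a) = 0"
    show "pushforward h p = 0"
    proof (rule poly_mapping_eqI)
      fix c
      show "lookup (pushforward h p) c = lookup 0 c"
      proof (cases "c \<in> range h")
        case True
        then show ?thesis
          using * by (auto simp: lookup_pushforward)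
      next
        case False
        then have "{a. a \<in> Poly_Mapping.keys p \<and> h a = c} = {}"
          by auto
        then show ?thesis
          by (simp only: lookup_pushforward sum.empty lookup_zero)
      qed
    qed
  next
    assume "pushforward h p = 0"
    then show "\<forall>b. (\<Sum>a | a \<in> Poly_Mapping.keys p \<and> h a = h b. lookup p a) = 0"
      by (simp flip: lookup_pushforward)
  qed
  show ?thesis
    unfolding aux assms ..
qed

subsection \<open>The toric ideal is prime\<close>

lemma toric_map_eq: "toric_map ends = pushforward (mono_image ends)"
  by (auto simp: toric_map_def pushforward_def)

lemma lookup_mono_image:
  fixes ends :: "'e::finite \<Rightarrow> 'v::finite set"
  shows "lookup (mono_image ends a) z = (\<Sum>e | z \<in> ends e. lookup a e)"
proof -
  have "lookup (mono_image ends a) z =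
      (\<Sum>e\<in>Poly_Mapping.keys a. \<Sum>v\<in>ends e. lookup a e when v = z)"
    by (simp add: mono_image_def lookup_sum lookup_single)
  also have "\<dots> = (\<Sum>e\<in>Poly_Mapping.keys a. if z \<in> ends e then lookup a e else 0)"
    by (intro sum.cong) (auto simp: when_def)
  also have "\<dots> = (\<Sum>e\<in>UNIV. if z \<in> ends e then lookup a e else 0)"
    by (intro sum.mono_neutral_left) (auto simp: in_keys_iff)
  finally show ?thesis
    by (simp add: sum.If_cases)
qed

lemma mono_image_add:
  fixes ends :: "'e::finite \<Rightarrow> 'v::finite set"
  shows "mono_image ends (a + b) = mono_image ends a + mono_image ends b"
  by (rule poly_mapping_eqI) (simp add: lookup_mono_image lookup_add sum.distrib)

lemma binomial_in_toric_ideal_iff: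
  "monom u - monom v \<in> (toric_ideal ends :: ('e, 'k::field) mpoly set) \<longleftrightarrow>
     mono_image ends u = mono_image ends v"
proof -
  have "pushforward (mono_image ends) (monom u - monom v :: ('e, 'k) mpoly) +
      pushforward (mono_image ends) (monom v) = pushforward (mono_image ends) (monom u)"
    by (simp flip: pushforward_add)
  then have *: "toric_map ends (monom u - monom v :: ('e, 'k) mpoly) =
      monom (mono_image ends u) - monom (mono_image ends v)"
    by (simp add: toric_map_eq monom_def eq_diff_eq)
  have "monom a = (monom b :: ('v, 'k) mpoly) \<longleftrightarrow> a = b" for a b
    by (metis monom_def keys_single one_neq_zero singleton_inject)
  with * show ?thesis
    by (simp add: toric_ideal_def)
qed

text \<open>Numbering the vertices by \<open>f\<close> turns the target exponents into
  \<open>nat \<Rightarrow>\<^sub>0 nat\<close>, an ordered monoid, over which polynomials have no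
  zero divisors. The map \<open>h\<close> has the same fibres as \<open>mono_image ends\<close>,
  hence the same kernel, and a kernel of a homomorphism into a domain is prime.\<close>

lemma toric_ideal_prime:
  fixes ends :: "'e::finite \<Rightarrow> 'v::finite set"
  shows "is_prime_ideal (toric_ideal ends :: ('e, 'k::field) mpoly set)"
proof -
  obtain f :: "'v \<Rightarrow> nat" where f: "inj f"
    using finite_imp_inj_to_nat_seg[of "UNIV :: 'v set"] by auto
  define g :: "('v \<Rightarrow>\<^sub>0 nat) \<Rightarrow> (nat \<Rightarrow>\<^sub>0 nat)"
    where "g b = (\<Sum>v\<in>UNIV. Poly_Mapping.single (f v) (lookup b v))" for b
  have lg: "lookup (g b) (f v) = lookup b v" for b v
    using f by (simp add: g_def lookup_sum lookup_single when_def inj_eq eq_commute)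
  have g_inj: "g b = g c \<longleftrightarrow> b = c" for b c
    by (metis lg poly_mapping_eqI)
  define h where "h = g \<circ> mono_image ends"
  have h_add: "h (a + b) = h a + h b" for a b
    by (simp add: h_def g_def mono_image_add lookup_add single_add sum.distrib)
  have I: "p \<in> toric_ideal ends \<longleftrightarrow> pushforward h p = 0" for p :: "('e, 'k) mpoly"
    unfolding toric_ideal_def toric_map_eq mem_Collect_eq
    by (rule pushforward_eq_0_cong) (simp add: h_def g_inj)
  have "(1 :: ('e, 'k) mpoly) \<notin> toric_ideal ends"
    unfolding I single_one[symmetric] pushforward_single
    by (metis lookup_single_eq lookup_zero one_neq_zero)
  then show ?thesis
    unfolding is_prime_ideal_def is_ideal_def
    by (auto simp: I pushforward_add pushforward_mult[of h, OF h_add])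
qed

subsection \<open>The height of the toric ideal\<close>

abbreviation scalar :: "'k \<Rightarrow> ('x, 'k::field) mpoly" where
  "scalar c \<equiv> Poly_Mapping.single 0 c"

lemma lookup_scalar_mult: "lookup (scalar r * p) a = r * lookup p a"
  by (simp add: in_keys_iff Poly_Mapping.map.rep_eq when_def flip: mult_map_scale_conv_mult)

definition lin_indep_mod :: "('x, 'k::field) mpoly set \<Rightarrow> ('i \<Rightarrow> ('x, 'k) mpoly) \<Rightarrow> 'i set \<Rightarrow> bool" where
  "lin_indep_mod P G X \<longleftrightarrow> (\<forall>F c. finite F \<longrightarrow> F \<subseteq> X \<longrightarrow>
     (\<Sum>i\<in>F. scalar (c i) * G i) \<in> P \<longrightarrow> (\<forall>i\<in>F. c i = 0))"

lemma is_ideal_sum: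
  assumes "is_ideal I" "\<And>i. i \<in> F \<Longrightarrow> f i \<in> I"
  shows "(\<Sum>i\<in>F. f i) \<in> I"
  using assms(2)
proof (induction F rule: infinite_finite_induct)
  case (insert x F)
  then have "f x \<in> I" "(\<Sum>i\<in>F. f i) \<in> I"
    by auto
  with insert(1,2) assms(1) show ?case
    by (simp add: is_ideal_def)
qed (use assms(1) in \<open>auto simp: is_ideal_def\<close>)

lemma is_ideal_mult_left: "is_ideal I \<Longrightarrow> x \<in> I \<Longrightarrow> r * x \<in> I"
  by (simp add: is_ideal_def)

lemma is_ideal_add: "is_ideal I \<Longrightarrow> x \<in> I \<Longrightarrow> y \<in> I \<Longrightarrow> x + y \<in> I"
  by (simp add: is_ideal_def)

lemma is_ideal_diff:
  assumes "is_ideal I" "x \<in> I" "y \<in> I"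
  shows "x - y \<in> I"
proof -
  have "x + (- 1) * y \<in> I"
    using assms by (intro is_ideal_add is_ideal_mult_left) auto
  then show ?thesis
    by simp
qed

lemma prime_ideal_power:
  assumes "is_prime_ideal P" "z \<notin> P"
  shows "z ^ k \<notin> P"
proof (induction k)
  case 0
  have "1 \<notin> P"
  proof
    assume "1 \<in> P"
    then have "x \<in> P" for x
      using assms(1) is_ideal_mult_left[of P 1 x] by (auto simp: is_prime_ideal_def)
    with assms show False by blast
  qed
  then show ?case
    by simp
qed (use assms in \<open>auto simp: is_prime_ideal_def\<close>)

text \<open>In a relation modulo \<open>P\<close>, the lowest power of \<open>z\<close> with a
  non-zero coefficient can be divided out, as \<open>P\<close> is prime and does not contain
  \<open>z\<close>. Read modulo \<open>Q\<close>, which contains \<open>z\<close>, only the terms of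
  that lowest power survive, and they form a relation among the \<open>G\<close>.\<close>

lemma lin_indep_mod_extend:
  assumes P: "is_prime_ideal P" and Q: "is_ideal Q" and "P \<subseteq> Q" "z \<in> Q" "z \<notin> P"
    and G: "lin_indep_mod Q G X"
    and inj: "inj_on (\<lambda>x. (k x, i x)) Y" and iY: "i ` Y \<subseteq> X"
  shows "lin_indep_mod P (\<lambda>x. z ^ k x * G (i x)) Y"
  unfolding lin_indep_mod_def
proof (intro allI impI, rule ccontr)
  fix F c
  assume F: "finite F" "F \<subseteq> Y" and sumP: "(\<Sum>x\<in>F. scalar (c x) * (z ^ k x * G (i x))) \<in> P"
    and "\<not> (\<forall>x\<in>F. c x = 0)"
  define F' where "F' = {x\<in>F. c x \<noteq> 0}"
  define m where "m = Min (k ` F')"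
  have F': "finite F'" "F' \<noteq> {}" "F' \<subseteq> F"
    using F \<open>\<not> (\<forall>x\<in>F. c x = 0)\<close> by (auto simp: F'_def)
  have mle: "m \<le> k x" if "x \<in> F'" for x
    using that F' by (simp add: m_def)
  have "m \<in> k ` F'"
    unfolding m_def using F' by (intro Min_in) auto
  then obtain x0 where x0: "x0 \<in> F'" "k x0 = m"
    by blast
  let ?t = "\<lambda>x. scalar (c x) * (z ^ (k x - m) * G (i x))"
  have "(\<Sum>x\<in>F. scalar (c x) * (z ^ k x * G (i x))) = (\<Sum>x\<in>F'. scalar (c x) * (z ^ k x * G (i x)))"
    using F by (intro sum.mono_neutral_right) (auto simp: F'_def)
  also have "\<dots> = (\<Sum>x\<in>F'. z ^ m * ?t x)"
  proof (intro sum.cong refl)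
    fix x
    assume "x \<in> F'"
    then have "z ^ k x = z ^ m * z ^ (k x - m)"
      using mle by (simp flip: power_add)
    then show "scalar (c x) * (z ^ k x * G (i x)) = z ^ m * ?t x"
      by (simp add: mult_ac)
  qed
  finally have "z ^ m * (\<Sum>x\<in>F'. ?t x) \<in> P"
    using sumP by (simp add: sum_distrib_left)
  then have "(\<Sum>x\<in>F'. ?t x) \<in> Q"
    using P prime_ideal_power[OF P \<open>z \<notin> P\<close>, of m] \<open>P \<subseteq> Q\<close> by (auto simp: is_prime_ideal_def)
  define F0 where "F0 = {x\<in>F'. k x = m}"
  have "(\<Sum>x\<in>F'-F0. ?t x) \<in> Q"
  proof (rule is_ideal_sum[OF Q])
    fix x
    assume "x \<in> F' - F0"
    then have "k x - m = Suc (k x - m - 1)"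
      using mle[of x] by (auto simp: F0_def)
    then have "z ^ (k x - m) = z * z ^ (k x - m - 1)"
      by (metis power_Suc)
    then have "?t x = (scalar (c x) * z ^ (k x - m - 1) * G (i x)) * z"
      by (simp add: mult_ac)
    also have "\<dots> \<in> Q"
      using Q \<open>z \<in> Q\<close> by (rule is_ideal_mult_left)
    finally show "?t x \<in> Q" .
  qed
  then have "(\<Sum>x\<in>F'. ?t x) - (\<Sum>x\<in>F'-F0. ?t x) \<in> Q"
    by (rule is_ideal_diff[OF Q \<open>(\<Sum>x\<in>F'. ?t x) \<in> Q\<close>])
  moreover have "(\<Sum>x\<in>F'. ?t x) = (\<Sum>x\<in>F'-F0. ?t x) + (\<Sum>x\<in>F0. ?t x)"
    using F' by (intro sum.subset_diff) (auto simp: F0_def)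
  ultimately have "(\<Sum>x\<in>F0. ?t x) \<in> Q"
    by simp
  moreover have "(\<Sum>x\<in>F0. ?t x) = (\<Sum>x\<in>F0. scalar (c x) * G (i x))"
    by (intro sum.cong) (auto simp: F0_def)
  ultimately have 1: "(\<Sum>x\<in>F0. scalar (c x) * G (i x)) \<in> Q"
    by simp
  have inj0: "inj_on i F0"
  proof (rule inj_onI)
    fix x y
    assume "x \<in> F0" "y \<in> F0" "i x = i y"
    then have "(k x, i x) = (k y, i y)" "x \<in> Y" "y \<in> Y"
      using F F' by (auto simp: F0_def)
    with inj show "x = y"
      by (rule inj_onD)
  qed
  have "(\<Sum>y\<in>i ` F0. scalar (c (the_inv_into F0 i y)) * G y) = (\<Sum>x\<in>F0. scalar (c x) * G (i x))"
    using inj0 by (simp add: sum.reindex the_inv_into_f_f)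
  with 1 have "(\<Sum>y\<in>i ` F0. scalar (c (the_inv_into F0 i y)) * G y) \<in> Q"
    by simp
  moreover have "finite (i ` F0)" "i ` F0 \<subseteq> X"
    using F F' iY by (auto simp: F0_def)
  ultimately have "\<forall>y\<in>i ` F0. c (the_inv_into F0 i y) = 0"
    using G[unfolded lin_indep_mod_def, rule_format, of "i ` F0" "\<lambda>y. c (the_inv_into F0 i y)"] by blast
  then have "c x0 = 0"
    using x0 inj0 by (auto simp: F0_def the_inv_into_f_f)
  with x0 show False
    by (simp add: F'_def)
qed

lemma lin_indep_mod_cong:
  assumes "lin_indep_mod P G X" "\<And>x. x \<in> X \<Longrightarrow> G x = H x"
  shows "lin_indep_mod P H X"
  unfolding lin_indep_mod_def
proof (intro allI impI)
  fix F c
  assume F: "finite F" "F \<subseteq> X" "(\<Sum>i\<in>F. scalar (c i) * H i) \<in> P"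
  have "(\<Sum>i\<in>F. scalar (c i) * G i) = (\<Sum>i\<in>F. scalar (c i) * H i)"
    using F(2) assms(2) by (intro sum.cong refl) (simp add: subset_iff)
  with F(3) have "(\<Sum>i\<in>F. scalar (c i) * G i) \<in> P"
    by (simp only:)
  with F(1,2) assms(1)[unfolded lin_indep_mod_def, rule_format, of F c] show "\<forall>i\<in>F. c i = 0"
    by blast
qed

definition monomial_product :: "('x, 'k::field) mpoly list \<Rightarrow> nat list \<times> ('x \<Rightarrow>\<^sub>0 nat) \<Rightarrow> ('x, 'k) mpoly" where
  "monomial_product zs = (\<lambda>(ks, \<beta>). prod_list (map2 (^) zs ks) * monom \<beta>)"

text \<open>Descending from the top of the chain, each strict inclusion supplies an element whose
  powers are adjoined by \<open>lin_indep_mod_extend\<close>. This takes the place of a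
  transcendence degree: at \<open>j = n\<close> there are \<open>n\<close> elements independent
  together with the variables in \<open>Y\<close>.\<close>

lemma prime_chain_lin_indep:
  fixes ch :: "nat \<Rightarrow> ('x, 'k::field) mpoly set"
  assumes prime: "\<And>i. i \<le> n \<Longrightarrow> is_prime_ideal (ch i)"
    and chain: "\<And>i. i < n \<Longrightarrow> ch i \<subset> ch (Suc i)"
    and base: "lin_indep_mod (ch n) monom {\<beta>. Poly_Mapping.keys \<beta> \<subseteq> Y}"
    and "j \<le> n"
  shows "\<exists>zs. length zs = j \<and> lin_indep_mod (ch (n - j)) (monomial_product zs)
           {(ks, \<beta>). length ks = j \<and> Poly_Mapping.keys \<beta> \<subseteq> Y}"
  using \<open>j \<le> n\<close>
proof (induction j)
  case 0
  have "lin_indep_mod (ch n) (monomial_product []) {(ks, \<beta>). length ks = 0 \<and> Poly_Mapping.keys \<beta> \<subseteq> Y}"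
    unfolding lin_indep_mod_def
  proof (intro allI impI)
    fix F :: "(nat list \<times> ('x \<Rightarrow>\<^sub>0 nat)) set" and c
    assume F: "finite F" "F \<subseteq> {(ks, \<beta>). length ks = 0 \<and> Poly_Mapping.keys \<beta> \<subseteq> Y}"
      and s: "(\<Sum>i\<in>F. scalar (c i) * monomial_product [] i) \<in> ch n"
    have F_eq: "F = Pair [] ` (snd ` F)"
      using F by force
    have "(\<Sum>i\<in>F. scalar (c i) * monomial_product [] i) = (\<Sum>\<beta>\<in>snd ` F. scalar (c ([], \<beta>)) * monom \<beta>)"
      by (subst F_eq, subst sum.reindex) (auto simp: monomial_product_def inj_on_def)
    with s have "(\<Sum>\<beta>\<in>snd ` F. scalar (c ([], \<beta>)) * monom \<beta>) \<in> ch n"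
      by simp
    moreover have "finite (snd ` F)" "snd ` F \<subseteq> {\<beta>. Poly_Mapping.keys \<beta> \<subseteq> Y}"
      using F by force+
    ultimately have "\<forall>\<beta>\<in>snd ` F. c ([], \<beta>) = 0"
      using base[unfolded lin_indep_mod_def, rule_format, of "snd ` F" "\<lambda>\<beta>. c ([], \<beta>)"] by blast
    then show "\<forall>i\<in>F. c i = 0"
      using F by force
  qed
  then show ?case
    by auto
next
  case (Suc j)
  then obtain zs where zs: "length zs = j" "lin_indep_mod (ch (n - j)) (monomial_product zs)
           {(ks, \<beta>). length ks = j \<and> Poly_Mapping.keys \<beta> \<subseteq> Y}"
    by auto
  have nj: "n - j = Suc (n - Suc j)"
    using Suc by auto
  have "ch (n - Suc j) \<subset> ch (n - j)"
    using chain[of "n - Suc j"] Suc nj by auto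
  then obtain z where z: "z \<in> ch (n - j)" "z \<notin> ch (n - Suc j)" "ch (n - Suc j) \<subseteq> ch (n - j)"
    by blast
  let ?X = "{(ks :: nat list, \<beta> :: 'x \<Rightarrow>\<^sub>0 nat). length ks = Suc j \<and> Poly_Mapping.keys \<beta> \<subseteq> Y}"
  let ?k = "\<lambda>x. hd (fst x)" and ?i = "\<lambda>x. (tl (fst x), snd x)"
  have inj: "inj_on (\<lambda>x. (?k x, ?i x)) ?X"
  proof (rule inj_onI)
    fix x y
    assume "x \<in> ?X" "y \<in> ?X" and eq: "(?k x, ?i x) = (?k y, ?i y)"
    then have "fst x \<noteq> []" "fst y \<noteq> []"
      by (auto split: prod.splits)
    then have "fst x = fst y"
      using eq by (intro list.expand) auto
    with eq show "x = y"
      by (simp add: prod_eq_iff)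
  qed
  have sub: "?i ` ?X \<subseteq> {(ks, \<beta>). length ks = j \<and> Poly_Mapping.keys \<beta> \<subseteq> Y}"
    by auto
  have "is_prime_ideal (ch (n - Suc j))" and "is_ideal (ch (n - j))"
    using prime[of "n - Suc j"] prime[of "n - j"] by (auto simp: is_prime_ideal_def)
  from lin_indep_mod_extend[OF this z(3,1,2) zs(2) inj sub]
  have "lin_indep_mod (ch (n - Suc j)) (\<lambda>x. z ^ ?k x * monomial_product zs (?i x)) ?X" .
  moreover have "z ^ ?k x * monomial_product zs (?i x) = monomial_product (z # zs) x" if "x \<in> ?X" for x
  proof -
    obtain l \<beta> where x: "x = (l, \<beta>)"
      by (cases x)
    with that obtain k ks where "l = k # ks"
      by (cases l) simp_all
    with x show ?thesis
      by (simp add: monomial_product_def mult.assoc)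
  qed
  ultimately have "lin_indep_mod (ch (n - Suc j)) (monomial_product (z # zs)) ?X"
    by (rule lin_indep_mod_cong)
  then show ?case
    using zs(1) by (intro exI[of _ "z # zs"]) simp
qed

section \<open>Counting products inside a box of exponents\<close>

definition exponents_le :: "nat \<Rightarrow> ('x, 'k::field) mpoly \<Rightarrow> bool" where
  "exponents_le d p \<longleftrightarrow> (\<forall>a\<in>Poly_Mapping.keys p. \<forall>x. lookup a x \<le> d)"

lemma exponents_le_mult:
  assumes "exponents_le d p" "exponents_le d' q"
  shows "exponents_le (d + d') (p * q)"
  unfolding exponents_le_def
proof (intro ballI allI)
  fix a x
  assume "a \<in> Poly_Mapping.keys (p * q)"
  then obtain b c where "b \<in> Poly_Mapping.keys p" "c \<in> Poly_Mapping.keys q" "a = b + c"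
    using keys_mult by blast
  then show "lookup a x \<le> d + d'"
    using assms by (auto simp: exponents_le_def lookup_add intro: add_mono)
qed

lemma exponents_le_1: "exponents_le 0 1"
  by (simp add: exponents_le_def)

lemma exponents_le_power: "exponents_le d p \<Longrightarrow> exponents_le (k * d) (p ^ k)"
  by (induction k) (auto intro: exponents_le_mult exponents_le_1)

lemma exponents_le_mono: "exponents_le d p \<Longrightarrow> d \<le> d' \<Longrightarrow> exponents_le d' p"
  by (meson exponents_le_def le_trans)

lemma ex_exponents_le:
  fixes p :: "('x::finite, 'k::field) mpoly"
  shows "\<exists>d. exponents_le d p"
proof -
  let ?S = "\<Union>a\<in>Poly_Mapping.keys p. range (lookup a)"
  have "lookup a x \<le> Max ?S" if "a \<in> Poly_Mapping.keys p" for a x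
    using that by (intro Max_ge) auto
  then show ?thesis
    by (auto simp: exponents_le_def)
qed

lemma exponents_le_monomial_product:
  fixes zs :: "('x, 'k::field) mpoly list"
  assumes "\<And>z. z \<in> set zs \<Longrightarrow> exponents_le D z" "set ks \<subseteq> {..<N}" "\<And>x. lookup \<beta> x < N"
  shows "exponents_le (N * (length zs * D + 1)) (monomial_product zs (ks, \<beta>))"
proof -
  have "exponents_le (length zs * (N * D)) (prod_list (map2 (^) zs ks))"
    using assms(1,2)
  proof (induction zs arbitrary: ks)
    case Nil
    then show ?case
      by (simp add: exponents_le_1)
  next
    case (Cons z zs)
    show ?case
    proof (cases ks)
      case Nil
      then show ?thesis
        by (auto intro: exponents_le_mono[OF exponents_le_1])
    next
      case (Cons k ks')
      have "exponents_le (N * D) (z ^ k)"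
        using Cons Cons.prems by (intro exponents_le_mono[OF exponents_le_power[of D]]) auto
      moreover have "exponents_le (length zs * (N * D)) (prod_list (map2 (^) zs ks'))"
        using Cons Cons.prems by (intro Cons.IH) auto
      ultimately show ?thesis
        using exponents_le_mult[of "N * D" "z ^ k"] Cons by simp
    qed
  qed
  moreover have "exponents_le N (monom \<beta> :: ('x, 'k) mpoly)"
    using assms(3) by (auto simp: exponents_le_def monom_def intro: less_imp_le)
  ultimately have "exponents_le (length zs * (N * D) + N) (monomial_product zs (ks, \<beta>))"
    by (simp add: monomial_product_def exponents_le_mult)
  then show ?thesis
    by (rule exponents_le_mono) (simp add: algebra_simps)
qed

lemma card_exponents_box:
  shows "finite {a :: 'x::finite \<Rightarrow>\<^sub>0 nat. \<forall>x. lookup a x \<le> d}"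
    and "card {a :: 'x::finite \<Rightarrow>\<^sub>0 nat. \<forall>x. lookup a x \<le> d} \<le> (d + 1) ^ CARD('x)"
proof -
  let ?J = "{a :: 'x \<Rightarrow>\<^sub>0 nat. \<forall>x. lookup a x \<le> d}"
  let ?P = "PiE (UNIV :: 'x set) (\<lambda>_. {..d})"
  have inj: "inj_on lookup ?J"
    by (simp add: inj_on_def lookup_inject)
  have sub: "lookup ` ?J \<subseteq> ?P" and fin: "finite ?P"
    by (auto intro: finite_PiE)
  show "finite ?J"
    using inj sub fin by (meson finite_imageD finite_subset)
  have "card ?J \<le> card ?P"
    using inj sub fin by (metis card_image card_mono)
  then show "card ?J \<le> (d + 1) ^ CARD('x)"
    by (simp add: card_PiE)
qed

text \<open>The bound \<open>Suc N\<close> rather than \<open>N\<close> admits the exponent 0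
  outside \<open>Y\<close> even when \<open>N = 0\<close>.\<close>

lemma card_exponents_supported:
  fixes Y :: "'x::finite set"
  shows "N ^ card Y \<le> card {\<beta> :: 'x \<Rightarrow>\<^sub>0 nat. Poly_Mapping.keys \<beta> \<subseteq> Y \<and> (\<forall>x. lookup \<beta> x < Suc N)}"
proof -
  let ?P = "PiE Y (\<lambda>_. {..<N})"
  let ?S = "{\<beta> :: 'x \<Rightarrow>\<^sub>0 nat. Poly_Mapping.keys \<beta> \<subseteq> Y \<and> (\<forall>x. lookup \<beta> x < Suc N)}"
  define f :: "('x \<Rightarrow> nat) \<Rightarrow> ('x \<Rightarrow>\<^sub>0 nat)"
    where "f g = Abs_poly_mapping (\<lambda>x. if x \<in> Y then g x else 0)" for g
  have f: "lookup (f g) = (\<lambda>x. if x \<in> Y then g x else 0)" for g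
    by (simp add: f_def)
  have "inj_on f ?P"
  proof (rule inj_onI)
    fix g h
    assume gh: "g \<in> ?P" "h \<in> ?P" "f g = f h"
    then have "g x = h x" if "x \<in> Y" for x
      using that f[of g] f[of h] by (auto dest: fun_cong[of _ _ x])
    with gh show "g = h"
      by (meson PiE_ext)
  qed
  moreover have "f ` ?P \<subseteq> ?S"
  proof (rule image_subsetI)
    fix g
    assume g: "g \<in> ?P"
    have "g x < Suc N" if "x \<in> Y" for x
      using PiE_mem[OF g that] by simp
    then show "f g \<in> ?S"
      by (simp add: f in_keys_iff subset_iff)
  qed
  moreover have "finite ?S"
    by (rule finite_subset[OF _ card_exponents_box(1)[of N]]) (auto simp: less_Suc_eq_le)
  ultimately have "card ?P \<le> card ?S"
    by (rule card_inj_on_le)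
  moreover have "card ?P = N ^ card Y"
    by (subst card_PiE) auto
  ultimately show ?thesis
    by (simp only:)
qed

text \<open>Growth comparison: at least \<open>N ^ (length zs + card Y)\<close> products have
  exponents at most \<open>N * C\<close>, and there are at most
  \<open>(N * C + 1) ^ CARD('x)\<close> such monomials. If the first exponent were larger, a big
  \<open>N\<close> would force a linear relation among the products.\<close>

lemma lin_indep_monomial_products_bound:
  fixes zs :: "('x::finite, 'k::field) mpoly list"
  assumes indep: "lin_indep_mod P (monomial_product zs) {(ks, \<beta>). length ks = length zs \<and> Poly_Mapping.keys \<beta> \<subseteq> Y}"
    and "0 \<in> P"
  shows "length zs + card Y \<le> CARD('x)"
proof (rule ccontr)
  assume big: "\<not> length zs + card Y \<le> CARD('x)"
  let ?l = "length zs" and ?m = "CARD('x)"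
  have "\<forall>z :: ('x, 'k) mpoly. \<exists>d. exponents_le d z"
    by (simp add: ex_exponents_le)
  then obtain d where d: "\<And>z :: ('x, 'k) mpoly. exponents_le (d z) z"
    by metis
  define D where "D = Max (insert 0 (d ` set zs))"
  have D: "exponents_le D z" if "z \<in> set zs" for z
    by (rule exponents_le_mono[OF d]) (use that in \<open>auto simp: D_def\<close>)
  \<comment> \<open>The factor 2 absorbs the estimate of \<open>Suc N\<close> by
    \<open>2 * N\<close> below.\<close>
  define C where "C = 2 * (?l * D + 1)"
  \<comment> \<open>Just large enough that the constant \<open>(C + 1) ^ ?m\<close> is beaten by one
    further factor \<open>N\<close>.\<close>
  define N where "N = (C + 1) ^ ?m + 1"
  have "N > 0"
    by (simp add: N_def)
  define J where "J = {a :: 'x \<Rightarrow>\<^sub>0 nat. \<forall>x. lookup a x \<le> N * C}"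
  define K where "K = {ks :: nat list. set ks \<subseteq> {..<N} \<and> length ks = ?l}"
  define S where "S = {\<beta> :: 'x \<Rightarrow>\<^sub>0 nat. Poly_Mapping.keys \<beta> \<subseteq> Y \<and> (\<forall>x. lookup \<beta> x < Suc N)}"
  have finS: "finite S"
    by (rule finite_subset[OF _ card_exponents_box(1)[of N]]) (auto simp: S_def less_Suc_eq_le)
  have finK: "finite K" and cardK: "card K = N ^ ?l"
    unfolding K_def by (simp_all add: finite_lists_length_eq card_lists_length_eq)
  have "card J \<le> (N * C + 1) ^ ?m"
    unfolding J_def by (rule card_exponents_box)
  also have "\<dots> \<le> (N * (C + 1)) ^ ?m"
    using \<open>N > 0\<close> by (intro power_mono) auto
  also have "\<dots> = N ^ ?m * (C + 1) ^ ?m"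
    by (rule power_mult_distrib)
  also have "\<dots> < N ^ ?m * N"
    using \<open>N > 0\<close> by (intro mult_strict_left_mono) (auto simp: N_def)
  also have "\<dots> = N ^ Suc ?m"
    by simp
  also have "\<dots> \<le> N ^ (?l + card Y)"
    using big \<open>N > 0\<close> by (intro power_increasing) auto
  also have "\<dots> \<le> card (K \<times> S)"
    using card_exponents_supported[of N Y] by (simp add: card_cartesian_product cardK power_add S_def)
  finally have "card J < card (K \<times> S)" .
  moreover have "finite J" "finite (K \<times> S)"
    using finS finK by (auto simp: J_def card_exponents_box)
  ultimately obtain c where c: "\<exists>t\<in>K \<times> S. c t \<noteq> 0"
    "\<And>a. a \<in> J \<Longrightarrow> (\<Sum>t\<in>K \<times> S. c t * lookup (monomial_product zs t) a) = 0"
    using underdetermined_system[of J "K \<times> S" "\<lambda>t a. lookup (monomial_product zs t) a"] by blast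
  have "(\<Sum>t\<in>K \<times> S. scalar (c t) * monomial_product zs t) = 0"
  proof (rule poly_mapping_eqI)
    fix a
    have "(\<Sum>t\<in>K \<times> S. c t * lookup (monomial_product zs t) a) = 0"
    proof (cases "a \<in> J")
      case False
      have "lookup (monomial_product zs t) a = 0" if "t \<in> K \<times> S" for t
      proof -
        obtain ks \<beta> where t: "t = (ks, \<beta>)" "ks \<in> K" "\<beta> \<in> S"
          using \<open>t \<in> K \<times> S\<close> by blast
        have "exponents_le (Suc N * (?l * D + 1)) (monomial_product zs t)"
          unfolding t(1) using t D
          by (intro exponents_le_monomial_product) (fastforce simp: K_def S_def)+
        moreover have "Suc N * (?l * D + 1) \<le> (2 * N) * (?l * D + 1)"
          using \<open>N > 0\<close> by (intro mult_le_mono1) simp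
        then have "Suc N * (?l * D + 1) \<le> N * C"
          by (simp only: C_def mult_ac)
        ultimately have "exponents_le (N * C) (monomial_product zs t)"
          by (rule exponents_le_mono)
        with False show ?thesis
          by (auto simp: J_def exponents_le_def in_keys_iff)
      qed
      then show ?thesis
        by simp
    qed (rule c)
    then show "lookup (\<Sum>t\<in>K \<times> S. scalar (c t) * monomial_product zs t) a = lookup 0 a"
      by (simp add: lookup_sum lookup_scalar_mult)
  qed
  moreover have "K \<times> S \<subseteq> {(ks, \<beta>). length ks = ?l \<and> Poly_Mapping.keys \<beta> \<subseteq> Y}"
    by (auto simp: K_def S_def)
  ultimately have "\<forall>t\<in>K \<times> S. c t = 0"
    using indep[unfolded lin_indep_mod_def, rule_format, of "K \<times> S" c] \<open>finite (K \<times> S)\<close> \<open>0 \<in> P\<close> by simp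
  with c show False
    by blast
qed

section \<open>The kernel lattice and its rank\<close>

definition incidence_kernel :: "('e::finite \<Rightarrow> 'v set) \<Rightarrow> ('e \<Rightarrow> int) \<Rightarrow> bool" where
  "incidence_kernel ends l \<longleftrightarrow> (\<forall>z. (\<Sum>e | z \<in> ends e. l e) = 0)"

text \<open>Independence of the columns of the incidence matrix indexed by \<open>Y\<close>. For
  \<open>Y\<close> of largest size, \<open>CARD('e) - card Y\<close> is therefore the rank of the
  kernel lattice.\<close>

definition incidence_free :: "('e::finite \<Rightarrow> 'v set) \<Rightarrow> 'e set \<Rightarrow> bool" where
  "incidence_free ends Y \<longleftrightarrow> (\<forall>l. incidence_kernel ends l \<longrightarrow> (\<forall>e. e \<notin> Y \<longrightarrow> l e = 0) \<longrightarrow> (\<forall>e. l e = 0))"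

lemma incidence_kernel_diff_iff:
  fixes ends :: "'e::finite \<Rightarrow> 'v::finite set"
  shows "incidence_kernel ends (\<lambda>e. int (lookup u e) - int (lookup v e)) \<longleftrightarrow> mono_image ends u = mono_image ends v"
proof -
  have "mono_image ends u = mono_image ends v \<longleftrightarrow>
      (\<forall>z. lookup (mono_image ends u) z = lookup (mono_image ends v) z)"
    by (auto intro: poly_mapping_eqI)
  then show ?thesis
    by (simp add: incidence_kernel_def lookup_mono_image sum_subtractf flip: of_nat_sum)
qed

text \<open>Distinct monomials in the variables of \<open>Y\<close> have distinct images, so they
  are linearly independent modulo I_G; this starts the descent along a chain. As I_G is itself
  prime, bounding the chains that end at it suffices.\<close>

lemma toric_ideal_height:
  fixes ends :: "'e::finite \<Rightarrow> 'v::finite set"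
  assumes Y: "incidence_free ends Y"
  shows "ideal_height (toric_ideal ends :: ('e, 'k::field) mpoly set) \<le> enat (CARD('e) - card Y)"
proof -
  let ?I = "toric_ideal ends :: ('e, 'k) mpoly set"
  have base: "lin_indep_mod ?I monom {\<beta>. Poly_Mapping.keys \<beta> \<subseteq> Y}"
    unfolding lin_indep_mod_def
  proof (intro allI impI ballI)
    fix F c \<beta>
    assume F: "finite F" "F \<subseteq> {\<beta>. Poly_Mapping.keys \<beta> \<subseteq> Y}" "\<beta> \<in> F"
      and "(\<Sum>\<beta>\<in>F. scalar (c \<beta>) * monom \<beta>) \<in> ?I"
    then have 0: "pushforward (mono_image ends) (\<Sum>\<beta>\<in>F. Poly_Mapping.single \<beta> (c \<beta>)) = 0"
      by (simp add: toric_ideal_def toric_map_eq monom_def mult_single)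
    have "pushforward (mono_image ends) (\<Sum>\<beta>\<in>F. Poly_Mapping.single \<beta> (c \<beta>)) =
        (\<Sum>\<beta>\<in>F. Poly_Mapping.single (mono_image ends \<beta>) (c \<beta>))"
      using F(1) by induction (auto simp: pushforward_add)
    with 0 have "lookup (\<Sum>\<beta>\<in>F. Poly_Mapping.single (mono_image ends \<beta>) (c \<beta>)) (mono_image ends \<beta>) = 0"
      by simp
    then have "(\<Sum>\<gamma>\<in>F. c \<gamma> when mono_image ends \<gamma> = mono_image ends \<beta>) = 0"
      by (simp add: lookup_sum lookup_single)
    moreover have "mono_image ends \<gamma> = mono_image ends \<beta> \<longleftrightarrow> \<gamma> = \<beta>" if "\<gamma> \<in> F" for \<gamma>
    proof
      assume "mono_image ends \<gamma> = mono_image ends \<beta>"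
      then have "incidence_kernel ends (\<lambda>e. int (lookup \<gamma> e) - int (lookup \<beta> e))"
        by (simp add: incidence_kernel_diff_iff)
      moreover have "int (lookup \<gamma> e) - int (lookup \<beta> e) = 0" if "e \<notin> Y" for e
      proof -
        have "e \<notin> Poly_Mapping.keys \<gamma>" "e \<notin> Poly_Mapping.keys \<beta>"
          using F that \<open>\<gamma> \<in> F\<close> by auto
        then show ?thesis
          by (simp add: in_keys_iff)
      qed
      ultimately have "\<forall>e. int (lookup \<gamma> e) - int (lookup \<beta> e) = 0"
        using Y[unfolded incidence_free_def, rule_format, of "\<lambda>e. int (lookup \<gamma> e) - int (lookup \<beta> e)"] by blast
      then show "\<gamma> = \<beta>"
        by (intro poly_mapping_eqI) auto
    qed simp
    then have "(\<Sum>\<gamma>\<in>F. c \<gamma> when mono_image ends \<gamma> = mono_image ends \<beta>) = (\<Sum>\<gamma>\<in>F. c \<gamma> when \<gamma> = \<beta>)"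
      by (intro sum.cong) auto
    ultimately show "c \<beta> = 0"
      using F by (simp add: when_def)
  qed
  have "n \<le> CARD('e) - card Y"
    if ch: "\<forall>i\<le>n. is_prime_ideal (ch i)" "\<forall>i<n. ch i \<subset> ch (Suc i)" "ch n = ?I" for n and ch :: "nat \<Rightarrow> ('e, 'k) mpoly set"
  proof -
    obtain zs where "length zs = n" "lin_indep_mod (ch (n - n)) (monomial_product zs)
           {(ks, \<beta>). length ks = n \<and> Poly_Mapping.keys \<beta> \<subseteq> Y}"
      using prime_chain_lin_indep[of n ch Y n] ch base by auto
    moreover have "0 \<in> ch (n - n)"
      using ch by (auto simp: is_prime_ideal_def is_ideal_def)
    ultimately have "n + card Y \<le> CARD('e)"
      using lin_indep_monomial_products_bound[of "ch (n - n)" zs Y] by simp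
    then show ?thesis
      by simp
  qed
  then have "prime_height ?I \<le> enat (CARD('e) - card Y)"
    unfolding prime_height_def by (intro Sup_least) auto
  moreover have "ideal_height ?I \<le> prime_height ?I"
    unfolding ideal_height_def using toric_ideal_prime[of ends] by (intro Inf_lower) auto
  ultimately show ?thesis
    by (rule order_trans[rotated])
qed

subsection \<open>Graded Nakayama\<close>

definition tdeg :: "('x::finite \<Rightarrow>\<^sub>0 nat) \<Rightarrow> nat" where
  "tdeg a = (\<Sum>x\<in>UNIV. lookup a x)"

lemma tdeg_add: "tdeg (a + b) = tdeg a + tdeg b"
  by (simp add: tdeg_def lookup_add sum.distrib)

lemma tdeg_eq_0_iff: "tdeg a = 0 \<longleftrightarrow> a = 0"
  by (auto simp: tdeg_def intro: poly_mapping_eqI)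

definition homogeneous :: "nat \<Rightarrow> ('x::finite, 'k::field) mpoly \<Rightarrow> bool" where
  "homogeneous d p \<longleftrightarrow> (\<forall>a\<in>Poly_Mapping.keys p. tdeg a = d)"

definition hom_part :: "nat \<Rightarrow> ('x::finite, 'k::field) mpoly \<Rightarrow> ('x, 'k) mpoly" where
  "hom_part d p = (\<Sum>a | a \<in> Poly_Mapping.keys p \<and> tdeg a = d. Poly_Mapping.single a (lookup p a))"

lemma lookup_hom_part: "lookup (hom_part d p) a = (if tdeg a = d then lookup p a else 0)"
  by (auto simp: hom_part_def lookup_sum lookup_single when_def in_keys_iff)

lemma hom_part_add: "hom_part d (p + q) = hom_part d p + hom_part d q"
  by (rule poly_mapping_eqI) (simp add: lookup_hom_part lookup_add)

lemma hom_part_0 [simp]: "hom_part d 0 = 0"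
  by (rule poly_mapping_eqI) (simp add: lookup_hom_part)

lemma hom_part_sum: "hom_part d (\<Sum>i\<in>F. f i) = (\<Sum>i\<in>F. hom_part d (f i))"
  by (induction F rule: infinite_finite_induct) (auto simp: hom_part_add)

lemma hom_part_homogeneous:
  assumes "homogeneous k p"
  shows "hom_part d p = (if k = d then p else 0)"
proof (rule poly_mapping_eqI)
  fix a
  show "lookup (hom_part d p) a = lookup (if k = d then p else 0) a"
    using assms by (cases "a \<in> Poly_Mapping.keys p") (auto simp: lookup_hom_part homogeneous_def in_keys_iff)
qed

lemma hom_part_mult_homogeneous:
  assumes "homogeneous k b"
  shows "hom_part d (h * b) = (if k \<le> d then hom_part (d - k) h * b else 0)"
proof (induction h rule: poly_mapping_additive_induct)
  case zero
  then show ?case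
    by simp
next
  case (single a c)
  have "homogeneous (tdeg a + k) (Poly_Mapping.single a c * b)"
    unfolding homogeneous_def
  proof
    fix x
    assume "x \<in> Poly_Mapping.keys (Poly_Mapping.single a c * b)"
    then obtain y z where "y \<in> Poly_Mapping.keys (Poly_Mapping.single a c)" "z \<in> Poly_Mapping.keys b" "x = y + z"
      using keys_mult by blast
    then show "tdeg x = tdeg a + k"
      using assms by (auto simp: homogeneous_def tdeg_add split: if_splits)
  qed
  moreover have "homogeneous (tdeg a) (Poly_Mapping.single a c)"
    by (auto simp: homogeneous_def split: if_splits)
  ultimately show ?case
    by (auto simp: hom_part_homogeneous)
next
  case (add p q)
  then show ?case
    by (simp add: hom_part_add distrib_right)
qed

lemma constant_term_mult_eq_0:
  fixes p q :: "('x::finite, 'k::field) mpoly"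
  assumes "lookup p 0 = 0"
  shows "lookup (p * q) 0 = 0"
proof (rule ccontr)
  assume "lookup (p * q) 0 \<noteq> 0"
  then have "0 \<in> Poly_Mapping.keys (p * q)"
    by (simp add: in_keys_iff)
  then obtain a b where ab: "a \<in> Poly_Mapping.keys p" "0 = a + b"
    using keys_mult by blast
  have "tdeg a = 0"
    using tdeg_add[of a b] ab(2) by (simp add: tdeg_eq_0_iff[of 0, THEN iffD2])
  then show False
    using ab assms by (simp add: tdeg_eq_0_iff in_keys_iff)
qed

lemma hom_part_0_eq_0:
  assumes "lookup p 0 = 0"
  shows "hom_part 0 p = 0"
  by (rule poly_mapping_eqI) (use assms in \<open>auto simp: lookup_hom_part tdeg_eq_0_iff\<close>)

section \<open>Generated ideals and redundant generators\<close>

lemma gen_ideal_finite_iff: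
  assumes "finite S"
  shows "x \<in> gen_ideal S \<longleftrightarrow> (\<exists>c. x = (\<Sum>s\<in>S. c s * s))"
proof
  assume "x \<in> gen_ideal S"
  then obtain F c where F: "F \<subseteq> S" "x = (\<Sum>s\<in>F. c s * s)"
    by (auto simp: gen_ideal_def)
  have "x = (\<Sum>s\<in>S. (if s \<in> F then c s else 0) * s)"
    unfolding F(2) using F(1) assms by (intro sum.mono_neutral_cong_left) auto
  then show "\<exists>c. x = (\<Sum>s\<in>S. c s * s)"
    by (intro exI[of _ "\<lambda>s. if s \<in> F then c s else 0"])
qed (use assms in \<open>auto simp: gen_ideal_def\<close>)

lemma gen_ideal_mono: "S \<subseteq> T \<Longrightarrow> gen_ideal S \<subseteq> gen_ideal T"
  by (auto simp: gen_ideal_def)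

lemma gen_ideal_obtain_finite:
  assumes "finite X" "X \<subseteq> gen_ideal S"
  obtains F where "finite F" "F \<subseteq> S" "X \<subseteq> gen_ideal F"
proof -
  have "\<exists>F. finite F \<and> F \<subseteq> S \<and> x \<in> gen_ideal F" if "x \<in> X" for x
  proof -
    have "x \<in> gen_ideal S"
      using that assms by auto
    then obtain F c where "finite F" "F \<subseteq> S" "x = (\<Sum>s\<in>F. c s * s)"
      by (auto simp: gen_ideal_def)
    then have "x \<in> gen_ideal F"
      by (auto simp: gen_ideal_finite_iff)
    with \<open>finite F\<close> \<open>F \<subseteq> S\<close> show ?thesis
      by blast
  qed
  then obtain F where F: "\<And>x. x \<in> X \<Longrightarrow> finite (F x) \<and> F x \<subseteq> S \<and> x \<in> gen_ideal (F x)"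
    by metis
  show thesis
  proof (rule that)
    show "X \<subseteq> gen_ideal (\<Union>x\<in>X. F x)"
    proof
      fix x
      assume "x \<in> X"
      then show "x \<in> gen_ideal (\<Union>x\<in>X. F x)"
        using F gen_ideal_mono[of "F x" "\<Union>x\<in>X. F x"] by blast
    qed
  qed (use F assms in auto)
qed

lemma is_ideal_gen_ideal: "is_ideal (gen_ideal S)"
  unfolding is_ideal_def
proof (intro conjI ballI allI)
  show "0 \<in> gen_ideal S"
    by (auto simp: gen_ideal_def intro!: exI[of _ "{}"])
next
  fix x y
  assume "x \<in> gen_ideal S" "y \<in> gen_ideal S"
  then obtain F where F: "finite F" "F \<subseteq> S" "{x, y} \<subseteq> gen_ideal F"
    using gen_ideal_obtain_finite[of "{x, y}" S] by auto
  then obtain c d where "x = (\<Sum>s\<in>F. c s * s)" "y = (\<Sum>s\<in>F. d s * s)"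
    by (auto simp: gen_ideal_finite_iff)
  then have "x + y = (\<Sum>s\<in>F. (c s + d s) * s)"
    by (simp add: sum.distrib distrib_right)
  then have "x + y \<in> gen_ideal F"
    unfolding gen_ideal_finite_iff[OF F(1)] by (intro exI[of _ "\<lambda>s. c s + d s"])
  then show "x + y \<in> gen_ideal S"
    using gen_ideal_mono[OF F(2)] by blast
next
  fix r x
  assume "x \<in> gen_ideal S"
  then obtain F c where F: "finite F" "F \<subseteq> S" "x = (\<Sum>s\<in>F. c s * s)"
    by (auto simp: gen_ideal_def)
  then have "r * x = (\<Sum>s\<in>F. (r * c s) * s)"
    by (simp add: sum_distrib_left mult.assoc)
  then have "r * x \<in> gen_ideal F"
    unfolding gen_ideal_finite_iff[OF F(1)] by (intro exI[of _ "\<lambda>s. r * c s"])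
  then show "r * x \<in> gen_ideal S"
    using gen_ideal_mono[OF F(2)] by blast
qed

lemma gen_ideal_superset: "S \<subseteq> gen_ideal S"
proof
  fix x
  assume "x \<in> S"
  then show "x \<in> gen_ideal S"
    unfolding gen_ideal_def by (auto intro!: exI[of _ "{x}"] exI[of _ "\<lambda>_. 1"])
qed

lemma gen_ideal_least:
  assumes "is_ideal I" "S \<subseteq> I"
  shows "gen_ideal S \<subseteq> I"
proof
  fix x
  assume "x \<in> gen_ideal S"
  then obtain F c where F: "F \<subseteq> S" "x = (\<Sum>s\<in>F. c s * s)"
    by (auto simp: gen_ideal_def)
  then show "x \<in> I"
    using assms by (auto intro!: is_ideal_sum is_ideal_mult_left)
qed

lemma redundant_generator:
  assumes "b \<in> gen_ideal (S - {b})"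
  shows "gen_ideal (S - {b}) = gen_ideal S"
proof
  have "S \<subseteq> gen_ideal (S - {b})"
    using gen_ideal_superset[of "S - {b}"] assms by blast
  then show "gen_ideal S \<subseteq> gen_ideal (S - {b})"
    by (intro gen_ideal_least is_ideal_gen_ideal)
qed (intro gen_ideal_mono Diff_subset)

text \<open>If an irredundant homogeneous system were larger than \<open>set gs\<close>, the
  constant terms of its coefficients over \<open>gs\<close> would satisfy a linear relation, and the
  homogeneous part of the resulting identity would make one of its members redundant.\<close>

lemma irredundant_homogeneous_system_card_le:
  fixes B :: "('x::finite, 'k::field) mpoly set"
  assumes hom: "\<And>b. b \<in> B \<Longrightarrow> homogeneous (dg b) b"
    and irredundant: "\<And>b. b \<in> B \<Longrightarrow> b \<notin> gen_ideal (B - {b})"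
    and gen: "gen_ideal (set gs) = gen_ideal B"
    and T: "finite T" "T \<subseteq> B"
  shows "card T \<le> card (set gs)"
proof (rule ccontr)
  let ?G = "set gs"
  assume "\<not> card T \<le> card ?G"
  then have less: "card ?G < card T"
    by simp
  have "\<exists>c. b = (\<Sum>g\<in>?G. c g * g)" if "b \<in> T" for b
  proof -
    have "b \<in> gen_ideal ?G"
      using that T gen_ideal_superset[of B] gen by blast
    then show ?thesis
      by (simp add: gen_ideal_finite_iff)
  qed
  then have "\<exists>r. \<forall>b\<in>T. b = (\<Sum>g\<in>?G. r b g * g)"
    by (intro bchoice ballI)
  then obtain r where r: "\<And>b. b \<in> T \<Longrightarrow> b = (\<Sum>g\<in>?G. r b g * g)"
    by (elim exE) (simp only: Ball_def, blast)
  obtain F where F: "finite F" "F \<subseteq> B" "?G \<subseteq> gen_ideal F"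
    using gen_ideal_obtain_finite[of ?G B] gen gen_ideal_superset[of ?G] by auto
  have "\<exists>c. g = (\<Sum>b\<in>F. c b * b)" if "g \<in> ?G" for g
    using subsetD[OF F(3) that] F(1) by (simp add: gen_ideal_finite_iff)
  then have "\<exists>f. \<forall>g\<in>?G. g = (\<Sum>b\<in>F. f g b * b)"
    by (intro bchoice ballI)
  then obtain f where f: "\<And>g. g \<in> ?G \<Longrightarrow> g = (\<Sum>b\<in>F. f g b * b)"
    by (elim exE) (simp only: Ball_def, blast)
  \<comment> \<open>One equation per generator in \<open>?G\<close>: the combination of
    \<open>T\<close> with coefficients \<open>l\<close> is to have coefficients \<open>s g\<close>
    over \<open>?G\<close> without constant term.\<close>
  obtain l where l: "\<exists>b\<in>T. l b \<noteq> 0" "\<And>g. g \<in> ?G \<Longrightarrow> (\<Sum>b\<in>T. l b * lookup (r b g) 0) = 0"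
    using underdetermined_system[OF _ T(1) less, of "\<lambda>b g. lookup (r b g) 0"] by blast
  obtain b0 where b0: "b0 \<in> T" "l b0 \<noteq> 0"
    using l(1) by blast
  then have "b0 \<in> B"
    using T by blast
  define s where "s g = (\<Sum>b\<in>T. scalar (l b) * r b g)" for g
  define t where "t b = (\<Sum>g\<in>?G. s g * f g b)" for b
  have s0: "lookup (s g) 0 = 0" if "g \<in> ?G" for g
    using l(2)[OF that] by (simp add: s_def lookup_sum lookup_scalar_mult)
  have t0: "lookup (t b) 0 = 0" for b
    by (simp add: t_def lookup_sum s0 constant_term_mult_eq_0)
  have "(\<Sum>b\<in>T. scalar (l b) * b) = (\<Sum>b\<in>T. scalar (l b) * (\<Sum>g\<in>?G. r b g * g))"
    by (intro sum.cong refl arg_cong2[of _ _ _ _ "(*)"] r)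
  also have "\<dots> = (\<Sum>g\<in>?G. s g * g)"
    unfolding s_def sum_distrib_left sum_distrib_right by (subst sum.swap) (simp add: mult.assoc)
  also have "\<dots> = (\<Sum>g\<in>?G. s g * (\<Sum>b\<in>F. f g b * b))"
    by (intro sum.cong refl arg_cong2[of _ _ _ _ "(*)"] f)
  also have "\<dots> = (\<Sum>b\<in>F. t b * b)"
    unfolding t_def sum_distrib_left sum_distrib_right by (subst sum.swap) (simp add: mult.assoc)
  finally have eq: "(\<Sum>b\<in>T. scalar (l b) * b) = (\<Sum>b\<in>F. t b * b)" .
  let ?d = "dg b0" and ?I = "gen_ideal (B - {b0})"
  have I: "is_ideal ?I"
    by (rule is_ideal_gen_ideal)
  have in_I: "x * b \<in> ?I" if "b \<in> B" "b \<noteq> b0" for x b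
    using that I gen_ideal_superset[of "B - {b0}"] by (intro is_ideal_mult_left) auto
  have part_in_I: "hom_part ?d (x * b) \<in> ?I" if "b \<in> B" "b \<noteq> b0" for x b
    using in_I[OF that] I hom_part_mult_homogeneous[OF hom[OF that(1)], of ?d x]
    by (auto simp: is_ideal_def)
  have part_b0: "hom_part ?d (x * b0) = hom_part 0 x * b0" for x
    using hom_part_mult_homogeneous[OF hom[OF \<open>b0 \<in> B\<close>], of ?d x] by simp
  \<comment> \<open>In degree \<open>dg b0\<close> the summand of \<open>b0\<close> could only
    contribute the constant term of \<open>t b0\<close>, which is 0; all other summands are
    multiples of generators different from \<open>b0\<close>.\<close>
  have "(\<Sum>b\<in>F. hom_part ?d (t b * b)) \<in> ?I"
  proof (rule is_ideal_sum[OF I])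
    fix b
    assume "b \<in> F"
    show "hom_part ?d (t b * b) \<in> ?I"
    proof (cases "b = b0")
      case True
      then show ?thesis
        using I by (simp add: part_b0 hom_part_0_eq_0 t0 is_ideal_def)
    qed (use F \<open>b \<in> F\<close> in \<open>auto intro: part_in_I\<close>)
  qed
  then have "hom_part ?d (\<Sum>b\<in>T. scalar (l b) * b) \<in> ?I"
    by (simp only: eq hom_part_sum)
  then have 1: "(\<Sum>b\<in>T. hom_part ?d (scalar (l b) * b)) \<in> ?I"
    by (simp only: hom_part_sum)
  have 2: "(\<Sum>b\<in>T - {b0}. hom_part ?d (scalar (l b) * b)) \<in> ?I"
    by (rule is_ideal_sum[OF I]) (use T in \<open>auto intro: part_in_I\<close>)
  have "hom_part ?d (scalar (l b0) * b0) = scalar (l b0) * b0"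
  proof -
    have "homogeneous 0 (scalar (l b0) :: ('x, 'k) mpoly)"
      by (auto simp: homogeneous_def tdeg_eq_0_iff split: if_splits)
    then show ?thesis
      by (simp add: part_b0 hom_part_homogeneous)
  qed
  then have "(\<Sum>b\<in>T. hom_part ?d (scalar (l b) * b)) =
      scalar (l b0) * b0 + (\<Sum>b\<in>T - {b0}. hom_part ?d (scalar (l b) * b))"
    using sum.remove[OF T(1) b0(1), of "\<lambda>b. hom_part ?d (scalar (l b) * b)"] by simp
  then have "scalar (l b0) * b0 \<in> ?I"
    using is_ideal_diff[OF I 1 2] by simp
  then have "scalar (inverse (l b0)) * (scalar (l b0) * b0) \<in> ?I"
    by (rule is_ideal_mult_left[OF I])
  moreover have "scalar (inverse (l b0)) * (scalar (l b0) * b0) = b0"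
    using b0 by (simp add: mult_single flip: mult.assoc)
  ultimately show False
    using irredundant[OF \<open>b0 \<in> B\<close>] by simp
qed

lemma minimal_system_irredundant:
  assumes "minimal_binomial_system I B" "b \<in> B"
  shows "b \<notin> gen_ideal (B - {b})"
proof
  assume "b \<in> gen_ideal (B - {b})"
  then have "gen_ideal (B - {b}) = I"
    using redundant_generator[of b B] assms by (simp add: minimal_binomial_system_def)
  moreover have "B - {b} \<subset> B"
    using assms by blast
  ultimately show False
    using assms by (simp add: minimal_binomial_system_def)
qed

text \<open>Handshake count. Consequently the total degree of a monomial is determined by its image,
  which is why binomials of I_G are homogeneous.\<close>

lemma sum_mono_image:
  fixes ends :: "'e::finite \<Rightarrow> 'v::finite set"
  assumes "\<And>e. card (ends e) = 2"
  shows "(\<Sum>z\<in>UNIV. \<Sum>e | z \<in> ends e. u e) = 2 * (\<Sum>e\<in>UNIV. u e :: nat)"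
proof -
  have "(\<Sum>z\<in>UNIV. \<Sum>e | z \<in> ends e. u e) = (\<Sum>z\<in>UNIV. \<Sum>e\<in>UNIV. if z \<in> ends e then u e else 0)"
    by (simp add: sum.If_cases)
  also have "\<dots> = (\<Sum>e\<in>UNIV. \<Sum>z\<in>UNIV. if z \<in> ends e then u e else 0)"
    by (rule sum.swap)
  also have "\<dots> = (\<Sum>e\<in>UNIV. 2 * u e)"
    by (simp add: sum.If_cases assms)
  finally show ?thesis
    by (simp add: sum_distrib_left)
qed

subsection \<open>Fibres\<close>

text \<open>Replacing one term of a binomial by the other inside a monomial. Exponents are plain
  functions here, so that the combinatorics below is free of polynomials.\<close>

definition moves :: "'b set \<Rightarrow> ('b \<Rightarrow> 'e \<Rightarrow> nat) \<Rightarrow> ('b \<Rightarrow> 'e \<Rightarrow> nat) \<Rightarrow> (('e \<Rightarrow> nat) \<times> ('e \<Rightarrow> nat)) set" where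
  "moves B U V = {(\<lambda>e. w e + U q e, \<lambda>e. w e + V q e) | w q. q \<in> B} \<union>
                 {(\<lambda>e. w e + V q e, \<lambda>e. w e + U q e) | w q. q \<in> B}"

lemma movesI: "q \<in> B \<Longrightarrow> (\<lambda>e. w e + U q e, \<lambda>e. w e + V q e) \<in> moves B U V"
  by (auto simp: moves_def)

lemma moves_sym: "(x, y) \<in> moves B U V \<Longrightarrow> (y, x) \<in> moves B U V"
  by (auto simp: moves_def)

text \<open>The linear functional \<open>\<psi>\<close> adds the coefficients of the monomials in
  the connected component of \<open>u\<close>. It vanishes on every monomial multiple of a
  generator, whose two terms differ by a move, hence on the whole ideal; on the given binomial this
  forces \<open>v\<close> into the component.\<close>

lemma binomial_in_gen_ideal_connected:
  fixes B :: "('e::finite, 'k::field) mpoly set"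
  assumes rows: "\<And>q. q \<in> B \<Longrightarrow> q = monom (U q) - monom (V q)"
    and "monom u - monom v \<in> gen_ideal B"
  shows "(lookup u, lookup v) \<in> (moves B (\<lambda>q. lookup (U q)) (\<lambda>q. lookup (V q)))\<^sup>*"
proof -
  let ?R = "moves B (\<lambda>q. lookup (U q)) (\<lambda>q. lookup (V q))"
  define C where "C a \<longleftrightarrow> (lookup u, lookup a) \<in> ?R\<^sup>*" for a
  define \<psi> where "\<psi> f = lookup (pushforward C f) True" for f :: "('e, 'k) mpoly"
  have add: "\<psi> (f + g) = \<psi> f + \<psi> g" for f g
    by (simp add: \<psi>_def pushforward_add lookup_add)
  have zero: "\<psi> 0 = 0"
    by (simp add: \<psi>_def)
  have single: "\<psi> (Poly_Mapping.single a c) = (if C a then c else 0)" for a c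
    by (simp add: \<psi>_def lookup_single when_def)
  have diff: "\<psi> (f - g) = \<psi> f - \<psi> g" for f g
    using add[of "f - g" g] by simp
  have psi_sum: "\<psi> (\<Sum>i\<in>F. f i) = (\<Sum>i\<in>F. \<psi> (f i))" for F :: "'z set" and f
    by (induction F rule: infinite_finite_induct) (auto simp: add zero)
  have "\<psi> (h * q) = 0" if "q \<in> B" for h q
  proof (induction h rule: poly_mapping_additive_induct)
    case (single a c)
    have eq: "lookup (a + U q) = (\<lambda>e. lookup a e + lookup (U q) e)" "lookup (a + V q) = (\<lambda>e. lookup a e + lookup (V q) e)"
      by (auto simp: lookup_add)
    have "(lookup (a + U q), lookup (a + V q)) \<in> ?R"
      unfolding eq by (rule movesI[OF that])
    then have "C (a + U q) \<longleftrightarrow> C (a + V q)"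
      unfolding C_def by (meson moves_sym rtrancl.rtrancl_into_rtrancl)
    moreover have "Poly_Mapping.single a c * q = Poly_Mapping.single (a + U q) c - Poly_Mapping.single (a + V q) c"
      by (subst rows[OF that]) (simp add: monom_def right_diff_distrib mult_single)
    ultimately show ?case
      by (simp add: diff \<open>\<And>a c. \<psi> (Poly_Mapping.single a c) = (if C a then c else 0)\<close>)
  qed (simp_all add: zero add distrib_right)
  moreover obtain F c where "F \<subseteq> B" "monom u - monom v = (\<Sum>q\<in>F. c q * q)"
    using assms(2) by (auto simp: gen_ideal_def)
  ultimately have "\<psi> (monom u - monom v) = 0"
    by (auto simp: psi_sum intro!: sum.neutral)
  moreover have "C u"
    by (simp add: C_def)
  ultimately have "C v"
    by (auto simp: diff single monom_def split: if_splits)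
  then show ?thesis
    by (simp add: C_def)
qed

subsection \<open>Independent systems of moves\<close>

definition balanced :: "('e::finite \<Rightarrow> 'v set) \<Rightarrow> ('e \<Rightarrow> nat) \<Rightarrow> ('e \<Rightarrow> nat) \<Rightarrow> bool" where
  "balanced ends u v \<longleftrightarrow> (\<forall>z. (\<Sum>e | z \<in> ends e. u e) = (\<Sum>e | z \<in> ends e. v e))"

lemma common_denominator:
  fixes c :: "'a \<Rightarrow> rat"
  assumes "finite T"
  shows "\<exists>K::int. K > 0 \<and> (\<forall>t\<in>T. \<exists>m::int. of_int K * c t = of_int m)"
  using assms
proof induction
  case empty
  show ?case
    by (intro exI[of _ 1]) simp
next
  case (insert x T)
  then obtain K :: int where K: "K > 0" "\<forall>t\<in>T. \<exists>m::int. of_int K * c t = of_int m"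
    by blast
  obtain a b where ab: "quotient_of (c x) = (a, b)"
    by (cases "quotient_of (c x)")
  have b: "b > 0" "c x = of_int a / of_int b"
    using quotient_of_denom_pos[OF ab] quotient_of_div[OF ab] by auto
  have "\<exists>m::int. of_int (K * b) * c t = of_int m" if "t \<in> insert x T" for t
  proof (cases "t = x")
    case True
    have "of_int (K * b) * c x = of_int (K * a)"
      using b by simp
    with True show ?thesis
      by blast
  next
    case False
    with that K obtain m :: int where "of_int K * c t = of_int m"
      by blast
    then have "of_int (K * b) * c t = of_int (m * b)"
      by (simp add: mult_ac flip: \<open>of_int K * c t = of_int m\<close>)
    then show ?thesis
      by blast
  qed
  moreover have "K * b > 0"
    using K b by simp
  ultimately show ?case
    by blast
qed

lemma sum_zero_opposite_sign:
  fixes f :: "'a \<Rightarrow> rat"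
  assumes "finite T" "(\<Sum>t\<in>T. f t) = 0" "q \<in> T" "f q < 0"
  shows "\<exists>t\<in>T. f t > 0"
proof (rule ccontr)
  assume "\<not> ?thesis"
  then have "\<forall>t\<in>T. f t \<le> 0"
    by auto
  then have "f q = 0"
    using sum_nonneg_eq_0_iff[of T "\<lambda>t. - f t"] assms by (simp add: sum_negf)
  with assms show False
    by simp
qed

text \<open>What is kept of a minimal system once the polynomials are gone. The rows are taken over
  the rationals, whatever the field \<open>'k\<close>.\<close>

locale fibre_moves =
  fixes ends :: "'e::finite \<Rightarrow> 'v::finite set" and B :: "'b set" and U V :: "'b \<Rightarrow> 'e \<Rightarrow> nat"
  assumes finite_B: "finite B"
    and two_ends: "card (ends e) = 2"
    and balanced_row: "q \<in> B \<Longrightarrow> balanced ends (U q) (V q)"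
    and U_nonzero: "q \<in> B \<Longrightarrow> \<exists>e. U q e \<noteq> 0"
    and V_nonzero: "q \<in> B \<Longrightarrow> \<exists>e. V q e \<noteq> 0"
    and connected: "balanced ends u v \<Longrightarrow> (u, v) \<in> (moves B U V)\<^sup>*"
begin

definition row :: "'b \<Rightarrow> 'e \<Rightarrow> rat" where
  "row q e = of_nat (U q e) - of_nat (V q e)"

text \<open>One induction along a path of moves for two invariants: total degree in
  \<open>balanced_span\<close>, and avoiding a set of edges in \<open>few_mixed_rows\<close>.
  \<open>Q\<close> records what applicability of a row under the invariant says about that
  row.\<close>

lemma moves_span:
  assumes "(u, v) \<in> (moves B U V)\<^sup>*" "Inv u"
    and UV: "\<And>w q. q \<in> B \<Longrightarrow> Inv (\<lambda>e. w e + U q e) \<Longrightarrow> Inv (\<lambda>e. w e + V q e) \<and> Q q"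
    and VU: "\<And>w q. q \<in> B \<Longrightarrow> Inv (\<lambda>e. w e + V q e) \<Longrightarrow> Inv (\<lambda>e. w e + U q e) \<and> Q q"
  shows "Inv v \<and> (\<exists>c. (\<forall>e. of_nat (u e) - of_nat (v e) = (\<Sum>q\<in>B. c q * row q e)) \<and> (\<forall>q. c q \<noteq> 0 \<longrightarrow> Q q))"
  using assms(1)
proof (induction rule: rtrancl_induct)
  case base
  show ?case
    using \<open>Inv u\<close> by (intro conjI exI[of _ "\<lambda>_. 0"]) auto
next
  case (step x y)
  then obtain c where x: "Inv x" and c: "\<And>e. of_nat (u e) - of_nat (x e) = (\<Sum>q\<in>B. c q * row q e)"
    "\<And>q. c q \<noteq> 0 \<Longrightarrow> Q q"
    by blast
  obtain q \<sigma> where q: "q \<in> B" "Inv y" "Q q" "\<And>e. of_nat (x e) - of_nat (y e) = \<sigma> * row q e"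
  proof -
    from step.hyps(2) consider w q where "q \<in> B" "x = (\<lambda>e. w e + U q e)" "y = (\<lambda>e. w e + V q e)"
      | w q where "q \<in> B" "x = (\<lambda>e. w e + V q e)" "y = (\<lambda>e. w e + U q e)"
      unfolding moves_def by blast
    then show thesis
    proof cases
      case 1
      then show thesis
        using UV[OF 1(1), of w] x by (intro that[of q 1]) (auto simp: row_def)
    next
      case 2
      then show thesis
        using VU[OF 2(1), of w] x by (intro that[of q "-1"]) (auto simp: row_def)
    qed
  qed
  define d where "d = c(q := c q + \<sigma>)"
  have "of_nat (u e) - of_nat (y e) = (\<Sum>q\<in>B. d q * row q e)" for e
  proof -
    have "(\<Sum>q\<in>B. d q * row q e) = d q * row q e + (\<Sum>t\<in>B - {q}. d t * row t e)"
      using finite_B q by (simp add: sum.remove)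
    also have "(\<Sum>t\<in>B - {q}. d t * row t e) = (\<Sum>t\<in>B - {q}. c t * row t e)"
      by (intro sum.cong) (auto simp: d_def)
    finally have "(\<Sum>q\<in>B. d q * row q e) = \<sigma> * row q e + (c q * row q e + (\<Sum>t\<in>B - {q}. c t * row t e))"
      by (simp add: d_def algebra_simps)
    also have "c q * row q e + (\<Sum>t\<in>B - {q}. c t * row t e) = (\<Sum>t\<in>B. c t * row t e)"
      using finite_B q by (simp add: sum.remove)
    finally show ?thesis
      using c(1)[of e] q(4)[of e] by simp
  qed
  moreover have "\<forall>t. d t \<noteq> 0 \<longrightarrow> Q t"
    using c(2) q(3) by (simp add: d_def)
  ultimately show ?case
    using q(2) by blast
qed

lemma balanced_sum_eq:
  assumes "balanced ends u v"
  shows "(\<Sum>e\<in>UNIV. u e) = (\<Sum>e\<in>UNIV. v e)"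
  using assms sum_mono_image[of ends u] sum_mono_image[of ends v] two_ends
  by (simp add: balanced_def)

text \<open>Moves preserve the total degree, and a row can only be applied to a monomial that its
  term divides; so rows of larger degree never occur.\<close>

lemma balanced_span:
  assumes "balanced ends u v"
  shows "\<exists>c. (\<forall>e. of_nat (u e) - of_nat (v e) = (\<Sum>q\<in>B. c q * row q e)) \<and>
      (\<forall>q. c q \<noteq> 0 \<longrightarrow> (\<Sum>e\<in>UNIV. U q e) \<le> (\<Sum>e\<in>UNIV. u e))"
proof -
  let ?n = "\<Sum>e\<in>UNIV. u e"
  have deg: "(\<Sum>e\<in>UNIV. U q e) = (\<Sum>e\<in>UNIV. V q e)" if "q \<in> B" for q
    using that by (intro balanced_sum_eq balanced_row)
  show ?thesis
    by (rule conjunct2, rule moves_span[OF connected[OF assms], where Inv = "\<lambda>x. (\<Sum>e\<in>UNIV. x e) = ?n"])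
      (auto simp: sum.distrib deg)
qed

lemma kernel_balanced:
  assumes "incidence_kernel ends l"
  shows "balanced ends (\<lambda>e. nat (l e)) (\<lambda>e. nat (- l e))"
  unfolding balanced_def
proof
  fix z
  have "int (\<Sum>e | z \<in> ends e. nat (l e)) - int (\<Sum>e | z \<in> ends e. nat (- l e)) =
      (\<Sum>e | z \<in> ends e. int (nat (l e)) - int (nat (- l e)))"
    by (simp add: sum_subtractf)
  also have "\<dots> = (\<Sum>e | z \<in> ends e. l e)"
    by (intro sum.cong) auto
  also have "\<dots> = 0"
    using assms by (simp add: incidence_kernel_def)
  finally show "(\<Sum>e | z \<in> ends e. nat (l e)) = (\<Sum>e | z \<in> ends e. nat (- l e))"
    by (simp only: right_minus_eq of_nat_eq_iff)
qed

lemma kernel_span: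
  assumes "incidence_kernel ends l"
  shows "\<exists>c. \<forall>e. of_int (l e) = (\<Sum>q\<in>B. c q * row q e)"
proof -
  have l: "of_int (l e) = (of_nat (nat (l e)) - of_nat (nat (- l e)) :: rat)" for e
    by (cases "l e \<ge> 0") auto
  obtain c where c: "(\<forall>e. of_nat (nat (l e)) - of_nat (nat (- l e)) = (\<Sum>q\<in>B. c q * row q e)) \<and>
      (\<forall>q. c q \<noteq> 0 \<longrightarrow> (\<Sum>e\<in>UNIV. U q e) \<le> (\<Sum>e\<in>UNIV. nat (l e)))"
    using balanced_span[OF kernel_balanced[OF assms]] by (rule exE)
  show ?thesis
    unfolding l by (intro exI[of _ c] conjunct1[OF c])
qed

text \<open>For a largest \<open>Y\<close>, every edge outside \<open>Y\<close> carries a kernel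
  vector that is non-zero there and otherwise supported in \<open>Y\<close>. These are at least
  \<open>card B\<close> independent vectors in the span of the rows, which leaves no room for a
  relation among the rows.\<close>

lemma rows_independent:
  assumes card_le: "\<And>Y. incidence_free ends Y \<Longrightarrow> card B \<le> CARD('e) - card Y"
    and rel: "\<And>e. (\<Sum>q\<in>B. l q * row q e) = 0" and "q0 \<in> B"
  shows "l q0 = 0"
proof (rule ccontr)
  assume "l q0 \<noteq> 0"
  have "incidence_free ends {}"
    by (simp add: incidence_free_def)
  moreover have "\<forall>Y. incidence_free ends Y \<longrightarrow> card Y < Suc CARD('e)"
    by (simp add: card_mono less_Suc_eq_le)
  ultimately have "\<exists>Y. incidence_free ends Y \<and> (\<forall>Y'. incidence_free ends Y' \<longrightarrow> card Y' \<le> card Y)"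
    by (rule Lattices_Big.ex_has_greatest_nat)
  then obtain Y where "incidence_free ends Y \<and> (\<forall>Y'. incidence_free ends Y' \<longrightarrow> card Y' \<le> card Y)"
    by (rule exE)
  then have Y: "incidence_free ends Y"
    and max: "\<And>Y'. incidence_free ends Y' \<Longrightarrow> card Y' \<le> card Y"
    by simp_all
  have "\<exists>k. e \<notin> Y \<longrightarrow> (incidence_kernel ends k \<and> k e \<noteq> 0 \<and> (\<forall>f. f \<notin> insert e Y \<longrightarrow> k f = 0))" for e
  proof (cases "e \<in> Y")
    case False
    have "\<not> incidence_free ends (insert e Y)"
      using max[of "insert e Y"] False by auto
    then obtain k f where k: "incidence_kernel ends k" "\<forall>f. f \<notin> insert e Y \<longrightarrow> k f = 0" "k f \<noteq> 0"
      by (auto simp: incidence_free_def)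
    have "k e \<noteq> 0"
    proof
      assume "k e = 0"
      with k(2) have "\<forall>f. f \<notin> Y \<longrightarrow> k f = 0"
        by auto
      with Y k(1,3) show False
        by (simp add: incidence_free_def)
    qed
    with k show ?thesis
      by (intro exI[of _ k]) simp
  qed simp
  then have "\<exists>k. \<forall>e. e \<notin> Y \<longrightarrow> (incidence_kernel ends (k e) \<and> k e e \<noteq> 0 \<and> (\<forall>f. f \<notin> insert e Y \<longrightarrow> k e f = 0))"
    by (intro choice allI)
  then obtain k where "\<forall>e. e \<notin> Y \<longrightarrow> (incidence_kernel ends (k e) \<and> k e e \<noteq> 0 \<and> (\<forall>f. f \<notin> insert e Y \<longrightarrow> k e f = 0))"
    by (rule exE)
  then have k: "\<And>e. e \<notin> Y \<Longrightarrow> incidence_kernel ends (k e)" "\<And>e. e \<notin> Y \<Longrightarrow> k e e \<noteq> 0"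
    "\<And>e f. e \<notin> Y \<Longrightarrow> f \<notin> insert e Y \<Longrightarrow> k e f = 0"
    by simp_all
  have "\<forall>e\<in>-Y. \<exists>c. \<forall>f. of_int (k e f) = (\<Sum>q\<in>B. c q * row q f)"
    using kernel_span[OF k(1)] by simp
  then have "\<exists>c. \<forall>e\<in>-Y. \<forall>f. of_int (k e f) = (\<Sum>q\<in>B. c e q * row q f)"
    by (rule bchoice)
  then obtain c where "\<forall>e\<in>-Y. \<forall>f. of_int (k e f) = (\<Sum>q\<in>B. c e q * row q f)"
    by (rule exE)
  then have c: "\<And>e f. e \<notin> Y \<Longrightarrow> of_int (k e f) = (\<Sum>q\<in>B. c e q * row q f)"
    by simp
  \<comment> \<open>\<open>None\<close> stands for the supposed relation \<open>l\<close>, and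
    \<open>Some e\<close> for the coefficients of the kernel vector at \<open>e\<close>: at least
    \<open>card B + 1\<close> vectors with \<open>card B\<close> entries.\<close>
  define T where "T = insert None (Some ` (- Y))"
  have sumT: "(\<Sum>t\<in>T. g t) = g None + (\<Sum>e\<in>-Y. g (Some e))" for g :: "'e option \<Rightarrow> rat"
    by (simp add: T_def sum.reindex)
  have "card B < card T"
    using card_le[OF Y] by (simp add: T_def card_image Compl_eq_Diff_UNIV card_Diff_subset)
  then obtain t where t: "\<exists>x\<in>T. t x \<noteq> 0"
    "\<And>q. q \<in> B \<Longrightarrow> (\<Sum>x\<in>T. t x * (case x of None \<Rightarrow> l q | Some e \<Rightarrow> c e q)) = 0"
    using underdetermined_system[of B T "\<lambda>x q. case x of None \<Rightarrow> l q | Some e \<Rightarrow> c e q"] finite_B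
    by (auto simp: T_def)
  have t2: "t None * l q + (\<Sum>e\<in>-Y. t (Some e) * c e q) = 0" if "q \<in> B" for q
    using t(2)[OF that] by (simp add: sumT)
  have "(\<Sum>e\<in>-Y. t (Some e) * of_int (k e f)) = 0" for f
  proof -
    have "(\<Sum>e\<in>-Y. t (Some e) * of_int (k e f)) = (\<Sum>e\<in>-Y. \<Sum>q\<in>B. t (Some e) * c e q * row q f)"
      by (intro sum.cong refl) (simp add: c sum_distrib_left mult.assoc)
    also have "\<dots> = (\<Sum>q\<in>B. \<Sum>e\<in>-Y. t (Some e) * c e q * row q f)"
      by (rule sum.swap)
    also have "\<dots> = (\<Sum>q\<in>B. - (t None * l q) * row q f)"
    proof (intro sum.cong refl)
      fix q
      assume "q \<in> B"
      then have "(\<Sum>e\<in>-Y. t (Some e) * c e q) = - (t None * l q)"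
        using t2[of q] by (simp add: eq_neg_iff_add_eq_0 add.commute)
      then show "(\<Sum>e\<in>-Y. t (Some e) * c e q * row q f) = - (t None * l q) * row q f"
        by (simp only: sum_distrib_right[symmetric])
    qed
    also have "\<dots> = - t None * (\<Sum>q\<in>B. l q * row q f)"
      by (simp add: sum_distrib_left mult.assoc)
    finally show ?thesis
      by (simp add: rel)
  qed
  then have 0: "t (Some f) = 0" if "f \<notin> Y" for f
  proof -
    have "(\<Sum>e\<in>-Y. t (Some e) * of_int (k e f)) = (\<Sum>e\<in>-Y. if e = f then t (Some f) * of_int (k f f) else 0)"
      using that k(3) by (intro sum.cong) auto
    then show ?thesis
      using \<open>(\<Sum>e\<in>-Y. t (Some e) * of_int (k e f)) = 0\<close> that k(2)[OF that] by simp
  qed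
  then have "(\<Sum>e\<in>-Y. t (Some e) * c e q0) = 0"
    by (intro sum.neutral) simp
  then have "t None = 0"
    using t2[OF \<open>q0 \<in> B\<close>] \<open>l q0 \<noteq> 0\<close> by simp
  with 0 t(1) show False
    by (auto simp: T_def)
qed

end

locale independent_moves = fibre_moves ends B U V
  for ends :: "'e::finite \<Rightarrow> 'v::finite set" and B :: "'b set" and U V :: "'b \<Rightarrow> 'e \<Rightarrow> nat" +
  assumes independent: "(\<And>e. (\<Sum>q\<in>B. l q * row q e) = 0) \<Longrightarrow> q \<in> B \<Longrightarrow> l q = 0"
begin

text \<open>Phrased by the two terms instead of the signs of \<open>row q\<close>, because a common
  variable of the two terms is only excluded later, by the case of a singleton
  \<open>J\<close>.\<close>

definition mixed :: "'b \<Rightarrow> 'e set \<Rightarrow> bool" where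
  "mixed q J \<longleftrightarrow> (\<exists>e\<in>J. U q e \<noteq> 0) \<and> (\<exists>e\<in>J. V q e \<noteq> 0)"

text \<open>Fischer and Shapiro: a complete intersection matrix is dominating. Enlarging \<open>J\<close> as long as some row meets it on one side only, one may assume that the
  moves preserve the set of monomials avoiding \<open>J\<close>; a linear relation then produces a
  kernel vector that is constant on \<open>J\<close>.\<close>

lemma few_mixed_rows:
  assumes "J0 \<noteq> {}"
  shows "card {q\<in>B. mixed q J0} < card J0"
proof (rule ccontr)
  define big where "big J \<longleftrightarrow> J \<noteq> {} \<and> card J \<le> card {q\<in>B. mixed q J}" for J
  assume "\<not> ?thesis"
  then have "big J0"
    using assms by (simp add: big_def)
  moreover have "\<forall>J. big J \<longrightarrow> card J < Suc CARD('e)"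
    by (simp add: card_mono less_Suc_eq_le)
  ultimately have "\<exists>J. big J \<and> (\<forall>J'. big J' \<longrightarrow> card J' \<le> card J)"
    by (rule Lattices_Big.ex_has_greatest_nat)
  then obtain J where "big J \<and> (\<forall>J'. big J' \<longrightarrow> card J' \<le> card J)"
    by (rule exE)
  then have J: "big J" and max: "\<And>J'. big J' \<Longrightarrow> card J' \<le> card J"
    by simp_all
  define T where "T = {q\<in>B. mixed q J}"
  have T: "T \<subseteq> B" "finite T" "card J \<le> card T" "J \<noteq> {}"
    using J finite_B by (auto simp: T_def big_def)
  \<comment> \<open>A new column that makes one more row mixed would keep at least as many mixed
    rows as columns, against the maximality of \<open>J\<close>.\<close>
  have extend: False if "q \<in> B" "q \<notin> T" "e \<notin> J" "mixed q (insert e J)" for q e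
  proof -
    have "insert q T \<subseteq> {q\<in>B. mixed q (insert e J)}"
      using that by (auto simp: T_def mixed_def)
    then have "card (insert q T) \<le> card {q\<in>B. mixed q (insert e J)}"
      using finite_B by (intro card_mono) auto
    then have "big (insert e J)"
      using that T by (simp add: big_def)
    then show False
      using max[of "insert e J"] that by simp
  qed
  have closed: "(\<exists>e\<in>J. U q e \<noteq> 0) \<longleftrightarrow> (\<exists>e\<in>J. V q e \<noteq> 0)" if q: "q \<in> B" for q
  proof (rule ccontr)
    assume neq: "\<not> ?thesis"
    then have "q \<notin> T"
      by (auto simp: T_def mixed_def)
    obtain e f where ef: "U q e \<noteq> 0" "V q f \<noteq> 0"
      using U_nonzero[OF q] V_nonzero[OF q] by blast
    show False
    proof (cases "\<exists>e\<in>J. U q e \<noteq> 0")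
      case True
      with neq ef have "f \<notin> J" "mixed q (insert f J)"
        by (auto simp: mixed_def)
      with q \<open>q \<notin> T\<close> show False
        by (rule extend)
    next
      case False
      with neq ef have "e \<notin> J" "mixed q (insert e J)"
        by (auto simp: mixed_def)
      with q \<open>q \<notin> T\<close> show False
        by (rule extend)
    qed
  qed
  define avoid where "avoid x \<longleftrightarrow> (\<forall>e\<in>J. x e = 0)" for x :: "'e \<Rightarrow> nat"
  have avoid_span: "avoid v \<and> (\<exists>c. (\<forall>e. of_nat (u e) - of_nat (v e) = (\<Sum>q\<in>B. c q * row q e)) \<and>
      (\<forall>q. c q \<noteq> 0 \<longrightarrow> q \<notin> T))" if "balanced ends u v" "avoid u" for u v
  proof (rule moves_span[where Inv = avoid and Q = "\<lambda>q. q \<notin> T", OF connected[OF that(1)] that(2)])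
    show "avoid (\<lambda>e. w e + V q e) \<and> q \<notin> T" if "q \<in> B" "avoid (\<lambda>e. w e + U q e)" for w q
      using that closed[OF that(1)] by (auto simp: avoid_def T_def mixed_def)
    show "avoid (\<lambda>e. w e + U q e) \<and> q \<notin> T" if "q \<in> B" "avoid (\<lambda>e. w e + V q e)" for w q
      using that closed[OF that(1)] by (auto simp: avoid_def T_def mixed_def)
  qed
  \<comment> \<open>A combination \<open>l\<close> of mixed rows, constant and non-negative on
    \<open>J\<close>, has a negative part avoiding \<open>J\<close>. The moves from there to the
    positive part avoid \<open>J\<close> throughout and use no row of \<open>T\<close>: thus
    \<open>d = 0\<close>, and \<open>l\<close> has a second expression by rows outside
    \<open>T\<close>, so independence kills all \<open>c q\<close>.\<close>
  have key: "d = 0 \<and> (\<forall>q\<in>T. c q = 0)"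
    if c: "\<And>e. e \<in> J \<Longrightarrow> (\<Sum>q\<in>T. of_int (c q) * row q e) = of_int d" and "d \<ge> 0" for c d
  proof -
    define l :: "'e \<Rightarrow> int" where "l e = (\<Sum>q\<in>T. c q * (int (U q e) - int (V q e)))" for e
    have l: "of_int (l e) = (\<Sum>q\<in>T. of_int (c q) * row q e)" for e
      by (simp add: l_def row_def)
    have lJ: "l e = d" if "e \<in> J" for e
      using l[of e] c[OF that] by simp
    have "(\<Sum>e | z \<in> ends e. l e) = 0" for z
    proof -
      have "(\<Sum>e | z \<in> ends e. l e) = (\<Sum>q\<in>T. c q * (\<Sum>e | z \<in> ends e. int (U q e) - int (V q e)))"
        unfolding l_def sum_distrib_left by (rule sum.swap)
      also have "\<dots> = 0"
      proof (intro sum.neutral ballI)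
        fix q
        assume "q \<in> T"
        then have "balanced ends (U q) (V q)"
          using T balanced_row by blast
        then have "(\<Sum>e | z \<in> ends e. int (U q e) - int (V q e)) = 0"
          by (simp add: balanced_def sum_subtractf flip: of_nat_sum)
        then show "c q * (\<Sum>e | z \<in> ends e. int (U q e) - int (V q e)) = 0"
          by simp
      qed
      finally show ?thesis .
    qed
    then have "incidence_kernel ends l"
      by (simp add: incidence_kernel_def)
    then have "balanced ends (\<lambda>e. nat (- l e)) (\<lambda>e. nat (l e))"
      using kernel_balanced by (auto simp: balanced_def)
    moreover have "avoid (\<lambda>e. nat (- l e))"
      using lJ \<open>d \<ge> 0\<close> by (simp add: avoid_def)
    ultimately obtain b where av: "avoid (\<lambda>e. nat (l e))"
      and b: "\<And>e. of_nat (nat (- l e)) - of_nat (nat (l e)) = (\<Sum>q\<in>B. b q * row q e)" "\<And>q. b q \<noteq> 0 \<Longrightarrow> q \<notin> T"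
      using avoid_span by blast
    have "d = 0"
      using av lJ T(4) \<open>d \<ge> 0\<close> by (fastforce simp: avoid_def)
    define h where "h q = b q + (if q \<in> T then of_int (c q) else 0)" for q
    have "(\<Sum>q\<in>B. h q * row q e) = 0" for e
    proof -
      have "(\<Sum>q\<in>B. (if q \<in> T then of_int (c q) else 0) * row q e) = of_int (l e)"
        unfolding l using T finite_B by (intro sum.mono_neutral_cong_right) auto
      moreover have "of_nat (nat (- l e)) - of_nat (nat (l e)) = (- of_int (l e) :: rat)"
        by (cases "l e \<ge> 0") auto
      ultimately show ?thesis
        using b(1)[of e] by (simp add: h_def distrib_right sum.distrib)
    qed
    then have h0: "h q = 0" if "q \<in> T" for q
      using independent that T by blast
    have "c q = 0" if "q \<in> T" for q
      using h0[OF that] that b(2)[of q] by (cases "b q = 0") (simp_all add: h_def)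
    with \<open>d = 0\<close> show ?thesis
      by blast
  qed
  \<comment> \<open>\<open>None\<close> carries the unknown constant value on \<open>J\<close>. This
    extra unknown makes the system underdetermined even if there are exactly as many mixed rows as
    columns.\<close>
  define T' where "T' = insert None (Some ` T)"
  have sumT': "(\<Sum>t\<in>T'. g t) = g None + (\<Sum>q\<in>T. g (Some q))" for g :: "'b option \<Rightarrow> rat"
    using T by (simp add: T'_def sum.reindex)
  have "card J < card T'" "finite T'"
    using T by (simp_all add: T'_def card_image)
  then obtain t where t: "\<exists>x\<in>T'. t x \<noteq> 0"
    "\<And>e. e \<in> J \<Longrightarrow> (\<Sum>x\<in>T'. t x * (case x of None \<Rightarrow> 1 | Some q \<Rightarrow> row q e)) = 0"
    using underdetermined_system[of J T' "\<lambda>x e. case x of None \<Rightarrow> 1 | Some q \<Rightarrow> row q e"] by auto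
  \<comment> \<open>Moves connect integral vectors, so denominators are cleared; the case
    distinction on \<open>m None\<close> below provides the sign that \<open>key\<close>
    requires.\<close>
  obtain K :: int where K: "K > 0" "\<forall>x\<in>T'. \<exists>m::int. of_int K * t x = of_int m"
    using common_denominator[OF \<open>finite T'\<close>] by blast
  then obtain m :: "'b option \<Rightarrow> int" where m: "\<And>x. x \<in> T' \<Longrightarrow> of_int K * t x = of_int (m x)"
    by metis
  have J_rel: "(\<Sum>q\<in>T. of_int (m (Some q)) * row q e) = of_int (- m None)" if "e \<in> J" for e
  proof -
    have "0 = of_int K * (\<Sum>x\<in>T'. t x * (case x of None \<Rightarrow> 1 | Some q \<Rightarrow> row q e))"
      using t(2)[OF that] by simp
    also have "\<dots> = of_int K * t None + (\<Sum>q\<in>T. of_int K * t (Some q) * row q e)"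
      by (simp add: sumT' distrib_left sum_distrib_left mult.assoc)
    also have "\<dots> = of_int (m None) + (\<Sum>q\<in>T. of_int (m (Some q)) * row q e)"
      using m by (simp add: T'_def)
    finally show ?thesis
      by simp
  qed
  have "m None = 0 \<and> (\<forall>q\<in>T. m (Some q) = 0)"
  proof (cases "m None \<le> 0")
    case True
    with key[of "\<lambda>q. m (Some q)" "- m None"] J_rel show ?thesis
      by auto
  next
    case False
    have "(\<Sum>q\<in>T. of_int (- m (Some q)) * row q e) = of_int (m None)" if "e \<in> J" for e
      using J_rel[OF that] by (simp add: sum_negf)
    with key[of "\<lambda>q. - m (Some q)" "m None"] False show ?thesis
      by auto
  qed
  then have "t x = 0" if "x \<in> T'" for x
    using m[OF that] K(1) that by (auto simp: T'_def)
  with t(1) show False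
    by blast
qed

text \<open>The 1 x 1 case of \<open>few_mixed_rows\<close>: the two terms of a binomial of the
  system are coprime.\<close>

lemma row_sides_disjoint:
  assumes "q \<in> B" "U q e \<noteq> 0"
  shows "V q e = 0"
proof (rule ccontr)
  assume "V q e \<noteq> 0"
  then have "q \<in> {q\<in>B. mixed q {e}}"
    using assms by (simp add: mixed_def)
  then show False
    using few_mixed_rows[of "{e}"] finite_B by (auto simp: card_eq_0_iff)
qed

text \<open>Following successors into smaller and smaller images leads to a set permuted by the
  successor map. One edge for each arc then gives at most as many columns as rows, and each row is
  met on both sides, by its outgoing and its incoming arc. \<open>P\<close> and \<open>N\<close>
  leave the orientation of each row free.\<close>

lemma no_cycle_of_rows:
  assumes "T \<subseteq> B" "T \<noteq> {}"
    and sides: "\<And>q. q \<in> T \<Longrightarrow> (P q \<subseteq> {e. U q e \<noteq> 0} \<and> N q \<subseteq> {e. V q e \<noteq> 0}) \<or>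
                          (P q \<subseteq> {e. V q e \<noteq> 0} \<and> N q \<subseteq> {e. U q e \<noteq> 0})"
    and succ: "\<And>q. q \<in> T \<Longrightarrow> \<exists>q'\<in>T. N q \<inter> P q' \<noteq> {}"
  shows False
  using assms
proof (induction "card T" arbitrary: T rule: less_induct)
  case less
  have finT: "finite T"
    using less.prems(1) finite_B finite_subset by blast
  have "\<exists>f. \<forall>q\<in>T. f q \<in> T \<and> N q \<inter> P (f q) \<noteq> {}"
    using less.prems(4) by (intro bchoice) blast
  then obtain f where f: "\<And>q. q \<in> T \<Longrightarrow> f q \<in> T" "\<And>q. q \<in> T \<Longrightarrow> N q \<inter> P (f q) \<noteq> {}"
    by blast
  show False
  proof (cases "f ` T = T")
    case False
    have "f ` T \<subset> T"
      using f False by auto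
    then have "card (f ` T) < card T"
      using finT by (rule psubset_card_mono[rotated])
    then show False
    proof (rule less.hyps)
      show "f ` T \<subseteq> B"
        using less.prems(1) f(1) by blast
      show "f ` T \<noteq> {}"
        using less.prems(2) by simp
    qed (use less.prems(3) f in blast)+
  next
    case True
    have "\<exists>h. \<forall>q\<in>T. h q \<in> N q \<inter> P (f q)"
      using f(2) by (intro bchoice) blast
    then obtain h where h: "\<And>q. q \<in> T \<Longrightarrow> h q \<in> N q" "\<And>q. q \<in> T \<Longrightarrow> h q \<in> P (f q)"
      by blast
    have "mixed q (h ` T)" if "q \<in> T" for q
    proof -
      obtain q' where "q' \<in> T" "q = f q'"
        using True \<open>q \<in> T\<close> by blast
      then have "h q \<in> N q" "h q' \<in> P q" "h q \<in> h ` T" "h q' \<in> h ` T"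
        using h that by auto
      with less.prems(3)[OF that] show ?thesis
        by (auto simp: mixed_def)
    qed
    then have "T \<subseteq> {q\<in>B. mixed q (h ` T)}"
      using less.prems(1) by blast
    then have "card T \<le> card {q\<in>B. mixed q (h ` T)}"
      using finite_B by (intro card_mono) auto
    also have "\<dots> < card (h ` T)"
      using less.prems(2) by (intro few_mixed_rows) auto
    also have "\<dots> \<le> card T"
      using finT by (rule card_image_le)
    finally show False
      by simp
  qed
qed

text \<open>A proper balanced part and its complement both have smaller degree than
  \<open>p\<close>, so by \<open>balanced_span\<close> each is a combination of rows without
  \<open>p\<close>. Their sum is the row of \<open>p\<close>, contradicting independence.\<close>

lemma row_primitive:
  assumes p: "p \<in> B" and le: "\<And>e. a e \<le> U p e" "\<And>e. b e \<le> V p e" and bal: "balanced ends a b"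
  shows "(\<Sum>e\<in>UNIV. a e) = 0 \<or> (\<Sum>e\<in>UNIV. a e) = (\<Sum>e\<in>UNIV. U p e)"
proof (rule ccontr)
  assume neg: "\<not> ?thesis"
  let ?a' = "\<lambda>e. U p e - a e" and ?b' = "\<lambda>e. V p e - b e"
  have sum_a': "(\<Sum>e\<in>E. ?a' e) = (\<Sum>e\<in>E. U p e) - (\<Sum>e\<in>E. a e)"
    and sum_b': "(\<Sum>e\<in>E. ?b' e) = (\<Sum>e\<in>E. V p e) - (\<Sum>e\<in>E. b e)" for E
    using le by (simp_all add: sum_subtractf_nat)
  have bal': "balanced ends ?a' ?b'"
    using bal balanced_row[OF p] by (simp add: balanced_def sum_a' sum_b')
  have "(\<Sum>e\<in>UNIV. a e) \<le> (\<Sum>e\<in>UNIV. U p e)"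
    using le by (intro sum_mono)
  with neg have small: "(\<Sum>e\<in>UNIV. a e) < (\<Sum>e\<in>UNIV. U p e)" "(\<Sum>e\<in>UNIV. ?a' e) < (\<Sum>e\<in>UNIV. U p e)"
    unfolding sum_a' by linarith+
  obtain c where c: "(\<forall>e. of_nat (a e) - of_nat (b e) = (\<Sum>q\<in>B. c q * row q e)) \<and>
      (\<forall>q. c q \<noteq> 0 \<longrightarrow> (\<Sum>e\<in>UNIV. U q e) \<le> (\<Sum>e\<in>UNIV. a e))"
    using balanced_span[OF bal] by (rule exE)
  obtain c' where c': "(\<forall>e. of_nat (?a' e) - of_nat (?b' e) = (\<Sum>q\<in>B. c' q * row q e)) \<and>
      (\<forall>q. c' q \<noteq> 0 \<longrightarrow> (\<Sum>e\<in>UNIV. U q e) \<le> (\<Sum>e\<in>UNIV. ?a' e))"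
    using balanced_span[OF bal'] by (rule exE)
  have cp: "c p = 0" "c' p = 0"
    using spec[OF conjunct2[OF c], of p] spec[OF conjunct2[OF c'], of p] small by linarith+
  define h where "h q = c q + c' q - (if q = p then 1 else 0)" for q
  have "(\<Sum>q\<in>B. h q * row q e) = 0" for e
  proof -
    have "(\<Sum>q\<in>B. h q * row q e) = (\<Sum>q\<in>B. c q * row q e) + (\<Sum>q\<in>B. c' q * row q e) -
        (\<Sum>q\<in>B. (if q = p then row p e else 0))"
      unfolding sum.distrib[symmetric] sum_subtractf[symmetric]
      by (intro sum.cong) (auto simp: h_def algebra_simps)
    also have "(\<Sum>q\<in>B. (if q = p then row p e else 0)) = row p e"
      using finite_B p by simp
    also have "(\<Sum>q\<in>B. c q * row q e) + (\<Sum>q\<in>B. c' q * row q e) - row p e = 0"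
      unfolding conjunct1[OF c, rule_format, symmetric] conjunct1[OF c', rule_format, symmetric] using le[of e] by (simp add: row_def of_nat_diff)
    finally show ?thesis .
  qed
  then have "h p = 0"
    using independent p by blast
  then show False
    by (simp add: h_def cp)
qed

text \<open>Write \<open>l\<close> as a combination of rows. The rows other than \<open>p\<close> that occur, oriented by the
  sign of their coefficient, form an acyclic digraph whose maximal paths start and end in the support
  of \<open>p\<close>; a path from one side of \<open>p\<close> to the other would close up to a cycle through \<open>p\<close>.\<close>

lemma restriction_to_side:
  assumes p: "p \<in> B" and ker: "incidence_kernel ends l"
    and supp: "\<And>e. U p e = 0 \<Longrightarrow> V p e = 0 \<Longrightarrow> l e = 0"
  shows "\<exists>x::rat. \<forall>z. (\<Sum>e | z \<in> ends e. if U p e \<noteq> 0 then of_int (l e) else 0) =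
           x * (\<Sum>e | z \<in> ends e. of_nat (U p e))"
proof -
  obtain c where c: "\<forall>e. of_int (l e) = (\<Sum>q\<in>B. c q * row q e)"
    using kernel_span[OF ker] by (rule exE)
  define R where "R = {e. U p e \<noteq> 0}"
  define L where "L = {e. V p e \<noteq> 0}"
  have RL: "R \<inter> L = {}"
    using row_sides_disjoint[OF p] by (auto simp: R_def L_def)
  define T where "T = {q\<in>B. q \<noteq> p \<and> c q \<noteq> 0}"
  have T: "T \<subseteq> B" "finite T" "p \<notin> T"
    using finite_B by (auto simp: T_def)
  define s where "s q e = c q * row q e" for q e
  define P where "P q = {e. s q e > 0}" for q
  define N where "N q = {e. s q e < 0}" for q
  have lT: "of_int (l e) = (\<Sum>q\<in>T. s q e) + c p * row p e" for e
  proof -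
    have "(\<Sum>q\<in>B. c q * row q e) = c p * row p e + (\<Sum>q\<in>B - {p}. c q * row q e)"
      using finite_B p by (simp add: sum.remove)
    also have "(\<Sum>q\<in>B - {p}. c q * row q e) = (\<Sum>q\<in>T. s q e)"
      unfolding s_def using finite_B by (intro sum.mono_neutral_right) (auto simp: T_def)
    finally show ?thesis
      using spec[OF c, of e] by simp
  qed
  have cancel: "(\<Sum>q\<in>T. s q e) = 0" if "e \<notin> R" "e \<notin> L" for e
    using that lT[of e] supp[of e] by (simp add: R_def L_def row_def)
  have sides: "(P q \<subseteq> {e. U q e \<noteq> 0} \<and> N q \<subseteq> {e. V q e \<noteq> 0}) \<or>
      (P q \<subseteq> {e. V q e \<noteq> 0} \<and> N q \<subseteq> {e. U q e \<noteq> 0})" if "q \<in> T" for q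
  proof (cases "c q > 0")
    case True
    then show ?thesis
      by (auto simp: P_def N_def s_def row_def zero_less_mult_iff mult_less_0_iff)
  next
    case False
    then have "c q < 0"
      using that by (simp add: T_def)
    then show ?thesis
      by (auto simp: P_def N_def s_def row_def zero_less_mult_iff mult_less_0_iff)
  qed
  have nonempty: "P q \<noteq> {} \<and> N q \<noteq> {}" if "q \<in> T" for q
  proof -
    have q: "q \<in> B" "c q \<noteq> 0"
      using that by (auto simp: T_def)
    obtain e f where ef: "U q e \<noteq> 0" "V q f \<noteq> 0"
      using U_nonzero[OF q(1)] V_nonzero[OF q(1)] by blast
    have "V q e = 0"
      by (rule row_sides_disjoint[OF q(1) ef(1)])
    moreover have "U q f = 0"
      using row_sides_disjoint[OF q(1), of f] ef(2) by auto
    ultimately have "row q e > 0" "row q f < 0"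
      using ef by (simp_all add: row_def)
    then have "(s q e > 0 \<and> s q f < 0) \<or> (s q e < 0 \<and> s q f > 0)"
      using q(2) by (auto simp: s_def zero_less_mult_iff mult_less_0_iff)
    then show ?thesis
      by (auto simp: P_def N_def)
  qed
  have N_to_P: "\<exists>q'\<in>T. e \<in> P q'" if "q \<in> T" "e \<in> N q" "e \<notin> R" "e \<notin> L" for q e
    using sum_zero_opposite_sign[OF T(2) cancel[OF that(3,4)] that(1)] that(2) by (auto simp: N_def P_def)
  have P_to_N: "\<exists>q'\<in>T. e \<in> N q'" if "q \<in> T" "e \<in> P q" "e \<notin> R" "e \<notin> L" for q e
  proof -
    have "(\<Sum>q\<in>T. - s q e) = 0"
      using cancel[OF that(3,4)] by (simp add: sum_negf)
    from sum_zero_opposite_sign[OF T(2) this that(1)] that(2) show ?thesis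
      by (auto simp: N_def P_def)
  qed
  define D where "D = {(q, q'). q \<in> T \<and> q' \<in> T \<and> N q \<inter> P q' \<noteq> {}}"
  \<comment> \<open>Arcs of \<open>D\<close> go from a negative to a positive entry at a common
    edge. \<open>Z X\<close> collects the rows with a path that leaves through \<open>X\<close>, and
    \<open>Y X\<close> those on a path that entered through \<open>X\<close>.\<close>
  define Z where "Z X = {q\<in>T. \<exists>q'\<in>T. (q, q') \<in> D\<^sup>* \<and> N q' \<inter> X \<noteq> {}}" for X
  define Y where "Y X = {q\<in>T. \<exists>q'\<in>T. (q', q) \<in> D\<^sup>* \<and> P q' \<inter> X \<noteq> {}}" for X
  have Z_base: "q \<in> Z X" if "q \<in> T" "N q \<inter> X \<noteq> {}" for q X
    using that by (auto simp: Z_def)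
  have Y_base: "q \<in> Y X" if "q \<in> T" "P q \<inter> X \<noteq> {}" for q X
    using that by (auto simp: Y_def)
  have Z_step: "q \<in> Z X" if "(q, q') \<in> D" "q' \<in> Z X" for q q' X
    using that by (auto simp: Z_def D_def intro: converse_rtrancl_into_rtrancl)
  have Y_step: "q' \<in> Y X" if "(q, q') \<in> D" "q \<in> Y X" for q q' X
    using that by (auto simp: Y_def D_def intro: rtrancl_into_rtrancl)
  have Z_cases: "N q \<inter> X \<noteq> {} \<or> (\<exists>q'. (q, q') \<in> D \<and> q' \<in> Z X)" if q: "q \<in> Z X" for q X
  proof -
    obtain q' where q': "q' \<in> T" "(q, q') \<in> D\<^sup>*" "N q' \<inter> X \<noteq> {}"
      using q unfolding Z_def by blast
    from q'(2) show ?thesis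
    proof (cases rule: converse_rtranclE)
      case base
      with q' show ?thesis by simp
    next
      case (step y)
      then have "y \<in> Z X"
        using q' by (auto simp: Z_def D_def)
      with step show ?thesis
        by blast
    qed
  qed
  \<comment> \<open>Rows that never leave through \<open>R\<close> or \<open>L\<close> would all
    have successors of the same kind, since off the support of \<open>p\<close> every negative entry
    is cancelled by a positive one.\<close>
  have Z_cover: "T \<subseteq> Z R \<union> Z L"
  proof (rule ccontr)
    let ?T0 = "T - (Z R \<union> Z L)"
    assume "\<not> ?thesis"
    then have "?T0 \<noteq> {}"
      by blast
    moreover have "\<exists>q'\<in>?T0. N q \<inter> P q' \<noteq> {}" if q: "q \<in> ?T0" for q
    proof -
      obtain e where e: "e \<in> N q"
        using q nonempty by blast
      then have "e \<notin> R" "e \<notin> L"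
        using q Z_base by blast+
      then obtain q' where q': "q' \<in> T" "e \<in> P q'"
        using N_to_P q e by blast
      then have "(q, q') \<in> D"
        using q e by (auto simp: D_def)
      then have "q' \<in> ?T0"
        using q q' Z_step by blast
      with e q' show ?thesis
        by blast
    qed
    ultimately show False
      using T(1) sides by (intro no_cycle_of_rows[of ?T0 P N]) auto
  qed
  have Y_cover: "T \<subseteq> Y R \<union> Y L"
  proof (rule ccontr)
    let ?T0 = "T - (Y R \<union> Y L)"
    assume "\<not> ?thesis"
    then have ne: "?T0 \<noteq> {}"
      by blast
    have succ: "\<exists>q'\<in>?T0. P q \<inter> N q' \<noteq> {}" if q: "q \<in> ?T0" for q
    proof -
      obtain e where e: "e \<in> P q"
        using q nonempty by blast
      then have "e \<notin> R" "e \<notin> L"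
        using q Y_base by blast+
      then obtain q' where q': "q' \<in> T" "e \<in> N q'"
        using P_to_N q e by blast
      then have "(q', q) \<in> D"
        using q e by (auto simp: D_def)
      then have "q' \<in> ?T0"
        using q q' Y_step by blast
      with e q' show ?thesis
        by blast
    qed
    show False
    proof (rule no_cycle_of_rows[of ?T0 N P, OF _ ne _ succ])
      show "?T0 \<subseteq> B"
        using T(1) by blast
      show "(N q \<subseteq> {e. U q e \<noteq> 0} \<and> P q \<subseteq> {e. V q e \<noteq> 0}) \<or>
          (N q \<subseteq> {e. V q e \<noteq> 0} \<and> P q \<subseteq> {e. U q e \<noteq> 0})" if "q \<in> ?T0" for q
        using sides[of q] that by blast
    qed
  qed
  have no_crossing: "Z X' \<inter> Y X = {}" if X: "(X = R \<and> X' = L) \<or> (X = L \<and> X' = R)" for X X'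
  proof (rule ccontr)
    assume "Z X' \<inter> Y X \<noteq> {}"
    then obtain q where q: "q \<in> Z X'" "q \<in> Y X"
      by blast
    \<comment> \<open>The row \<open>p\<close> is oriented so that it closes a path entering at
      \<open>X\<close> and leaving at \<open>X'\<close>.\<close>
    let ?P = "P(p := X')" and ?N = "N(p := X)" and ?C = "Z X' \<inter> Y X"
    have CT: "?C \<subseteq> T"
      by (auto simp: Z_def)
    show False
    proof (rule no_cycle_of_rows[of "insert p ?C" ?P ?N])
      show "insert p ?C \<subseteq> B"
        using CT T p by blast
      show "(?P q \<subseteq> {e. U q e \<noteq> 0} \<and> ?N q \<subseteq> {e. V q e \<noteq> 0}) \<or>
          (?P q \<subseteq> {e. V q e \<noteq> 0} \<and> ?N q \<subseteq> {e. U q e \<noteq> 0})" if "q \<in> insert p ?C" for q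
      proof (cases "q = p")
        case True
        then show ?thesis
          using X by (auto simp: R_def L_def)
      next
        case False
        then have "q \<in> T"
          using that CT by blast
        from sides[OF this] show ?thesis
          using False by simp
      qed
      show "\<exists>q'\<in>insert p ?C. ?N r \<inter> ?P q' \<noteq> {}" if r: "r \<in> insert p ?C" for r
      proof (cases "r = p")
        case True
        obtain q0 where q0: "q0 \<in> T" "(q0, q) \<in> D\<^sup>*" "P q0 \<inter> X \<noteq> {}"
          using q(2) by (auto simp: Y_def)
        have "q0 \<in> Z X'"
          using q(1) q0(1,2) by (auto simp: Z_def intro: rtrancl_trans)
        moreover have "q0 \<in> Y X"
          using q0 Y_base by blast
        ultimately show ?thesis
          using True q0 T(3) by (intro bexI[of _ q0]) auto
      next
        case False
        then have r': "r \<in> Z X'" "r \<in> Y X" "r \<in> T"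
          using r CT by auto
        from Z_cases[OF r'(1)] show ?thesis
        proof
          assume "N r \<inter> X' \<noteq> {}"
          then show ?thesis
            using False by (intro bexI[of _ p]) auto
        next
          assume "\<exists>q'. (r, q') \<in> D \<and> q' \<in> Z X'"
          then obtain q' where q': "(r, q') \<in> D" "q' \<in> Z X'"
            by blast
          then have "q' \<in> ?C"
            using r' Y_step by blast
          moreover have "N r \<inter> P q' \<noteq> {}" "q' \<noteq> p"
            using q' T(3) by (auto simp: D_def)
          ultimately show ?thesis
            using False by (intro bexI[of _ q']) auto
        qed
      qed
    qed simp
  qed
  have ZL_YR: "Z L \<inter> Y R = {}" and ZR_YL: "Z R \<inter> Y L = {}"
    using no_crossing[of R L] no_crossing[of L R] by auto
  have ZT: "Z X \<subseteq> T" and YT: "Y X \<subseteq> T" for X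
    by (auto simp: Z_def Y_def)
  have ZY_R: "Z R = Y R" and ZY_L: "Z L = Y L" and RL_T: "Z R \<inter> Z L = {}" "T = Z R \<union> Z L"
    using Z_cover Y_cover ZL_YR ZR_YL ZT YT by blast+
  have zero_ZR_L: "s q e = 0" if "q \<in> Z R" "e \<in> L" for q e
  proof (rule ccontr)
    assume "s q e \<noteq> 0"
    then have "e \<in> N q \<or> e \<in> P q"
      by (auto simp: N_def P_def)
    then have "q \<in> Z L \<or> q \<in> Y L"
      using Z_base[of q L] Y_base[of q L] ZT that by blast
    then show False
      using that RL_T ZY_L by blast
  qed
  have zero_ZL_R: "s q e = 0" if "q \<in> Z L" "e \<in> R" for q e
  proof (rule ccontr)
    assume "s q e \<noteq> 0"
    then have "e \<in> N q \<or> e \<in> P q"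
      by (auto simp: N_def P_def)
    then have "q \<in> Z R \<or> q \<in> Y R"
      using Z_base[of q R] Y_base[of q R] ZT that by blast
    then show False
      using that RL_T ZY_R by blast
  qed
  \<comment> \<open>The rows of \<open>T\<close> fall into those attached to \<open>R\<close> and
    those attached to \<open>L\<close>. The partial sum over the first class has degree 0 at each
    vertex and turns out to vanish outside \<open>R\<close>; so \<open>l\<close> on \<open>R\<close>
    is this sum plus \<open>c p\<close> times the first term of \<open>p\<close>, and
    \<open>c p\<close> is the factor sought.\<close>
  define \<Lambda> where "\<Lambda> e = (\<Sum>q\<in>Z R. s q e)" for e
  have \<Lambda>_out: "\<Lambda> e = 0" if e: "e \<notin> R" "e \<notin> L" for e
  proof (cases "\<exists>q\<in>Z R. s q e \<noteq> 0")
    case False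
    then show ?thesis
      by (simp add: \<Lambda>_def)
  next
    case True
    then obtain q0 where q0: "q0 \<in> Z R" "s q0 e \<noteq> 0"
      by blast
    \<comment> \<open>Opposite signs at \<open>e\<close> mean an arc, and arcs stay within a class.
      As the entries at \<open>e\<close> cancel, both signs occur, so all rows with an entry at
      \<open>e\<close> lie in one class.\<close>
    have same: "q \<in> Z R \<longleftrightarrow> q' \<in> Z R" if "q \<in> T" "q' \<in> T" "e \<in> N q" "e \<in> P q'" for q q'
    proof -
      have "(q, q') \<in> D"
        using that by (auto simp: D_def)
      then show ?thesis
        using Z_step[of q q' R] Y_step[of q q' R] ZY_R by blast
    qed
    have "q0 \<in> T" "e \<in> N q0 \<or> e \<in> P q0"
      using q0 ZT by (auto simp: N_def P_def)
    then obtain qn qp where qn: "qn \<in> T" "e \<in> N qn" and qp: "qp \<in> T" "e \<in> P qp" and "qn \<in> Z R" "qp \<in> Z R"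
      using N_to_P[OF _ _ e] P_to_N[OF _ _ e] same q0(1) by metis
    have "q \<in> Z R" if "q \<in> T" "s q e \<noteq> 0" for q
    proof -
      have "e \<in> N q \<or> e \<in> P q"
        using that by (auto simp: N_def P_def)
      then show ?thesis
        using same[OF that(1) qp(1) _ qp(2)] same[OF qn(1) that(1) qn(2)] \<open>qn \<in> Z R\<close> \<open>qp \<in> Z R\<close> by blast
    qed
    then have "\<Lambda> e = (\<Sum>q\<in>T. s q e)"
      unfolding \<Lambda>_def using T(2) ZT by (intro sum.mono_neutral_left) auto
    then show ?thesis
      using cancel[OF e] by simp
  qed
  have part: "(if U p e \<noteq> 0 then of_int (l e) else 0) = \<Lambda> e + c p * of_nat (U p e)" for e
  proof (cases "e \<in> R")
    case True
    then have "e \<notin> L"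
      using RL by blast
    have "(\<Sum>q\<in>T. s q e) = \<Lambda> e"
      unfolding \<Lambda>_def using T(2) ZT RL_T(2) zero_ZL_R[OF _ True] by (intro sum.mono_neutral_right) auto
    then show ?thesis
      using True \<open>e \<notin> L\<close> lT[of e] by (simp add: R_def L_def row_def)
  next
    case False
    have "\<Lambda> e = 0"
      using False \<Lambda>_out zero_ZR_L by (cases "e \<in> L") (auto simp: \<Lambda>_def)
    then show ?thesis
      using False by (simp add: R_def)
  qed
  have \<Lambda>_ker: "(\<Sum>e | z \<in> ends e. \<Lambda> e) = 0" for z
  proof -
    have "(\<Sum>e | z \<in> ends e. \<Lambda> e) = (\<Sum>q\<in>Z R. c q * (\<Sum>e | z \<in> ends e. row q e))"
      unfolding \<Lambda>_def s_def sum_distrib_left by (rule sum.swap)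
    also have "\<dots> = 0"
    proof (intro sum.neutral ballI)
      fix q
      assume "q \<in> Z R"
      then have "balanced ends (U q) (V q)"
        using ZT T balanced_row by blast
      then have "(\<Sum>e | z \<in> ends e. row q e) = 0"
        by (simp add: row_def balanced_def sum_subtractf flip: of_nat_sum)
      then show "c q * (\<Sum>e | z \<in> ends e. row q e) = 0"
        by simp
    qed
    finally show ?thesis .
  qed
  show ?thesis
    unfolding part sum.distrib \<Lambda>_ker by (intro exI[of _ "c p"]) (simp add: sum_distrib_left)
qed

end

subsection \<open>Alternating walks\<close>

lemma sum_over_preimage:
  fixes g :: "'i \<Rightarrow> 'e::finite" and f :: "'i \<Rightarrow> 'c::comm_monoid_add"
  assumes "finite X"
  shows "(\<Sum>e\<in>S. \<Sum>i | i \<in> X \<and> g i = e. f i) = (\<Sum>i | i \<in> X \<and> g i \<in> S. f i)"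
proof -
  let ?Y = "{i. i \<in> X \<and> g i \<in> S}"
  have "(\<Sum>e\<in>S. \<Sum>i | i \<in> X \<and> g i = e. f i) = (\<Sum>e\<in>S. \<Sum>i | i \<in> ?Y \<and> g i = e. f i)"
    by (intro sum.cong) auto
  also have "\<dots> = (\<Sum>i\<in>?Y. f i)"
    using assms by (intro sum.group) auto
  finally show ?thesis .
qed

lemma card_over_preimage:
  fixes g :: "'i \<Rightarrow> 'e::finite"
  assumes "finite X"
  shows "(\<Sum>e\<in>S. card {i\<in>X. g i = e}) = card {i\<in>X. g i \<in> S}"
  using sum_over_preimage[OF assms, where f = "\<lambda>_. 1::nat"] by simp

definition trail :: "('e \<Rightarrow> 'v set) \<Rightarrow> nat \<Rightarrow> (nat \<Rightarrow> 'v) \<Rightarrow> (nat \<Rightarrow> 'e) \<Rightarrow> bool" where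
  "trail ends n v g \<longleftrightarrow> (\<forall>i<n. ends (g i) = {v i, v (Suc i)})"

definition alternating_walk ::
  "('e \<Rightarrow> 'v set) \<Rightarrow> ('e \<Rightarrow> nat) \<Rightarrow> ('e \<Rightarrow> nat) \<Rightarrow> nat \<Rightarrow> (nat \<Rightarrow> 'v) \<Rightarrow> (nat \<Rightarrow> 'e) \<Rightarrow> bool" where
  "alternating_walk ends a b n v g \<longleftrightarrow> trail ends n v g \<and> n > 0 \<and> even n \<and> v n = v 0 \<and>
     (\<forall>e. a e = card {i\<in>{i\<in>{..<n}. even i}. g i = e}) \<and> (\<forall>e. b e = card {i\<in>{i\<in>{..<n}. odd i}. g i = e})"

text \<open>As \<open>n\<close> is even, a cyclic shift by an odd amount exchanges even and odd
  steps; this is the source of the sign in the final statement.\<close>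

lemma alternating_walk_rotate:
  assumes w: "alternating_walk ends a b n v g" and "r < n"
  defines "v' \<equiv> \<lambda>t. v ((t + r) mod n)" and "g' \<equiv> \<lambda>t. g ((t + r) mod n)"
  shows "if even r then alternating_walk ends a b n v' g' else alternating_walk ends b a n v' g'"
proof -
  have n: "n > 0" "even n" "v n = v 0" and tr: "trail ends n v g"
    using w by (auto simp: alternating_walk_def)
  have vSuc: "v (Suc m mod n) = v (Suc m)" if "m < n" for m
    using that n by (cases "Suc m = n") auto
  have "ends (g' t) = {v' t, v' (Suc t)}" for t
  proof -
    let ?m = "(t + r) mod n"
    have "?m < n"
      using n by simp
    moreover have "(Suc t + r) mod n = Suc ?m mod n"
      by (simp add: mod_Suc_eq)
    ultimately show ?thesis
      using tr vSuc[of ?m] by (simp add: v'_def g'_def trail_def)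
  qed
  then have tr': "trail ends n v' g'"
    by (simp add: trail_def)
  have v'n: "v' n = v' 0"
    by (simp add: v'_def)
  have "(t + r) mod n = (if t + r < n then t + r else t + r - n)" if "t < n" for t
    using that \<open>r < n\<close> by (auto simp: le_mod_geq)
  then have inj: "inj_on (\<lambda>t. (t + r) mod n) {..<n}"
    by (intro inj_onI) (auto split: if_splits)
  have "(\<lambda>t. (t + r) mod n) ` {..<n} \<subseteq> {..<n}"
    using n by auto
  with inj have bij: "bij_betw (\<lambda>t. (t + r) mod n) {..<n} {..<n}"
    by (simp add: bij_betw_def endo_inj_surj)
  have parity: "even ((t + r) mod n) \<longleftrightarrow> even (t + r)" for t
    using n by (simp add: dvd_mod_iff)
  have count: "card {t\<in>{t\<in>{..<n}. P ((t + r) mod n)}. g' t = e} = card {m\<in>{m\<in>{..<n}. P m}. g m = e}" for P e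
  proof (rule bij_betw_same_card)
    show "bij_betw (\<lambda>t. (t + r) mod n) {t\<in>{t\<in>{..<n}. P ((t + r) mod n)}. g' t = e} {m\<in>{m\<in>{..<n}. P m}. g m = e}"
      unfolding bij_betw_def
    proof
      show "inj_on (\<lambda>t. (t + r) mod n) {t\<in>{t\<in>{..<n}. P ((t + r) mod n)}. g' t = e}"
        by (rule inj_on_subset[OF inj]) auto
      have "m \<in> (\<lambda>t. (t + r) mod n) ` {t\<in>{t\<in>{..<n}. P ((t + r) mod n)}. g' t = e}"
        if "m < n" "P m" "g m = e" for m
      proof -
        have "m \<in> (\<lambda>t. (t + r) mod n) ` {..<n}"
          using bij that(1) by (simp add: bij_betw_def)
        then show ?thesis
          using that by (auto simp: g'_def)
      qed
      then show "(\<lambda>t. (t + r) mod n) ` {t\<in>{t\<in>{..<n}. P ((t + r) mod n)}. g' t = e} = {m\<in>{m\<in>{..<n}. P m}. g m = e}"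
        using n by (auto simp: g'_def)
    qed
  qed
  have ab: "a e = card {i\<in>{i\<in>{..<n}. even i}. g i = e}" "b e = card {i\<in>{i\<in>{..<n}. odd i}. g i = e}" for e
    using w by (simp_all add: alternating_walk_def)
  have "if even r then (card {t\<in>{t\<in>{..<n}. even t}. g' t = e} = a e \<and> card {t\<in>{t\<in>{..<n}. odd t}. g' t = e} = b e)
      else (card {t\<in>{t\<in>{..<n}. even t}. g' t = e} = b e \<and> card {t\<in>{t\<in>{..<n}. odd t}. g' t = e} = a e)" for e
    using count[of even e] count[of odd e] ab[of e] by (cases "even r") (simp_all add: parity)
  then show ?thesis
    using tr' n v'n by (cases "even r") (simp_all add: alternating_walk_def)
qed

definition hits :: "(nat \<Rightarrow> 'v) \<Rightarrow> nat \<Rightarrow> 'v \<Rightarrow> int" where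
  "hits v i z = (if v i = z then 1 else 0) + (if v (Suc i) = z then 1 else 0)"

text \<open>The sum telescopes: every inner visit is counted by two consecutive steps with opposite
  signs.\<close>

lemma alternating_sum_hits:
  assumes "j \<le> k"
  shows "(\<Sum>i=j..<k. (-1) ^ i * hits v i z) =
      (-1) ^ j * (if v j = z then 1 else 0) - (-1) ^ k * (if v k = z then 1 else 0)"
  using assms by (induction rule: dec_induct) (auto simp: hits_def)

text \<open>All that the graph theory below retains of the complete intersection property:
  \<open>primitive\<close> comes from \<open>row_primitive\<close>, and \<open>restriction\<close>
  from \<open>restriction_to_side\<close>.\<close>

locale primitive_pair =
  fixes ends :: "'e::finite \<Rightarrow> 'v::finite set" and a b :: "'e \<Rightarrow> nat"
  assumes two_ends: "card (ends e) = 2"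
    and inj_ends: "inj ends"
    and disjoint: "a e = 0 \<or> b e = 0"
    and nonzero: "\<exists>e. a e \<noteq> 0"
    and balanced_pair: "balanced ends a b"
    and primitive: "(\<And>e. a' e \<le> a e) \<Longrightarrow> (\<And>e. b' e \<le> b e) \<Longrightarrow> balanced ends a' b' \<Longrightarrow>
      (\<Sum>e\<in>UNIV. a' e) = 0 \<or> (\<Sum>e\<in>UNIV. a' e) = (\<Sum>e\<in>UNIV. a e)"
    and restriction: "incidence_kernel ends l \<Longrightarrow> (\<And>e. a e = 0 \<Longrightarrow> b e = 0 \<Longrightarrow> l e = 0) \<Longrightarrow>
      \<exists>x::rat. \<forall>z. (\<Sum>e | z \<in> ends e. if a e \<noteq> 0 then of_int (l e) else 0) =
        x * (\<Sum>e | z \<in> ends e. of_nat (a e))"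
begin

lemma balanced_total:
  assumes "balanced ends u w"
  shows "(\<Sum>e\<in>UNIV. u e) = (\<Sum>e\<in>UNIV. w e)"
  using assms sum_mono_image[of ends u] sum_mono_image[of ends w] two_ends
  by (simp add: balanced_def)

lemma trail_step_neq:
  assumes "trail ends n v g" "i < n"
  shows "v i \<noteq> v (Suc i)"
proof
  assume "v i = v (Suc i)"
  then have "card (ends (g i)) = 1"
    using assms by (simp add: trail_def)
  then show False
    by (simp add: two_ends)
qed

lemma hits_trail:
  assumes "trail ends n v g" "i < n"
  shows "hits v i z = (if z \<in> ends (g i) then 1 else 0)"
  using trail_step_neq[OF assms] assms by (auto simp: hits_def trail_def)

lemma sum_incident_count:
  assumes "trail ends n v g" "X \<subseteq> {..<n}"
  shows "int (\<Sum>e | z \<in> ends e. card {i\<in>X. g i = e}) = (\<Sum>i\<in>X. hits v i z)"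
proof -
  have fin: "finite X"
    using assms(2) finite_subset by blast
  have "int (\<Sum>e | z \<in> ends e. card {i\<in>X. g i = e}) = int (card {i\<in>X. z \<in> ends (g i)})"
    using card_over_preimage[OF fin, of g "{e. z \<in> ends e}"] by simp
  also have "\<dots> = (\<Sum>i\<in>X. if z \<in> ends (g i) then 1 else 0)"
    using fin by (simp add: sum.If_cases Int_def)
  also have "\<dots> = (\<Sum>i\<in>X. hits v i z)"
    using assms by (intro sum.cong refl) (auto simp: hits_trail)
  finally show ?thesis .
qed

lemma sum_even_odd:
  fixes f :: "nat \<Rightarrow> int"
  assumes "finite X"
  shows "(\<Sum>i\<in>X. (-1) ^ i * f i) = (\<Sum>i\<in>{i\<in>X. even i}. f i) - (\<Sum>i\<in>{i\<in>X. odd i}. f i)"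
proof -
  have "(\<Sum>i\<in>X. (-1) ^ i * f i) =
      (\<Sum>i\<in>{i\<in>X. even i}. (-1) ^ i * f i) + (\<Sum>i\<in>{i\<in>X. odd i}. (-1) ^ i * f i)"
    using assms by (subst sum.union_disjoint[symmetric]) (auto intro!: sum.cong)
  also have "(\<Sum>i\<in>{i\<in>X. even i}. (-1) ^ i * f i) = (\<Sum>i\<in>{i\<in>X. even i}. f i)"
    by (intro sum.cong) auto
  also have "(\<Sum>i\<in>{i\<in>X. odd i}. (-1) ^ i * f i) = - (\<Sum>i\<in>{i\<in>X. odd i}. f i)"
    unfolding sum_negf[symmetric] by (intro sum.cong) auto
  finally show ?thesis
    by simp
qed

lemma balanced_counts:
  assumes "trail ends n v g" "X \<subseteq> {..<n}" "\<And>z. (\<Sum>i\<in>X. (-1) ^ i * hits v i z) = 0"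
  shows "balanced ends (\<lambda>e. card {i\<in>{i\<in>X. even i}. g i = e}) (\<lambda>e. card {i\<in>{i\<in>X. odd i}. g i = e})"
  unfolding balanced_def
proof
  fix z
  have "finite X"
    using assms(2) finite_subset by blast
  have "{i\<in>X. even i} \<subseteq> {..<n}" "{i\<in>X. odd i} \<subseteq> {..<n}"
    using assms(2) by auto
  note counts = this[THEN sum_incident_count[OF assms(1)]]
  have "int (\<Sum>e | z \<in> ends e. card {i\<in>{i\<in>X. even i}. g i = e}) =
      int (\<Sum>e | z \<in> ends e. card {i\<in>{i\<in>X. odd i}. g i = e})"
    unfolding counts using sum_even_odd[OF \<open>finite X\<close>, of "\<lambda>i. hits v i z"] assms(3)[of z] by simp
  then show "(\<Sum>e | z \<in> ends e. card {i\<in>{i\<in>X. even i}. g i = e}) =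
      (\<Sum>e | z \<in> ends e. card {i\<in>{i\<in>X. odd i}. g i = e})"
    by (simp only: of_nat_eq_iff)
qed

section \<open>Greedy construction of an alternating closed walk\<close>

definition bounded_trail :: "nat \<Rightarrow> (nat \<Rightarrow> 'v) \<Rightarrow> (nat \<Rightarrow> 'e) \<Rightarrow> bool" where
  "bounded_trail n v g \<longleftrightarrow> trail ends n v g \<and> (\<forall>e. card {i\<in>{i\<in>{..<n}. even i}. g i = e} \<le> a e) \<and>
     (\<forall>e. card {i\<in>{i\<in>{..<n}. odd i}. g i = e} \<le> b e)"

lemma bounded_trail_Suc:
  assumes "bounded_trail n v g" "v n \<in> ends e"
    and room: "if even n then card {i\<in>{i\<in>{..<n}. even i}. g i = e} < a e
                else card {i\<in>{i\<in>{..<n}. odd i}. g i = e} < b e"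
  shows "\<exists>v' g'. bounded_trail (Suc n) v' g'"
proof -
  obtain y where y: "ends e = {v n, y}"
    using assms(2) two_ends[of e] by (auto simp: card_2_iff doubleton_eq_iff)
  let ?v = "v(Suc n := y)" and ?g = "g(n := e)"
  have tr: "trail ends (Suc n) ?v ?g"
    using assms(1) y by (auto simp: bounded_trail_def trail_def less_Suc_eq)
  have count: "{i\<in>{i\<in>{..<Suc n}. P i}. ?g i = x} =
      (if P n \<and> x = e then insert n {i\<in>{i\<in>{..<n}. P i}. g i = x} else {i\<in>{i\<in>{..<n}. P i}. g i = x})" for P x
    by (auto simp: less_Suc_eq)
  have "card {i\<in>{i\<in>{..<Suc n}. even i}. ?g i = x} \<le> a x" for x
    unfolding count using assms(1) room by (auto simp: bounded_trail_def)
  moreover have "card {i\<in>{i\<in>{..<Suc n}. odd i}. ?g i = x} \<le> b x" for x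
    unfolding count using assms(1) room by (auto simp: bounded_trail_def)
  ultimately have "bounded_trail (Suc n) ?v ?g"
    using tr by (simp add: bounded_trail_def)
  then show ?thesis
    by blast
qed

lemma ex_room:
  assumes "(\<Sum>e | z \<in> ends e. f e) < (\<Sum>e | z \<in> ends e. h e :: nat)"
  shows "\<exists>e. z \<in> ends e \<and> f e < h e"
proof (rule ccontr)
  assume "\<not> ?thesis"
  then have "(\<Sum>e | z \<in> ends e. h e) \<le> (\<Sum>e | z \<in> ends e. f e)"
    by (intro sum_mono) (auto simp: not_less)
  with assms show False
    by simp
qed

text \<open>At the end vertex the numbers of even and odd steps used differ, by telescoping, in
  favour of the parity of the last step. Since \<open>a\<close> and \<open>b\<close> have equal
  degree there, an edge of the parity due next is left over.\<close>

lemma bounded_trail_extend: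
  assumes bt: "bounded_trail n v g" and "n > 0" and open_end: "odd n \<or> v n \<noteq> v 0"
  shows "\<exists>v' g'. bounded_trail (Suc n) v' g'"
proof -
  let ?E = "{i\<in>{..<n}. even i}" and ?O = "{i\<in>{..<n}. odd i}"
  let ?ce = "\<lambda>e. card {i\<in>?E. g i = e}" and ?co = "\<lambda>e. card {i\<in>?O. g i = e}"
  let ?z = "v n"
  have tr: "trail ends n v g" and ce: "?ce e \<le> a e" and co: "?co e \<le> b e" for e
    using bt by (auto simp: bounded_trail_def)
  have "(\<Sum>i\<in>{..<n}. (-1) ^ i * hits v i ?z) = (if v 0 = ?z then 1 else 0) - (-1) ^ n"
    using alternating_sum_hits[of 0 n v ?z] by (simp add: atLeast0LessThan)
  moreover have "(\<Sum>i\<in>{..<n}. (-1) ^ i * hits v i ?z) =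
      int (\<Sum>e | ?z \<in> ends e. ?ce e) - int (\<Sum>e | ?z \<in> ends e. ?co e)"
  proof -
    have "?E \<subseteq> {..<n}" "?O \<subseteq> {..<n}"
      by auto
    note counts = this[THEN sum_incident_count[OF tr]]
    show ?thesis
      unfolding counts by (rule sum_even_odd) simp
  qed
  ultimately have diff: "int (\<Sum>e | ?z \<in> ends e. ?ce e) - int (\<Sum>e | ?z \<in> ends e. ?co e) =
      (if v 0 = ?z then 1 else 0) - (-1) ^ n"
    by linarith
  have le_a: "(\<Sum>e | ?z \<in> ends e. ?ce e) \<le> (\<Sum>e | ?z \<in> ends e. a e)"
    and le_b: "(\<Sum>e | ?z \<in> ends e. ?co e) \<le> (\<Sum>e | ?z \<in> ends e. b e)"
    by (intro sum_mono ce co)+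
  have bal: "(\<Sum>e | ?z \<in> ends e. a e) = (\<Sum>e | ?z \<in> ends e. b e)"
    using balanced_pair by (simp add: balanced_def)
  show ?thesis
  proof (cases "even n")
    case True
    with open_end have "v 0 \<noteq> ?z"
      by auto
    then have "int (\<Sum>e | ?z \<in> ends e. ?ce e) - int (\<Sum>e | ?z \<in> ends e. ?co e) = - 1"
      unfolding diff using True by simp
    then have "(\<Sum>e | ?z \<in> ends e. ?ce e) < (\<Sum>e | ?z \<in> ends e. ?co e)"
      by linarith
    then have "(\<Sum>e | ?z \<in> ends e. ?ce e) < (\<Sum>e | ?z \<in> ends e. a e)"
      using le_b bal by linarith
    then obtain e where "?z \<in> ends e" "?ce e < a e"
      using ex_room by blast
    then show ?thesis
      using bounded_trail_Suc[OF bt] True by simp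
  next
    case False
    then have "int (\<Sum>e | ?z \<in> ends e. ?co e) < int (\<Sum>e | ?z \<in> ends e. ?ce e)"
      using diff by (simp split: if_splits del: of_nat_sum)
    then have "(\<Sum>e | ?z \<in> ends e. ?co e) < (\<Sum>e | ?z \<in> ends e. b e)"
      using le_a bal by linarith
    then obtain e where "?z \<in> ends e" "?co e < b e"
      using ex_room by blast
    then show ?thesis
      using bounded_trail_Suc[OF bt] False by simp
  qed
qed

lemma bounded_trail_length:
  assumes "bounded_trail n v g"
  shows "n \<le> (\<Sum>e\<in>UNIV. a e) + (\<Sum>e\<in>UNIV. b e)"
proof -
  have "card {i\<in>{..<n}. even i} \<le> (\<Sum>e\<in>UNIV. a e)"
    using card_over_preimage[of "{i\<in>{..<n}. even i}" g UNIV]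
      sum_mono[of UNIV "\<lambda>e. card {i\<in>{i\<in>{..<n}. even i}. g i = e}" a] assms
    by (simp add: bounded_trail_def)
  moreover have "card {i\<in>{..<n}. odd i} \<le> (\<Sum>e\<in>UNIV. b e)"
    using card_over_preimage[of "{i\<in>{..<n}. odd i}" g UNIV]
      sum_mono[of UNIV "\<lambda>e. card {i\<in>{i\<in>{..<n}. odd i}. g i = e}" b] assms
    by (simp add: bounded_trail_def)
  moreover have "n = card {i\<in>{..<n}. even i} + card {i\<in>{..<n}. odd i}"
  proof -
    have "card ({i\<in>{..<n}. even i} \<union> {i\<in>{..<n}. odd i}) = card {i\<in>{..<n}. even i} + card {i\<in>{..<n}. odd i}"
      by (rule card_Un_disjoint) auto
    moreover have "{i\<in>{..<n}. even i} \<union> {i\<in>{..<n}. odd i} = {..<n}"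
      by auto
    ultimately show ?thesis
      by simp
  qed
  ultimately show ?thesis
    by linarith
qed

lemma ex_closed_bounded_trail:
  "\<exists>n v g. bounded_trail n v g \<and> n > 0 \<and> even n \<and> v n = v 0"
proof (rule ccontr)
  assume none: "\<not> ?thesis"
  obtain e0 where e0: "a e0 \<noteq> 0"
    using nonzero by blast
  obtain x0 where x0: "x0 \<in> ends e0"
    using two_ends[of e0] by fastforce
  have base: "bounded_trail 0 (\<lambda>_. x0) (\<lambda>_. e0)"
    by (simp add: bounded_trail_def trail_def)
  have "\<exists>v g. bounded_trail n v g" for n
  proof (induction n)
    case 0
    show ?case
      using base by blast
  next
    case (Suc n)
    then obtain v g where vg: "bounded_trail n v g"
      by blast
    show ?case
    proof (cases "n = 0")
      case True
      then show ?thesis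
        using bounded_trail_Suc[OF base, of e0] x0 e0 by simp
    next
      case False
      then have "odd n \<or> v n \<noteq> v 0"
        using none vg by blast
      then show ?thesis
        using bounded_trail_extend[OF vg] False by blast
    qed
  qed
  then obtain v g where "bounded_trail (Suc ((\<Sum>e\<in>UNIV. a e) + (\<Sum>e\<in>UNIV. b e))) v g"
    by blast
  from bounded_trail_length[OF this] show False
    by simp
qed

text \<open>The steps of a closed bounded trail form a non-zero balanced pair below
  \<open>(a, b)\<close>; primitivity leaves only the whole pair.\<close>

lemma ex_alternating_walk: "\<exists>n v g. alternating_walk ends a b n v g"
proof -
  obtain n v g where bt: "bounded_trail n v g" and n: "n > 0" "even n" "v n = v 0"
    using ex_closed_bounded_trail by blast
  have tr: "trail ends n v g"
    using bt by (simp add: bounded_trail_def)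
  let ?a = "\<lambda>e. card {i\<in>{i\<in>{..<n}. even i}. g i = e}" and ?b = "\<lambda>e. card {i\<in>{i\<in>{..<n}. odd i}. g i = e}"
  have le: "?a e \<le> a e" "?b e \<le> b e" for e
    using bt by (auto simp: bounded_trail_def)
  have "(\<Sum>i\<in>{..<n}. (-1) ^ i * hits v i z) = 0" for z
    using alternating_sum_hits[of 0 n v z] n by (simp add: atLeast0LessThan)
  from balanced_counts[OF tr _ this] have bal: "balanced ends ?a ?b"
    by simp
  have "(\<Sum>e\<in>UNIV. ?a e) = card {i\<in>{..<n}. even i}"
    using card_over_preimage[of "{i\<in>{..<n}. even i}" g UNIV] by simp
  moreover have "0 \<in> {i\<in>{..<n}. even i}"
    using n by simp
  ultimately have "(\<Sum>e\<in>UNIV. ?a e) \<noteq> 0"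
    by (metis (no_types, lifting) card_eq_0_iff empty_iff finite_lessThan finite_subset mem_Collect_eq subsetI)
  with primitive[OF le bal] have sa: "(\<Sum>e\<in>UNIV. ?a e) = (\<Sum>e\<in>UNIV. a e)"
    by blast
  then have sb: "(\<Sum>e\<in>UNIV. ?b e) = (\<Sum>e\<in>UNIV. b e)"
    using balanced_total[OF bal] balanced_total[OF balanced_pair] by simp
  have eq: "f e = h e" if "\<And>e. f e \<le> h e" "(\<Sum>e\<in>UNIV. f e) = (\<Sum>e\<in>UNIV. h e)" for f h :: "'e \<Rightarrow> nat" and e
  proof (rule ccontr)
    assume "f e \<noteq> h e"
    then have "f e < h e"
      using that(1)[of e] by simp
    then have "(\<Sum>e\<in>UNIV. f e) < (\<Sum>e\<in>UNIV. h e)"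
      using that(1) by (intro sum_strict_mono_ex1) auto
    with that(2) show False
      by simp
  qed
  have "alternating_walk ends a b n v g"
    unfolding alternating_walk_def using tr n eq[OF le(1) sa] eq[OF le(2) sb] by simp
  then show ?thesis
    by blast
qed

lemma swap: "primitive_pair ends b a"
proof
  show "card (ends e) = 2" "b e = 0 \<or> a e = 0" for e
    using two_ends disjoint[of e] by auto
  show "inj ends"
    by (rule inj_ends)
  show "balanced ends b a"
    using balanced_pair by (simp add: balanced_def)
  obtain e where "a e \<noteq> 0"
    using nonzero by blast
  show "\<exists>e. b e \<noteq> 0"
  proof (rule ccontr)
    assume "\<not> ?thesis"
    then have "(\<Sum>e\<in>UNIV. a e) = 0"
      using balanced_total[OF balanced_pair] by simp
    with \<open>a e \<noteq> 0\<close> show False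
      by simp
  qed
  show "(\<Sum>e\<in>UNIV. b' e) = 0 \<or> (\<Sum>e\<in>UNIV. b' e) = (\<Sum>e\<in>UNIV. b e)"
    if le: "\<And>e. b' e \<le> b e" "\<And>e. a' e \<le> a e" and bal: "balanced ends b' a'" for a' b'
  proof -
    have "balanced ends a' b'"
      using bal by (simp add: balanced_def)
    from primitive[OF le(2,1) this] show ?thesis
      using balanced_total[OF bal] balanced_total[OF balanced_pair] by simp
  qed
  show "\<exists>x::rat. \<forall>z. (\<Sum>e | z \<in> ends e. if b e \<noteq> 0 then of_int (l e) else 0) = x * (\<Sum>e | z \<in> ends e. of_nat (b e))"
    if ker: "incidence_kernel ends l" and supp: "\<And>e. b e = 0 \<Longrightarrow> a e = 0 \<Longrightarrow> l e = 0" for l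
  proof -
    obtain x :: rat where x: "\<forall>z. (\<Sum>e | z \<in> ends e. if a e \<noteq> 0 then of_int (l e) else 0) = x * (\<Sum>e | z \<in> ends e. of_nat (a e))"
      using restriction[OF ker] supp by blast
    \<comment> \<open>The two restrictions of a kernel vector have opposite degrees at each vertex,
      while \<open>a\<close> and \<open>b\<close> have the same degree; hence the factor changes
      sign.\<close>
    have "(\<Sum>e | z \<in> ends e. if b e \<noteq> 0 then of_int (l e) else 0) = - x * (\<Sum>e | z \<in> ends e. of_nat (b e))" for z
    proof -
      have "(\<Sum>e | z \<in> ends e. if a e \<noteq> 0 then of_int (l e) else 0) + (\<Sum>e | z \<in> ends e. if b e \<noteq> 0 then of_int (l e) else 0) =
          (\<Sum>e | z \<in> ends e. of_int (l e) :: rat)"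
        unfolding sum.distrib[symmetric]
      proof (intro sum.cong refl)
        fix e
        show "(if a e \<noteq> 0 then of_int (l e) else 0) + (if b e \<noteq> 0 then of_int (l e) else 0) = (of_int (l e) :: rat)"
          using disjoint[of e] supp[of e] by auto
      qed
      also have "\<dots> = of_int (\<Sum>e | z \<in> ends e. l e)"
        by simp
      also have "\<dots> = 0"
        using ker unfolding incidence_kernel_def by (simp del: of_int_sum)
      finally have "(\<Sum>e | z \<in> ends e. if b e \<noteq> 0 then of_int (l e) else 0) =
          - x * (\<Sum>e | z \<in> ends e. of_nat (a e))"
        using spec[OF x, of z] by linarith
      also have "(\<Sum>e | z \<in> ends e. of_nat (a e)) = (of_nat (\<Sum>e | z \<in> ends e. a e) :: rat)"
        by simp
      also have "\<dots> = of_nat (\<Sum>e | z \<in> ends e. b e)"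
        using balanced_pair unfolding balanced_def by (simp del: of_nat_sum)
      finally show ?thesis
        by simp
    qed
    then show ?thesis
      by (intro exI[of _ "- x"]) simp
  qed
qed

end

section \<open>Repeated visits of a primitive walk\<close>

locale primitive_walk = primitive_pair ends a b
  for ends :: "'e::finite \<Rightarrow> 'v::finite set" and a b :: "'e \<Rightarrow> nat" +
  fixes n :: nat and v :: "nat \<Rightarrow> 'v" and g :: "nat \<Rightarrow> 'e"
  assumes alternating: "alternating_walk ends a b n v g"
begin

lemma trail: "trail ends n v g" and n_pos: "n > 0" and n_even: "even n" and closed: "v n = v 0"
  and count_a: "a e = card {i\<in>{i\<in>{..<n}. even i}. g i = e}"
  and count_b: "b e = card {i\<in>{i\<in>{..<n}. odd i}. g i = e}"
  using alternating by (auto simp: alternating_walk_def)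

lemma step_neq: "i < n \<Longrightarrow> v i \<noteq> v (Suc i)"
  by (rule trail_step_neq[OF trail])

lemma even_edge: "i < n \<Longrightarrow> even i \<Longrightarrow> a (g i) \<noteq> 0"
  unfolding count_a by (auto simp: card_eq_0_iff)

lemma odd_edge: "i < n \<Longrightarrow> odd i \<Longrightarrow> b (g i) \<noteq> 0"
  unfolding count_b by (auto simp: card_eq_0_iff)

text \<open>Primitivity in terms of positions: a set of steps with alternating degree 0 at every
  vertex is a balanced pair below \<open>(a, b)\<close>.\<close>

lemma no_balanced_part:
  assumes X: "X \<subseteq> {..<n}" and sum0: "\<And>z. (\<Sum>i\<in>X. (-1) ^ i * hits v i z) = 0"
  shows "X = {} \<or> X = {..<n}"
proof -
  have fin: "finite X"
    using X finite_subset by blast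
  let ?XE = "{i\<in>X. even i}" and ?XO = "{i\<in>X. odd i}"
  let ?E = "{i\<in>{..<n}. even i}" and ?O = "{i\<in>{..<n}. odd i}"
  let ?a = "\<lambda>e. card {i\<in>?XE. g i = e}" and ?b = "\<lambda>e. card {i\<in>?XO. g i = e}"
  have bal: "balanced ends ?a ?b"
    by (rule balanced_counts[OF trail X sum0])
  have "?a e \<le> a e" "?b e \<le> b e" for e
    unfolding count_a count_b using X by (intro card_mono; force)+
  note prim = primitive[OF this bal]
  have tot: "(\<Sum>e\<in>UNIV. ?a e) = card ?XE" "(\<Sum>e\<in>UNIV. ?b e) = card ?XO"
    "(\<Sum>e\<in>UNIV. a e) = card ?E" "(\<Sum>e\<in>UNIV. b e) = card ?O"
    unfolding count_a count_b using card_over_preimage[of ?XE g UNIV] card_over_preimage[of ?XO g UNIV]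
      card_over_preimage[of ?E g UNIV] card_over_preimage[of ?O g UNIV] fin by simp_all
  have eo: "card ?XE = card ?XO" "card ?E = card ?O"
    using balanced_total[OF bal] balanced_total[OF balanced_pair] unfolding tot by auto
  from prim consider "card ?XE = 0" | "card ?XE = card ?E"
    unfolding tot by (rule disjE)
  then show ?thesis
  proof cases
    case 1
    then have "card ?XO = 0"
      using eo(1) by (simp only:)
    with 1 have "?XE = {}" "?XO = {}"
      using fin by (subst (asm) (1 2) card_0_eq; auto)+
    then show ?thesis
      by blast
  next
    case 2
    have "?XE = ?E"
      by (rule card_subset_eq) (use X 2 in auto)
    moreover have "?XO = ?O"
      by (rule card_subset_eq) (use X 2 eo in auto)
    ultimately have "X = {..<n}"
      by blast
    then show ?thesis ..
  qed
qed

text \<open>The steps between two visits of equal parity form an even closed walk, hence the whole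
  walk.\<close>

lemma same_parity:
  assumes "i < j" "j \<le> n" "v i = v j" "even (j - i)"
  shows "i = 0 \<and> j = n"
proof -
  have ev: "even i \<longleftrightarrow> even j"
    using assms by simp
  have "(\<Sum>k=i..<j. (-1) ^ k * hits v k z) = 0" for z
    using alternating_sum_hits[of i j v z] assms ev by (cases "even i") auto
  then have "{i..<j} = {} \<or> {i..<j} = {..<n}"
    using assms by (intro no_balanced_part) auto
  then have "{i..<j} = {..<n}"
    using assms by auto
  then have "0 \<in> {i..<j}" "n - 1 \<in> {i..<j}"
    using n_pos by auto
  then show ?thesis
    using assms by auto
qed

text \<open>Two of three visits have equal parity. The exception is the closing vertex, where
  positions 0 and \<open>n\<close> are the same visit.\<close>

lemma three_visits:
  assumes "i < j" "j < k" "k \<le> n" "v i = v j" "v j = v k"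
  shows "i = 0 \<and> k = n"
proof -
  have "odd (j - i)"
    using same_parity[of i j] assms by auto
  moreover have "odd (k - j)"
    using same_parity[of j k] assms by auto
  ultimately have "even (k - i)"
    using assms by auto
  then show ?thesis
    using same_parity[of i k] assms by auto
qed

lemma third_visit:
  assumes "i < j" "j < k" "k \<le> n" "0 < i \<or> k < n" "v i = v j" "v j = v k"
  shows False
  using three_visits[OF assms(1-3,5,6)] assms(4) by simp

text \<open>For crossing pairs the steps from \<open>i\<close> to \<open>k\<close> and from
  \<open>j\<close> to \<open>l\<close> together are balanced: paired visits have opposite parities,
  so the four boundary terms cancel. They omit step \<open>k\<close>.\<close>

lemma noncrossing:
  assumes "i < k" "k < j" "j < l" "l \<le> n" "v i = v j" "v k = v l"
  shows False
proof -
  have "odd (j - i)" "odd (l - k)"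
    using same_parity[of i j] same_parity[of k l] assms by auto
  then have par: "even j \<longleftrightarrow> odd i" "even l \<longleftrightarrow> odd k"
    using assms by auto
  have "(\<Sum>t\<in>{i..<k} \<union> {j..<l}. (-1) ^ t * hits v t z) = 0" for z
  proof -
    have "(\<Sum>t\<in>{i..<k} \<union> {j..<l}. (-1) ^ t * hits v t z) =
        (\<Sum>t=i..<k. (-1) ^ t * hits v t z) + (\<Sum>t=j..<l. (-1) ^ t * hits v t z)"
      using assms by (intro sum.union_disjoint) auto
    also have "\<dots> = 0"
      using alternating_sum_hits[of i k v z] alternating_sum_hits[of j l v z] assms par
      by (cases "even i"; cases "even k") auto
    finally show ?thesis .
  qed
  then have "{i..<k} \<union> {j..<l} = {} \<or> {i..<k} \<union> {j..<l} = {..<n}"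
    using assms by (intro no_balanced_part) auto
  moreover have "i \<in> {i..<k} \<union> {j..<l}" "k \<notin> {i..<k} \<union> {j..<l}" "k \<in> {..<n}"
    using assms by auto
  ultimately show False
    by blast
qed

text \<open>Restricted to the even steps, the weighted walk is \<open>x\<close> times the walk
  itself in degree at each vertex. Positivity at \<open>v 0\<close> gives that \<open>x\<close> is
  non-zero; as every vertex lies on an even step, the weighted degree is non-zero at every
  vertex.\<close>

lemma weighted_cover:
  fixes c :: "nat \<Rightarrow> int"
  assumes c_nonneg: "\<And>i. i < n \<Longrightarrow> c i \<ge> 0" and c0: "c 0 > 0"
    and sum0: "\<And>z. (\<Sum>i<n. c i * ((-1) ^ i * hits v i z)) = 0"
    and "t \<le> n"
  shows "\<exists>i<n. c i \<noteq> 0 \<and> (v t = v i \<or> v t = v (Suc i))"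
proof -
  define l where "l e = (\<Sum>i | i \<in> {..<n} \<and> g i = e. c i * (-1) ^ i)" for e
  have hits_sum: "(\<Sum>e | z \<in> ends e. \<Sum>i | i \<in> X \<and> g i = e. f i) = (\<Sum>i\<in>X. f i * hits v i z)"
    if "X \<subseteq> {..<n}" for X z and f :: "nat \<Rightarrow> int"
  proof -
    have fin: "finite X"
      using that finite_subset by blast
    have "(\<Sum>e | z \<in> ends e. \<Sum>i | i \<in> X \<and> g i = e. f i) = (\<Sum>i | i \<in> X \<and> g i \<in> {e. z \<in> ends e}. f i)"
      by (rule sum_over_preimage[OF fin])
    also have "\<dots> = (\<Sum>i\<in>X. if z \<in> ends (g i) then f i else 0)"
      using fin by (simp add: sum.inter_filter)
    also have "\<dots> = (\<Sum>i\<in>X. f i * hits v i z)"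
      using that by (intro sum.cong refl) (auto simp: hits_trail[OF trail])
    finally show ?thesis .
  qed
  let ?E = "{i\<in>{..<n}. even i}"
  have E: "?E \<subseteq> {..<n}"
    by auto
  have "incidence_kernel ends l"
    unfolding incidence_kernel_def l_def hits_sum[OF subset_refl] using sum0 by (simp add: mult.assoc)
  moreover have "l e = 0" if ab: "a e = 0" "b e = 0" for e
  proof -
    have False if "i < n" "g i = e" for i
      using even_edge[OF that(1)] odd_edge[OF that(1)] that(2) ab by (cases "even i") auto
    then have "{i. i \<in> {..<n} \<and> g i = e} = {}"
      by auto
    then show ?thesis
      unfolding l_def by (simp only: sum.empty)
  qed
  ultimately obtain x :: rat where x: "\<forall>z. (\<Sum>e | z \<in> ends e. if a e \<noteq> 0 then of_int (l e) else 0) =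
      x * (\<Sum>e | z \<in> ends e. of_nat (a e))"
    using restriction by blast
  have l_even: "(if a e \<noteq> 0 then l e else 0) = (\<Sum>i | i \<in> ?E \<and> g i = e. c i)" for e
  proof (cases "a e = 0")
    case True
    then have False if "i < n" "even i" "g i = e" for i
      using even_edge[OF that(1,2)] that(3) by simp
    then have "{i. i \<in> ?E \<and> g i = e} = {}"
      by auto
    with True show ?thesis
      by (simp only: sum.empty) simp
  next
    case False
    then have "b e = 0"
      using disjoint[of e] by simp
    then have ev: "even i" if "i < n" "g i = e" for i
      using odd_edge[OF that(1)] that(2) by (cases "even i") auto
    have "l e = (\<Sum>i | i \<in> ?E \<and> g i = e. c i)"
      unfolding l_def by (intro sum.cong) (use ev in auto)
    with False show ?thesis
      by simp
  qed
  have a_even: "int (a e) = (\<Sum>i | i \<in> ?E \<and> g i = e. 1)" for e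
    by (simp add: count_a)
  have rel: "of_int (\<Sum>i\<in>?E. c i * hits v i z) = x * of_int (\<Sum>i\<in>?E. hits v i z)" for z
  proof -
    have "of_int (\<Sum>i\<in>?E. c i * hits v i z) = (of_int (\<Sum>e | z \<in> ends e. if a e \<noteq> 0 then l e else 0) :: rat)"
      unfolding l_even hits_sum[OF E] ..
    also have "\<dots> = (\<Sum>e | z \<in> ends e. if a e \<noteq> 0 then of_int (l e) else 0)"
      unfolding of_int_sum by (intro sum.cong) auto
    also have "\<dots> = x * (\<Sum>e | z \<in> ends e. of_nat (a e))"
      using x by blast
    also have "(\<Sum>e | z \<in> ends e. of_nat (a e)) = (of_int (\<Sum>e | z \<in> ends e. int (a e)) :: rat)"
      by simp
    also have "(\<Sum>e | z \<in> ends e. int (a e)) = (\<Sum>i\<in>?E. hits v i z)"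
      unfolding a_even hits_sum[OF E] by simp
    finally show ?thesis .
  qed
  have hits_nonneg: "hits v i z \<ge> 0" for i z
    by (simp add: hits_def)
  have "c 0 * hits v 0 (v 0) \<le> (\<Sum>i\<in>?E. c i * hits v i (v 0))"
    using n_pos c_nonneg hits_nonneg by (intro member_le_sum) auto
  moreover have "c 0 * hits v 0 (v 0) > 0"
    using c0 by (simp add: hits_def)
  ultimately have "(\<Sum>i\<in>?E. c i * hits v i (v 0)) \<noteq> 0"
    by linarith
  then have "x \<noteq> 0"
    using rel[of "v 0"] by (auto simp del: of_int_sum)
  \<comment> \<open>An even step at position \<open>t\<close>: the one leaving it for even
    \<open>t\<close> (step 0 if \<open>t = n\<close>), the one arriving for odd
    \<open>t\<close>.\<close>
  obtain s where s: "s \<in> ?E" "hits v s (v t) > 0"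
  proof (cases "even t")
    case True
    show thesis
    proof (cases "t = n")
      case True
      then show thesis
        using n_pos closed by (intro that[of 0]) (auto simp: hits_def)
    next
      case False
      then show thesis
        using \<open>even t\<close> \<open>t \<le> n\<close> by (intro that[of t]) (auto simp: hits_def)
    qed
  next
    case False
    then show thesis
      using \<open>t \<le> n\<close> n_pos by (intro that[of "t - 1"]) (auto simp: hits_def)
  qed
  have "hits v s (v t) \<le> (\<Sum>i\<in>?E. hits v i (v t))"
    using s hits_nonneg by (intro member_le_sum) auto
  then have "(\<Sum>i\<in>?E. hits v i (v t)) \<noteq> 0"
    using s(2) by linarith
  then have "(\<Sum>i\<in>?E. c i * hits v i (v t)) \<noteq> 0"
    using rel[of "v t"] \<open>x \<noteq> 0\<close> by (auto simp del: of_int_sum)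
  then obtain i where "i \<in> ?E" "c i * hits v i (v t) \<noteq> 0"
    by (rule sum.not_neutral_contains_not_neutral)
  then show ?thesis
    by (intro exI[of _ i]) (auto simp: hits_def split: if_splits)
qed

end

subsection \<open>Classification of primitive walks\<close>

context primitive_walk
begin

definition segment :: "nat \<Rightarrow> nat \<Rightarrow> 'v list" where
  "segment i j = map v [i..<Suc j]"

lemma length_segment: "length (segment i j) = Suc j - i"
  by (simp add: segment_def del: upt_Suc)

lemma segment_nth: "t \<le> j - i \<Longrightarrow> i \<le> j \<Longrightarrow> segment i j ! t = v (i + t)"
  by (simp add: segment_def del: upt_Suc)

lemma tl_segment: "tl (segment i j) = map v [Suc i..<Suc j]"
  by (simp add: segment_def tl_upt flip: map_tl del: upt_Suc)

lemma hd_segment: "i \<le> j \<Longrightarrow> hd (segment i j) = v i"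
  by (simp add: segment_def hd_map del: upt_Suc)

lemma last_segment: "i \<le> j \<Longrightarrow> last (segment i j) = v j"
  by (simp add: segment_def last_map)

lemma set_segment: "set (segment i j) = v ` {i..j}"
  by (auto simp: segment_def simp del: upt_Suc)

lemma segment_append:
  assumes "i \<le> j" "j \<le> k"
  shows "segment i j @ tl (segment j k) = segment i k"
proof -
  have "[i..<Suc k] = [i..<Suc j] @ [Suc j..<Suc k]"
    using assms upt_add_eq_append[of i "Suc j" "k - j"] by (simp del: upt_Suc)
  then show ?thesis
    unfolding tl_segment by (simp add: segment_def del: upt_Suc)
qed

lemma odd_cycle_segment:
  assumes "i < j" "j \<le> n" "v i = v j" "odd (j - i)"
    and simple: "\<And>s t. i \<le> s \<Longrightarrow> s < t \<Longrightarrow> t \<le> j \<Longrightarrow> v s = v t \<Longrightarrow> s = i \<and> t = j"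
  shows "cycle_vs (segment i j)" "odd (cycle_len (segment i j))"
proof -
  have "j - i \<noteq> 1"
    using step_neq[of i] assms by (metis Suc_eq_plus1 add.commute le_add_diff_inverse less_imp_le_nat order_less_le_trans)
  with assms have "j - i \<ge> 3"
    by presburger
  moreover have "inj_on v {Suc i..j}"
  proof (rule linorder_inj_onI')
    fix s t
    assume "s \<in> {Suc i..j}" "t \<in> {Suc i..j}" "s < t"
    then show "v s \<noteq> v t"
      using simple[of s t] by auto
  qed
  then have "inj_on v (set [Suc i..<Suc j])"
    by (simp add: atLeastLessThanSuc_atLeastAtMost del: upt_Suc)
  then have "distinct (tl (segment i j))"
    unfolding tl_segment by (simp add: distinct_map del: upt_Suc)
  ultimately show "cycle_vs (segment i j)"
    using assms by (simp add: cycle_vs_def length_segment hd_segment last_segment)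
  show "odd (cycle_len (segment i j))"
    using assms by (simp add: cycle_len_def length_segment)
qed

lemma weighted_sum_split:
  assumes "j \<le> k" "k \<le> l" "l \<le> n"
  shows "(\<Sum>i<n. (if i < j then c1 else if i < k then c2 else if i < l then c3 else c4) * f i) =
    c1 * (\<Sum>i=0..<j. f i) + c2 * (\<Sum>i=j..<k. f i) + c3 * (\<Sum>i=k..<l. f i) + c4 * (\<Sum>i=l..<n. f i :: int)"
proof -
  let ?c = "\<lambda>i. if i < j then c1 else if i < k then c2 else if i < l then c3 else c4"
  have "(\<Sum>i<n. ?c i * f i) = (\<Sum>i=0..<n. ?c i * f i)"
    by (simp add: atLeast0LessThan)
  also have "\<dots> = (\<Sum>i=0..<j. ?c i * f i) + (\<Sum>i=j..<n. ?c i * f i)"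
    using assms by (intro sum.atLeastLessThan_concat[symmetric]) auto
  also have "(\<Sum>i=j..<n. ?c i * f i) = (\<Sum>i=j..<k. ?c i * f i) + (\<Sum>i=k..<n. ?c i * f i)"
    using assms by (intro sum.atLeastLessThan_concat[symmetric]) auto
  also have "(\<Sum>i=k..<n. ?c i * f i) = (\<Sum>i=k..<l. ?c i * f i) + (\<Sum>i=l..<n. ?c i * f i)"
    using assms by (intro sum.atLeastLessThan_concat[symmetric]) auto
  also have "(\<Sum>i=0..<j. ?c i * f i) = c1 * (\<Sum>i=0..<j. f i)"
    unfolding sum_distrib_left by (intro sum.cong) auto
  also have "(\<Sum>i=j..<k. ?c i * f i) = c2 * (\<Sum>i=j..<k. f i)"
    unfolding sum_distrib_left by (intro sum.cong) auto
  also have "(\<Sum>i=k..<l. ?c i * f i) = c3 * (\<Sum>i=k..<l. f i)"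
    unfolding sum_distrib_left using assms by (intro sum.cong) auto
  also have "(\<Sum>i=l..<n. ?c i * f i) = c4 * (\<Sum>i=l..<n. f i)"
    unfolding sum_distrib_left using assms by (intro sum.cong) auto
  finally show ?thesis
    by simp
qed

text \<open>Here the walk is \<open>O\<^sub>1 P O\<^sub>2 P'\<close> with odd cycles \<open>O\<^sub>1 = [0, j]\<close> and \<open>O\<^sub>2 = [k, l]\<close>. Both
  \<open>O\<^sub>1 + 2 P + O\<^sub>2\<close> and \<open>O\<^sub>1 + 2 P' + O\<^sub>2\<close> lie in the kernel, so by the restriction property each of
  them covers all vertices; as visits do not cross, \<open>P'\<close> is the reverse of \<open>P\<close>.\<close>

lemma two_cycles_with_path:
  assumes jk: "0 < j" "j < k" "k < l" "l < n" and vj: "v 0 = v j" and vk: "v k = v l"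
    and oddj: "odd j" and oddl: "odd (l - k)"
  shows "n - l = k - j" "\<And>i. i \<le> k - j \<Longrightarrow> v (j + i) = v (n - i)"
proof -
  have par: "even l \<longleftrightarrow> odd k"
    using oddl jk by auto
  have visits_0: False if "j < t" "t < n" "v t = v 0" for t
    using that jk vj by - (rule third_visit[of 0 j t], auto)
  have tel: "(\<Sum>i=0..<j. (-1) ^ i * hits v i z) = 2 * (if v 0 = z then 1 else 0)"
    "(\<Sum>i=j..<k. (-1) ^ i * hits v i z) = - (if v 0 = z then 1 else 0) - (-1) ^ k * (if v k = z then 1 else 0)"
    "(\<Sum>i=k..<l. (-1) ^ i * hits v i z) = 2 * ((-1) ^ k * (if v k = z then 1 else 0))"
    "(\<Sum>i=l..<n. (-1) ^ i * hits v i z) = - ((-1) ^ k * (if v k = z then 1 else 0)) - (if v 0 = z then 1 else 0)" for z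
    using alternating_sum_hits[of 0 j v z] alternating_sum_hits[of j k v z] alternating_sum_hits[of k l v z]
      alternating_sum_hits[of l n v z] jk vj vk oddj par n_even closed
    by (cases "even k"; simp)+
  have match1: "\<exists>s. j < s \<and> s < k \<and> v s = v t" if t: "l < t" "t < n" for t
  proof -
    \<comment> \<open>The kernel vector that doubles the first path and drops the second: by
      \<open>tel\<close>, a cycle contributes 2 at its base vertex and each path -1 at both of its
      ends, up to the sign of the visit. So a vertex of the second path must reappear elsewhere, and
      the first path is the only place left.\<close>
    let ?c = "\<lambda>i. if i < j then 1 else if i < k then 2 else if i < l then 1 else (0::int)"
    have "(\<Sum>i<n. ?c i * ((-1) ^ i * hits v i z)) = 0" for z
      unfolding weighted_sum_split[OF less_imp_le[OF jk(2)] less_imp_le[OF jk(3)] less_imp_le[OF jk(4)]] tel by simp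
    then have "\<exists>i<n. ?c i \<noteq> 0 \<and> (v t = v i \<or> v t = v (Suc i))"
      using t jk by (intro weighted_cover[of ?c t]) auto
    then obtain i where i: "i < n" "?c i \<noteq> 0" "v t = v i \<or> v t = v (Suc i)"
      by blast
    then have "i < l"
      using jk by (auto split: if_splits)
    then obtain s where s: "s \<le> l" "v t = v s"
      using i(3) by (metis Suc_leI less_imp_le_nat)
    have ne: "v s \<noteq> v 0"
      using s t jk by - (rule notI, rule visits_0[of t], auto)
    have "s \<noteq> 0"
      using ne by (rule contrapos_nn) simp
    moreover have "s \<noteq> j"
      using ne by (rule contrapos_nn) (simp add: vj)
    moreover have "\<not> (0 < s \<and> s < j)"
      using s t jk vj by - (rule notI, rule noncrossing[of 0 s j t], auto)
    moreover have "s \<noteq> k"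
      using s t jk vk by - (rule notI, rule third_visit[of k l t], auto)
    moreover have "s \<noteq> l"
      using s t jk vk by - (rule notI, rule third_visit[of k l t], auto)
    moreover have "\<not> (k < s \<and> s < l)"
      using s t jk vk by - (rule notI, rule noncrossing[of k s l t], auto)
    ultimately have "j < s" "s < k"
      using s(1) by auto
    with s show ?thesis
      by auto
  qed
  have match2: "\<exists>s. l < s \<and> s < n \<and> v s = v t" if t: "j < t" "t < k" for t
  proof -
    let ?c = "\<lambda>i. if i < j then 1 else if i < k then 0 else if i < l then 1 else (2::int)"
    have "(\<Sum>i<n. ?c i * ((-1) ^ i * hits v i z)) = 0" for z
      unfolding weighted_sum_split[OF less_imp_le[OF jk(2)] less_imp_le[OF jk(3)] less_imp_le[OF jk(4)]] tel by simp
    then have "\<exists>i<n. ?c i \<noteq> 0 \<and> (v t = v i \<or> v t = v (Suc i))"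
      using t jk by (intro weighted_cover[of ?c t]) auto
    then obtain i where i: "i < n" "?c i \<noteq> 0" "v t = v i \<or> v t = v (Suc i)"
      by blast
    then have "i < j \<or> k \<le> i"
      by (auto split: if_splits)
    then obtain s where s: "s \<le> j \<or> k \<le> s" "s \<le> n" "v t = v s"
      using i(1,3) by (metis Suc_leI le_Suc_eq less_imp_le_nat)
    have ne: "v s \<noteq> v 0"
      using s t jk by - (rule notI, rule visits_0[of t], auto)
    have "s \<noteq> 0"
      using ne by (rule contrapos_nn) simp
    moreover have "s \<noteq> j"
      using ne by (rule contrapos_nn) (simp add: vj)
    moreover have "s \<noteq> n"
      using ne by (rule contrapos_nn) (simp add: closed)
    moreover have "\<not> (0 < s \<and> s < j)"
      using s t jk vj by - (rule notI, rule noncrossing[of 0 s j t], auto)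
    moreover have "s \<noteq> k"
      using s t jk vk by - (rule notI, rule third_visit[of t k l], auto)
    moreover have "s \<noteq> l"
      using s t jk vk by - (rule notI, rule third_visit[of t k l], auto)
    moreover have "\<not> (k < s \<and> s < l)"
      using s t jk vk by - (rule notI, rule noncrossing[of t k s l], auto)
    ultimately have "l < s" "s < n"
      using s(1,2) by auto
    with s show ?thesis
      by auto
  qed
  \<comment> \<open>The paths are followed simultaneously from their common end. The partner of
    \<open>j + Suc i\<close> lies before \<open>n - i\<close> by non-crossing; if it skipped
    position \<open>n - Suc i\<close>, the partner of that position would have to lie strictly
    between \<open>j + i\<close> and \<open>j + Suc i\<close>.\<close>
  have rev: "l < n - i \<and> v (j + i) = v (n - i)" if "j + i < k" for i
    using that
  proof (induction i)
    case 0
    then show ?case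
      using jk vj closed by simp
  next
    case (Suc i)
    then have IH: "l < n - i" "v (j + i) = v (n - i)"
      by auto
    obtain s where s: "l < s" "s < n" "v s = v (j + Suc i)"
      using match2[of "j + Suc i"] Suc.prems by auto
    have "s \<noteq> n - i"
      using s IH Suc.prems jk by - (rule notI, rule third_visit[of "j + i" "j + Suc i" "n - i"], auto)
    moreover have "\<not> n - i < s"
      using s IH Suc.prems jk by - (rule notI, rule noncrossing[of "j + i" "j + Suc i" "n - i" s], auto)
    ultimately have "s < n - i"
      by simp
    have "s = n - Suc i"
    proof (rule ccontr)
      assume "s \<noteq> n - Suc i"
      define t where "t = n - Suc i"
      have t: "s < t" "t < n" "l < t" "t < n - i"
        using \<open>s < n - i\<close> \<open>s \<noteq> n - Suc i\<close> s by (auto simp: t_def)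
      obtain r where r: "j < r" "r < k" "v r = v t"
        using match1[OF t(3,2)] by blast
      have "r \<noteq> j + Suc i"
        using s r t Suc.prems jk by - (rule notI, rule third_visit[of "j + Suc i" s t], auto)
      moreover have "\<not> j + Suc i < r"
        using s r t Suc.prems jk by - (rule notI, rule noncrossing[of "j + Suc i" r s t], auto)
      moreover have "r \<noteq> j + i"
        using s r t IH Suc.prems jk by - (rule notI, rule third_visit[of "j + i" t "n - i"], auto)
      moreover have "\<not> r < j + i"
        using s r t IH Suc.prems jk by - (rule notI, rule noncrossing[of r "j + i" t "n - i"], auto)
      ultimately show False
        by simp
    qed
    then show ?case
      using s by simp
  qed
  have "l < n - (k - j - 1)"
    using rev[of "k - j - 1"] jk by auto
  then have le: "l \<le> n - (k - j)"
    by linarith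
  show eq: "n - l = k - j"
  proof (rule ccontr)
    assume "n - l \<noteq> k - j"
    \<comment> \<open>If the second path were longer, its vertex here would be matched with a vertex
      of the first path that already has a partner.\<close>
    define t where "t = n - (k - j)"
    have t: "l < t" "t < n"
      using le \<open>n - l \<noteq> k - j\<close> jk by (auto simp: t_def)
    obtain r where r: "j < r" "r < k" "v r = v t"
      using match1[OF t] by blast
    have "v r = v (n - (r - j))" "t < n - (r - j)"
      using rev[of "r - j"] r jk t by (auto simp: t_def)
    then show False
      using r t jk by - (rule third_visit[of r t "n - (r - j)"], auto)
  qed
  show "v (j + i) = v (n - i)" if "i \<le> k - j" for i
  proof (cases "j + i < k")
    case False
    then have "j + i = k" "n - i = l"
      using that eq jk by auto
    with vk show ?thesis
      by simp
  next
    case True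
    then show ?thesis
      using rev[of i] by simp
  qed
qed

text \<open>The start is chosen so that the first return closes a simple cycle
  \<open>[0, j]\<close>. A shortest return inside \<open>[j, n]\<close> gives the second cycle, and
  the case depends on whether it begins at \<open>j\<close>.\<close>

lemma classification:
  assumes j: "0 < j" "j \<le> n" "v 0 = v j"
    and simple: "\<And>s t. s < t \<Longrightarrow> t \<le> j \<Longrightarrow> v s = v t \<Longrightarrow> s = 0 \<and> t = j"
  shows "even_cycle_walk (segment 0 n) \<or> two_odd_cycles_vertex (segment 0 n) \<or> two_odd_cycles_path (segment 0 n)"
proof (cases "j = n")
  case True
  \<comment> \<open>The graph is simple, so a walk of length 2 would run back and forth on one edge,
    which would then occur in both terms.\<close>
  have "n \<noteq> 2"
  proof
    assume n: "n = 2"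
    then have "ends (g 0) = {v 0, v 1}" "ends (g 1) = {v 1, v 2}"
      using trail by (auto simp: trail_def numeral_2_eq_2)
    then have "ends (g 0) = ends (g 1)"
      using closed n by auto
    then have "g 0 = g 1"
      using inj_ends by (simp add: inj_eq)
    then show False
      using even_edge[of 0] odd_edge[of 1] disjoint[of "g 0"] n by auto
  qed
  then have "n \<ge> 4"
    using n_pos n_even by presburger
  moreover have "inj_on v {Suc 0..n}"
  proof (rule linorder_inj_onI')
    fix s t
    assume "s \<in> {Suc 0..n}" "t \<in> {Suc 0..n}" "s < t"
    then show "v s \<noteq> v t"
      using simple[of s t] True by auto
  qed
  then have "inj_on v (set [Suc 0..<Suc n])"
    by (simp add: atLeastLessThanSuc_atLeastAtMost del: upt_Suc)
  then have "distinct (tl (segment 0 n))"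
    unfolding tl_segment by (simp add: distinct_map del: upt_Suc)
  ultimately have "even_cycle_walk (segment 0 n)"
    using n_even closed
    by (simp add: even_cycle_walk_def cycle_vs_def cycle_len_def length_segment hd_segment last_segment)
  then show ?thesis ..
next
  case False
  with j have "j < n"
    by simp
  have "odd j"
    using same_parity[of 0 j] j \<open>j < n\<close> by auto
  have visits_0: False if "j < t" "t < n" "v t = v 0" for t
    using that j by - (rule third_visit[of 0 j t], auto)
  \<comment> \<open>Lengths of returns after the first cycle; \<open>n - j\<close> is one, as
    positions \<open>j\<close> and \<open>n\<close> visit the same vertex.\<close>
  define D where "D d \<longleftrightarrow> (\<exists>k. j \<le> k \<and> k + d \<le> n \<and> 0 < d \<and> v k = v (k + d))" for d
  have "D (n - j)"
    unfolding D_def using j \<open>j < n\<close> closed by (intro exI[of _ j]) auto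
  define d where "d = (LEAST d. D d)"
  have "D d"
    unfolding d_def by (rule LeastI[of D "n - j", OF \<open>D (n - j)\<close>])
  then obtain k where k: "j \<le> k" "k + d \<le> n" "0 < d" "v k = v (k + d)"
    unfolding D_def by blast
  define l where "l = k + d"
  have l: "k < l" "l \<le> n" "v k = v l"
    using k by (auto simp: l_def)
  have simple2: "s = k \<and> t = l" if st: "k \<le> s" "s < t" "t \<le> l" "v s = v t" for s t
  proof -
    have "D (t - s)"
      unfolding D_def using st k l by (intro exI[of _ s]) auto
    then have "d \<le> t - s"
      unfolding d_def by (rule Least_le)
    with st show ?thesis
      by (auto simp: l_def)
  qed
  have "odd (l - k)"
    using same_parity[of k l] l k j by auto
  have c1: "cycle_vs (segment 0 j)" "odd (cycle_len (segment 0 j))"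
    by (intro odd_cycle_segment; use j \<open>odd j\<close> simple in auto)+
  have c2: "cycle_vs (segment k l)" "odd (cycle_len (segment k l))"
    by (intro odd_cycle_segment; use l \<open>odd (l - k)\<close> simple2 in auto)+
  show ?thesis
  proof (cases "k = j")
    case True
    have "l = n"
      using visits_0[of l] l j True by fastforce
    have "v s = v 0" if st: "s \<le> j" "j \<le> t" "t \<le> n" "v s = v t" for s t
    proof (rule ccontr)
      assume ne: "v s \<noteq> v 0"
      have "s \<noteq> 0"
        using ne by (rule contrapos_nn) simp
      moreover have "s \<noteq> j"
        using ne by (rule contrapos_nn) (simp add: j(3))
      moreover have "t \<noteq> j"
        using ne by (rule contrapos_nn) (simp add: st(4) j(3))
      moreover have "t \<noteq> n"
        using ne by (rule contrapos_nn) (simp add: st(4) closed)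
      ultimately show False
        using st j by - (rule noncrossing[of 0 s j t], auto)
    qed
    then have meet: "set (segment 0 j) \<inter> set (segment j n) = {hd (segment 0 j)}"
      using j \<open>j < n\<close> unfolding set_segment by (auto simp: hd_segment image_iff)
    have "two_odd_cycles_vertex (segment 0 n)"
      unfolding two_odd_cycles_vertex_def
    proof (intro exI conjI)
      show "segment 0 n = segment 0 j @ tl (segment j n)"
        using j by (simp add: segment_append)
      show "hd (segment j n) = hd (segment 0 j)"
        using j by (simp add: hd_segment)
      show "cycle_vs (segment j n)" "odd (cycle_len (segment j n))"
        using c2 unfolding True \<open>l = n\<close> by this+
    qed (rule c1 meet)+
    then show ?thesis
      by simp
  next
    case False
    then have "j < k"
      using k by simp
    moreover have "l < n"
    proof (rule ccontr)
      assume "\<not> l < n"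
      then have "v k = v 0"
        using l closed by simp
      then show False
        using \<open>j < k\<close> l by - (rule visits_0[of k], auto)
    qed
    ultimately have ord: "0 < j" "j < k" "k < l" "l < n"
      using j l by auto
    note path = two_cycles_with_path[OF ord j(3) l(3) \<open>odd j\<close> \<open>odd (l - k)\<close>]
    have rev: "rev (segment j k) = segment l n"
    proof (rule nth_equalityI)
      show "length (rev (segment j k)) = length (segment l n)"
        using path(1) ord by (simp add: length_segment)
      fix i
      assume "i < length (rev (segment j k))"
      then have i: "i \<le> k - j"
        by (simp add: length_segment)
      have "rev (segment j k) ! i = segment j k ! (k - j - i)"
        using i ord by (subst rev_nth) (auto simp: length_segment)
      also have "\<dots> = v (j + (k - j - i))"
        using ord by (intro segment_nth) auto
      also have "\<dots> = v (n - (k - j - i))"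
        by (rule path(2)) simp
      also have "n - (k - j - i) = l + i"
        using path(1) i ord by auto
      also have "v (l + i) = segment l n ! i"
        using path(1) i ord by (intro segment_nth[symmetric]) auto
      finally show "rev (segment j k) ! i = segment l n ! i" .
    qed
    have disj: False if st: "s \<le> j" "k \<le> t" "t \<le> l" "v s = v t" for s t
    proof -
      have ne: "v s \<noteq> v 0"
        using st ord j by - (rule notI, rule visits_0[of t], auto)
      have "s \<noteq> 0"
        using ne by (rule contrapos_nn) simp
      moreover have "s \<noteq> j"
        using ne by (rule contrapos_nn) (simp add: j(3))
      ultimately show False
        using st ord j by - (rule noncrossing[of 0 s j t], auto)
    qed
    have pc1: "t = j" if st: "s \<le> j" "j \<le> t" "t \<le> k" "v s = v t" for s t
    proof (rule ccontr)
      assume "t \<noteq> j"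
      have ne: "v s \<noteq> v 0"
        using \<open>t \<noteq> j\<close> st ord j by - (rule notI, rule visits_0[of t], auto)
      have "s \<noteq> 0"
        using ne by (rule contrapos_nn) simp
      moreover have "s \<noteq> j"
        using ne by (rule contrapos_nn) (simp add: j(3))
      ultimately show False
        using \<open>t \<noteq> j\<close> st ord j by - (rule noncrossing[of 0 s j t], auto)
    qed
    have pc2: "s = k" if st: "j \<le> s" "s \<le> k" "k \<le> t" "t \<le> l" "v s = v t" for s t
    proof (rule ccontr)
      assume "s \<noteq> k"
      then have "t \<noteq> k"
        using st ord l by - (rule notI, rule third_visit[of s k l], auto)
      moreover have "t \<noteq> l"
        using \<open>s \<noteq> k\<close> st ord l by - (rule notI, rule third_visit[of s k l], auto)
      ultimately show False
        using \<open>s \<noteq> k\<close> st ord l by - (rule noncrossing[of s k t l], auto)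
    qed
    \<comment> \<open>Each vertex of the path recurs on the way back, so a repetition within the
      path would be a third visit.\<close>
    have inj: "inj_on v {j..k}"
    proof (rule linorder_inj_onI')
      fix s t
      assume st: "s \<in> {j..k}" "t \<in> {j..k}" "s < t"
      show "v s \<noteq> v t"
      proof
        assume "v s = v t"
        have "v s = v (n - (s - j))"
          using path(2)[of "s - j"] st by auto
        moreover have "t < n - (s - j)"
          using path(1) st ord by auto
        ultimately show False
          using \<open>v s = v t\<close> st ord by - (rule third_visit[of s t "n - (s - j)"], auto)
      qed
    qed
    have "inj_on v (set [j..<Suc k])"
      using inj by (simp add: atLeastLessThanSuc_atLeastAtMost del: upt_Suc)
    then have "distinct (segment j k)"
      unfolding segment_def by (simp add: distinct_map del: upt_Suc)
    moreover have "set (segment 0 j) \<inter> set (segment k l) = {}"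
      unfolding set_segment using disj by fastforce
    moreover have "set (segment j k) \<inter> set (segment 0 j) = {v j}"
    proof -
      have "v j \<in> set (segment j k) \<inter> set (segment 0 j)"
        unfolding set_segment using ord by auto
      moreover have "x = v j" if "x \<in> set (segment j k) \<inter> set (segment 0 j)" for x
      proof -
        from that obtain s t where "s \<le> j" "j \<le> t" "t \<le> k" "x = v t" "x = v s"
          unfolding set_segment by auto
        with pc1[of s t] show ?thesis
          by simp
      qed
      ultimately show ?thesis
        by blast
    qed
    moreover have "set (segment j k) \<inter> set (segment k l) = {v k}"
    proof -
      have "v k \<in> set (segment j k) \<inter> set (segment k l)"
        unfolding set_segment using ord by auto
      moreover have "x = v k" if "x \<in> set (segment j k) \<inter> set (segment k l)" for x
      proof -
        from that obtain s t where "j \<le> s" "s \<le> k" "k \<le> t" "t \<le> l" "x = v s" "x = v t"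
          unfolding set_segment by auto
        with pc2[of s t] show ?thesis
          by simp
      qed
      ultimately show ?thesis
        by blast
    qed
    moreover have "segment 0 n = segment 0 j @ tl (segment j k) @ tl (segment k l) @ tl (rev (segment j k))"
    proof -
      have "segment 0 j @ tl (segment j k) @ tl (segment k l) @ tl (segment l n) =
          ((segment 0 j @ tl (segment j k)) @ tl (segment k l)) @ tl (segment l n)"
        by simp
      also have "\<dots> = segment 0 n"
        using ord by (simp only: segment_append less_imp_le zero_le)
      finally show ?thesis
        unfolding rev by simp
    qed
    moreover have "2 \<le> length (segment j k)"
      using ord by (simp add: length_segment)
    moreover have "hd (segment j k) = v j" "last (segment j k) = v k" "hd (segment 0 j) = v j" "hd (segment k l) = v k"
      using ord j(3) by (simp_all add: hd_segment last_segment)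
    ultimately have "two_odd_cycles_path (segment 0 n)"
      unfolding two_odd_cycles_path_def using c1 c2
      by - (rule exI[of _ "segment 0 j"], rule exI[of _ "segment j k"], rule exI[of _ "segment k l"],
          simp only: not_False_eq_True simp_thms)
    then show ?thesis
      by simp
  qed
qed

lemma list_mono_filter:
  "lookup (list_mono (map (\<lambda>i. map g [0..<n] ! i) (filter P [0..<length (map g [0..<n])]))) e =
     card {i\<in>{i\<in>{..<n}. P i}. g i = e}"
proof -
  let ?is = "filter P [0..<n]"
  have eq: "map (\<lambda>i. map g [0..<n] ! i) (filter P [0..<length (map g [0..<n])]) = map g ?is"
    by auto
  have "lookup (list_mono (map g ?is)) e = (\<Sum>t<length ?is. if g (?is ! t) = e then (1::nat) else 0)"
    by (simp add: list_mono_def lookup_sum lookup_single when_def del: One_nat_def)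
  also have "\<dots> = sum_list (map (\<lambda>i. if g i = e then 1 else 0) ?is)"
    by (simp add: sum_list_sum_nth atLeast0LessThan)
  also have "\<dots> = (\<Sum>i\<in>set ?is. if g i = e then 1 else 0)"
    by (rule sum_list_distinct_conv_sum_set) simp
  also have "\<dots> = card {i\<in>{i\<in>{..<n}. P i}. g i = e}"
    by (simp add: sum.If_cases Int_def conj_ac)
  finally show ?thesis
    unfolding eq .
qed

lemma circuit_walk:
  assumes j: "0 < j" "j \<le> n" "v 0 = v j"
    and simple: "\<And>s t. s < t \<Longrightarrow> t \<le> j \<Longrightarrow> v s = v t \<Longrightarrow> s = 0 \<and> t = j"
    and u: "\<And>e. lookup u e = a e" "\<And>e. lookup w e = b e"
  shows "\<exists>vs es. is_walk ends vs es \<and> (even_cycle_walk vs \<or> two_odd_cycles_vertex vs \<or> two_odd_cycles_path vs) \<and>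
           monom u - monom w = (walk_binomial es :: ('e, 'k::field) mpoly)"
proof (intro exI conjI)
  show "even_cycle_walk (segment 0 n) \<or> two_odd_cycles_vertex (segment 0 n) \<or> two_odd_cycles_path (segment 0 n)"
    by (rule classification[OF j simple])
  show "is_walk ends (segment 0 n) (map g [0..<n])"
    using trail unfolding is_walk_def trail_def
    by (auto simp: length_segment segment_nth)
  have "u = list_mono (map (\<lambda>i. map g [0..<n] ! i) (filter even [0..<length (map g [0..<n])]))"
    by (rule poly_mapping_eqI) (simp only: u count_a list_mono_filter)
  moreover have "w = list_mono (map (\<lambda>i. map g [0..<n] ! i) (filter odd [0..<length (map g [0..<n])]))"
    by (rule poly_mapping_eqI) (simp only: u count_b list_mono_filter)
  ultimately show "monom u - monom w = (walk_binomial (map g [0..<n]) :: ('e, 'k) mpoly)"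
    by (simp only: walk_binomial_def)
qed

end

text \<open>The walk is rotated to the start of a shortest return, so that its first cycle is
  simple. After an odd rotation the classification applies to the pair \<open>(b, a)\<close>, which
  yields the negative of the walk binomial.\<close>

lemma (in primitive_pair) primitive_pair_circuit:
  assumes u: "\<And>e. lookup u e = a e" "\<And>e. lookup w e = b e"
  shows "\<exists>vs es. is_walk ends vs es \<and> (even_cycle_walk vs \<or> two_odd_cycles_vertex vs \<or> two_odd_cycles_path vs) \<and>
           (monom u - monom w = (walk_binomial es :: ('e, 'k::field) mpoly) \<or>
            monom u - monom w = - (walk_binomial es :: ('e, 'k) mpoly))"
proof -
  obtain n v g where aw: "alternating_walk ends a b n v g"
    using ex_alternating_walk by blast
  then have n: "0 < n" "v n = v 0"
    by (auto simp: alternating_walk_def)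
  define D where "D d \<longleftrightarrow> (\<exists>k. k + d \<le> n \<and> 0 < d \<and> v k = v (k + d))" for d
  have "D n"
    unfolding D_def using n by (intro exI[of _ 0]) auto
  define j where "j = (LEAST d. D d)"
  have "D j"
    unfolding j_def by (rule LeastI[of D n, OF \<open>D n\<close>])
  then obtain r where r: "r + j \<le> n" "0 < j" "v r = v (r + j)"
    unfolding D_def by blast
  then have "r < n"
    by simp
  define v' where "v' = (\<lambda>t. v ((t + r) mod n))"
  define g' where "g' = (\<lambda>t. g ((t + r) mod n))"
  have v': "v' t = v (r + t)" if "t \<le> j" for t
    using that r n by (cases "r + t = n") (auto simp: v'_def add.commute)
  have cyc: "0 < j" "j \<le> n" "v' 0 = v' j"
    using r v' by auto
  have simple: "s = 0 \<and> t = j" if st: "s < t" "t \<le> j" "v' s = v' t" for s t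
  proof -
    have "v (r + s) = v (r + t)"
      using st v'[of s] v'[of t] by simp
    then have "D (t - s)"
      unfolding D_def using st r by (intro exI[of _ "r + s"]) auto
    then have "j \<le> t - s"
      unfolding j_def by (rule Least_le)
    with st show ?thesis
      by auto
  qed
  have rot: "if even r then alternating_walk ends a b n v' g' else alternating_walk ends b a n v' g'"
    unfolding v'_def g'_def by (rule alternating_walk_rotate[OF aw \<open>r < n\<close>])
  show ?thesis
  proof (cases "even r")
    case True
    then interpret w: primitive_walk ends a b n v' g'
      using rot by unfold_locales simp
    have "\<exists>vs es. is_walk ends vs es \<and> (even_cycle_walk vs \<or> two_odd_cycles_vertex vs \<or> two_odd_cycles_path vs) \<and>
           monom u - monom w = (walk_binomial es :: ('e, 'k) mpoly)"
      by (rule w.circuit_walk[OF cyc _ u]) (rule simple)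
    then show ?thesis
      by blast
  next
    case False
    interpret sw: primitive_pair ends b a
      by (rule swap)
    interpret w: primitive_walk ends b a n v' g'
      using rot False by unfold_locales simp
    have "\<exists>vs es. is_walk ends vs es \<and> (even_cycle_walk vs \<or> two_odd_cycles_vertex vs \<or> two_odd_cycles_path vs) \<and>
           monom w - monom u = (walk_binomial es :: ('e, 'k) mpoly)"
      by (rule w.circuit_walk[OF cyc _ u(2,1)]) (rule simple)
    then obtain vs es where "is_walk ends vs es" "even_cycle_walk vs \<or> two_odd_cycles_vertex vs \<or> two_odd_cycles_path vs"
      and eq: "monom w - monom u = (walk_binomial es :: ('e, 'k) mpoly)"
      by blast
    moreover have "monom u - monom w = - (walk_binomial es :: ('e, 'k) mpoly)"
      unfolding eq[symmetric] by simp
    ultimately show ?thesis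
      by blast
  qed
qed

theorem theorem5p1:
  fixes ends :: "'e::finite \<Rightarrow> 'v::finite set"
    and p :: "('e, 'k::field) mpoly"
  assumes "simple_graph ends"
    and "connected_graph ends"
    and "complete_intersection ends TYPE('k)"
    and "minimal_generator (toric_ideal ends) p"
  shows "\<exists>vs es. is_walk ends vs es \<and>
           (even_cycle_walk vs \<or> two_odd_cycles_vertex vs \<or> two_odd_cycles_path vs) \<and>
           (p = walk_binomial es \<or> p = - walk_binomial es)"
proof -
  let ?I = "toric_ideal ends :: ('e, 'k) mpoly set"
  have inj: "inj ends" and two: "card (ends e) = 2" for e
    using assms(1) by (auto simp: simple_graph_def)
  obtain gs :: "('e, 'k) mpoly list" where gs: "gen_ideal (set gs) = ?I" "enat (length gs) = ideal_height ?I"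
    using assms(3) unfolding complete_intersection_def by blast
  obtain B where B: "minimal_binomial_system ?I B" "p \<in> B"
    using assms(4) unfolding minimal_generator_def by blast
  have genB: "gen_ideal B = ?I" and irred: "\<And>b. b \<in> B \<Longrightarrow> b \<notin> gen_ideal (B - {b})"
    using B(1) minimal_system_irredundant[OF B(1)] by (auto simp: minimal_binomial_system_def)
  have "\<forall>q\<in>B. \<exists>uv. q = monom (fst uv) - monom (snd uv)"
    using B(1) unfolding minimal_binomial_system_def is_binomial_def by (metis fst_conv snd_conv)
  then have "\<exists>f. \<forall>q\<in>B. q = monom (fst (f q)) - monom (snd (f q))"
    by (rule bchoice)
  then obtain f where f: "\<forall>q\<in>B. q = monom (fst (f q)) - monom (snd (f q))"
    by (rule exE)
  define U where "U q = fst (f q)" for q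
  define V where "V q = snd (f q)" for q
  have rows: "q = monom (U q) - monom (V q)" if "q \<in> B" for q
    unfolding U_def V_def using f that by (rule bspec)
  have img: "mono_image ends (U q) = mono_image ends (V q)" if "q \<in> B" for q
  proof -
    have "q \<in> ?I"
      using gen_ideal_superset[of B] that genB by blast
    then have "monom (U q) - monom (V q) \<in> ?I"
      using rows[OF that] by (simp only:)
    then show ?thesis
      by (simp only: binomial_in_toric_ideal_iff)
  qed
  have bal_iff: "balanced ends (lookup u) (lookup v) \<longleftrightarrow> mono_image ends u = mono_image ends v" for u v
  proof -
    have "mono_image ends u = mono_image ends v \<longleftrightarrow> (\<forall>z. lookup (mono_image ends u) z = lookup (mono_image ends v) z)"
      by (auto intro: poly_mapping_eqI)
    then show ?thesis
      by (simp add: balanced_def lookup_mono_image)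
  qed
  have deg: "tdeg (U q) = tdeg (V q)" if "q \<in> B" for q
    using img[OF that] sum_mono_image[of ends "lookup (U q)"] sum_mono_image[of ends "lookup (V q)"] two
    unfolding bal_iff[symmetric] balanced_def tdeg_def by simp
  \<comment> \<open>The difference of equal monomials also counts as a binomial, but 0 is redundant
    in any system.\<close>
  have U_ne_V: "U q \<noteq> V q" if "q \<in> B" for q
  proof
    assume "U q = V q"
    with rows[OF that] have "q = 0"
      by simp
    then show False
      using irred[OF that] is_ideal_gen_ideal[of "B - {q}"] by (simp add: is_ideal_def)
  qed
  have nonzero: "tdeg (U q) \<noteq> 0" if "q \<in> B" for q
    using U_ne_V[OF that] deg[OF that] tdeg_eq_0_iff[of "U q"] tdeg_eq_0_iff[of "V q"] by auto
  have hom: "homogeneous (tdeg (U q)) q" if "q \<in> B" for q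
  proof -
    have "Poly_Mapping.keys q \<subseteq> {U q, V q}"
      by (subst rows[OF that]) (use keys_diff[of "monom (U q)" "monom (V q)"] in \<open>auto simp: monom_def split: if_splits\<close>)
    then show ?thesis
      using deg[OF that] by (auto simp: homogeneous_def)
  qed
  have cardT: "card T \<le> length gs" if "finite T" "T \<subseteq> B" for T
  proof -
    have "card T \<le> card (set gs)"
      using hom irred trans[OF gs(1) genB[symmetric]] that by (rule irredundant_homogeneous_system_card_le)
    also have "\<dots> \<le> length gs"
      by (rule card_length)
    finally show ?thesis .
  qed
  \<comment> \<open>A minimal system is not assumed finite; the bound on its finite subsets gives
    finiteness.\<close>
  have finB: "finite B"
  proof (rule ccontr)
    assume "infinite B"
    then obtain T where "finite T" "T \<subseteq> B" "card T = Suc (length gs)"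
      using infinite_arbitrarily_large by metis
    with cardT[of T] show False
      by simp
  qed
  interpret fm: fibre_moves ends B "\<lambda>q. lookup (U q)" "\<lambda>q. lookup (V q)"
  proof
    show "balanced ends (lookup (U q)) (lookup (V q))" if "q \<in> B" for q
      using img[OF that] by (simp add: bal_iff)
    show "\<exists>e. lookup (U q) e \<noteq> 0" if "q \<in> B" for q
      using nonzero[OF that] by (auto simp: tdeg_def)
    show "\<exists>e. lookup (V q) e \<noteq> 0" if "q \<in> B" for q
      using nonzero[OF that] unfolding deg[OF that] by (auto simp: tdeg_def)
    show "(x, y) \<in> (moves B (\<lambda>q. lookup (U q)) (\<lambda>q. lookup (V q)))\<^sup>*" if "balanced ends x y" for x y
    proof -
      have xy: "lookup (Abs_poly_mapping x) = x" "lookup (Abs_poly_mapping y) = y"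
        by simp_all
      have "mono_image ends (Abs_poly_mapping x) = mono_image ends (Abs_poly_mapping y)"
        using that by (simp flip: bal_iff)
      then have "monom (Abs_poly_mapping x) - monom (Abs_poly_mapping y) \<in> gen_ideal B"
        unfolding genB by (simp only: binomial_in_toric_ideal_iff)
      from binomial_in_gen_ideal_connected[OF rows this] show ?thesis
        unfolding xy .
    qed
  qed (use finB two in auto)
  interpret im: independent_moves ends B "\<lambda>q. lookup (U q)" "\<lambda>q. lookup (V q)"
  proof
    fix l q
    assume rel: "\<And>e. (\<Sum>q\<in>B. l q * fm.row q e) = 0" and "q \<in> B"
    \<comment> \<open>Here the complete intersection property enters: \<open>card B\<close> is at
      most the number of generators \<open>gs\<close>, which equals the height.\<close>
    have "card B \<le> CARD('e) - card Y" if "incidence_free ends Y" for Y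
    proof -
      have "enat (length gs) \<le> enat (CARD('e) - card Y)"
        unfolding gs(2) by (rule toric_ideal_height[OF that])
      then show ?thesis
        using cardT[OF finB] by simp
    qed
    then show "l q = 0"
      using rel \<open>q \<in> B\<close> by (rule fm.rows_independent)
  qed
  interpret pp: primitive_pair ends "lookup (U p)" "lookup (V p)"
  proof
    show "lookup (U p) e = 0 \<or> lookup (V p) e = 0" for e
      using im.row_sides_disjoint[OF B(2), of e] by (cases "lookup (U p) e = 0") simp_all
    show "\<exists>e. lookup (U p) e \<noteq> 0"
      by (rule fm.U_nonzero[OF B(2)])
    show "balanced ends (lookup (U p)) (lookup (V p))"
      by (rule fm.balanced_row[OF B(2)])
    show "(\<Sum>e\<in>UNIV. a' e) = 0 \<or> (\<Sum>e\<in>UNIV. a' e) = (\<Sum>e\<in>UNIV. lookup (U p) e)"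
      if "\<And>e. a' e \<le> lookup (U p) e" "\<And>e. b' e \<le> lookup (V p) e" "balanced ends a' b'" for a' b'
      using B(2) that by (rule im.row_primitive)
    show "\<exists>x::rat. \<forall>z. (\<Sum>e | z \<in> ends e. if lookup (U p) e \<noteq> 0 then of_int (l e) else 0) =
        x * (\<Sum>e | z \<in> ends e. of_nat (lookup (U p) e))"
      if "incidence_kernel ends l" "\<And>e. lookup (U p) e = 0 \<Longrightarrow> lookup (V p) e = 0 \<Longrightarrow> l e = 0" for l
      using B(2) that by (rule im.restriction_to_side)
  qed (use inj two in auto)
  have "\<exists>vs es. is_walk ends vs es \<and>
           (even_cycle_walk vs \<or> two_odd_cycles_vertex vs \<or> two_odd_cycles_path vs) \<and>
           (monom (U p) - monom (V p) = (walk_binomial es :: ('e, 'k) mpoly) \<or>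
            monom (U p) - monom (V p) = - (walk_binomial es :: ('e, 'k) mpoly))"
    by (rule pp.primitive_pair_circuit) (rule refl)+
  then show ?thesis
    unfolding rows[OF B(2), symmetric] .
qed

end
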